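(* Assume that $F$ is uniformly elliptic and positively $1$-homogeneous and that $g\in C^{\gamma}(\Sigma_0)$ (for some $\gamma\in(0,1)$) is almost periodic on $\Sigma_0$. For $\varepsilon>0$ let $u^\varepsilon$ be the unique bounded viscosity solution of $$F(D^2u^\varepsilon)=0\ \text{in}\ \Sigma^1,\qquad u^\varepsilon=0\ \text{on}\ \Sigma_1,\qquad \partial_\nu u^\varepsilon(x)=g\left(\tfrac{x}{\varepsilon}\right)\ \text{on}\ \Sigma_0 .$$ Then there exists a unique constant $\bar g\in\mathbb{R}$ (depending on $F$, $g$, and the choice to locate the auxiliary Dirichlet condition on $\Sigma_1$) such that $u^\varepsilon\to\bar u$ uniformly on $\overline{\Sigma^1}$ as $\varepsilon\to0$, where $\bar u$ is the unique bounded viscosity solution of $$F(D^2\bar u)=0\ \text{in}\ \Sigma^1,\qquad \bar u=0\ \text{on}\ \Sigma_1,\qquad \partial_\nu \bar u=\bar g\ \text{on}\ \Sigma_0 .$$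
   Context: Let $d\ge 1$ and let $\nu\in\mathbb{R}^{d+1}$ be a fixed unit vector. For $r>0$ set $\Sigma^r=\{X\in\mathbb{R}^{d+1}: 0<X\cdot\nu<r\}$, $\Sigma_r=\{X: X\cdot\nu=r\}$, $\Sigma_0=\{X: X\cdot\nu=0\}$. $\partial_\nu$ denotes the derivative in the direction $\nu$ (pointing into the strip on $\Sigma_0$). $C^\gamma(\Sigma_0)$ is the space of bounded functions with finite $\gamma$-Hölder norm. $F$ is a real-valued function on symmetric $(d+1)\times(d+1)$ matrices. Uniform ellipticity: for some $\Lambda\ge\lambda>0$, $\mathcal{M}^-(M-N)\le F(M)-F(N)\le\mathcal{M}^+(M-N)$ for all symmetric $M,N$, where $\mathcal{M}^-(M)=\inf_{\lambda \mathrm{Id}\le A\le\Lambda \mathrm{Id}}\mathrm{Tr}(AM)$ and $\mathcal{M}^+(M)=\sup_{\lambda \mathrm{Id}\le A\le\Lambda \mathrm{Id}}\mathrm{Tr}(AM)$ (Pucci operators). Positive $1$-homogeneity: $F(\alpha M)=\alpha F(M)$ for all $\alpha\ge0$. A function $f:\Sigma_0\to\mathbb{R}$ is almost periodic if it can be uniformly approximated on $\Sigma_0$ by trigonometric polynomials. Existence and uniqueness of bounded viscosity solutions of these boundary value problems are standard facts. Sign convention: subsolutions satisfy $F(D^2u)\ge0$. *)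

theory Defs
  imports "HOL-Analysis.Analysis"
begin

text \<open>
  The ambient space is \<open>real ^ 'n\<close> with \<open>CARD('n) = d + 1\<close>.  Functions on a hyperplane or on a
  strip are total functions of which only the values on that set are ever inspected.
\<close>

definition strip :: "real ^ 'n \<Rightarrow> real \<Rightarrow> (real ^ 'n) set" where
  "strip \<nu> r = {X. 0 < X \<bullet> \<nu> \<and> X \<bullet> \<nu> < r}"

definition hyperplane :: "real ^ 'n \<Rightarrow> real \<Rightarrow> (real ^ 'n) set" where
  "hyperplane \<nu> r = {X. X \<bullet> \<nu> = r}"


section \<open>The operator\<close>

definition symmetric_matrix :: "real ^ 'n ^ 'n \<Rightarrow> bool" where
  "symmetric_matrix M \<longleftrightarrow> transpose M = M"

text \<open>Symmetric \<open>A\<close> with \<open>\<lambda> Id \<le> A \<le> \<Lambda> Id\<close> in the order of quadratic forms.\<close>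

definition elliptic_matrices :: "real \<Rightarrow> real \<Rightarrow> (real ^ 'n ^ 'n) set" where
  "elliptic_matrices l L =
     {A. symmetric_matrix A \<and> (\<forall>x. l * (x \<bullet> x) \<le> x \<bullet> (A *v x) \<and> x \<bullet> (A *v x) \<le> L * (x \<bullet> x))}"

definition pucci_minus :: "real \<Rightarrow> real \<Rightarrow> real ^ 'n ^ 'n \<Rightarrow> real" where
  "pucci_minus l L M = (INF A\<in>elliptic_matrices l L. trace (A ** M))"

definition pucci_plus :: "real \<Rightarrow> real \<Rightarrow> real ^ 'n ^ 'n \<Rightarrow> real" where
  "pucci_plus l L M = (SUP A\<in>elliptic_matrices l L. trace (A ** M))"

text \<open>\<open>F\<close> matters on symmetric matrices only; its values elsewhere are unconstrained.\<close>

definition uniformly_elliptic :: "(real ^ 'n ^ 'n \<Rightarrow> real) \<Rightarrow> bool" where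
  "uniformly_elliptic F \<longleftrightarrow>
     (\<exists>l L. 0 < l \<and> l \<le> L \<and>
        (\<forall>M N. symmetric_matrix M \<longrightarrow> symmetric_matrix N \<longrightarrow>
           pucci_minus l L (M - N) \<le> F M - F N \<and> F M - F N \<le> pucci_plus l L (M - N)))"

definition positively_homogeneous :: "(real ^ 'n ^ 'n \<Rightarrow> real) \<Rightarrow> bool" where
  "positively_homogeneous F \<longleftrightarrow>
     (\<forall>M a. symmetric_matrix M \<longrightarrow> 0 \<le> a \<longrightarrow> F (a *\<^sub>R M) = a * F M)"


section \<open>The Neumann data\<close>

definition hoelder_space :: "real \<Rightarrow> (real ^ 'n) set \<Rightarrow> (real ^ 'n \<Rightarrow> real) set" where
  "hoelder_space \<gamma> S =
     {f. bounded (f ` S) \<and> (\<exists>C. \<forall>x\<in>S. \<forall>y\<in>S. \<bar>f x - f y\<bar> \<le> C * dist x y powr \<gamma>)}"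

definition trigonometric_polynomial :: "(real ^ 'n) set \<Rightarrow> (real ^ 'n \<Rightarrow> complex) \<Rightarrow> bool" where
  "trigonometric_polynomial S p \<longleftrightarrow>
     (\<exists>K c. finite K \<and> K \<subseteq> S \<and> p = (\<lambda>x. \<Sum>\<xi>\<in>K. c \<xi> * exp (\<i> * complex_of_real (\<xi> \<bullet> x))))"

text \<open>
  Meant for a linear subspace \<open>S\<close>, which is then its own space of frequencies.
\<close>

definition almost_periodic_on :: "(real ^ 'n) set \<Rightarrow> (real ^ 'n \<Rightarrow> real) \<Rightarrow> bool" where
  "almost_periodic_on S f \<longleftrightarrow>
     (\<forall>\<delta>>0. \<exists>p. trigonometric_polynomial S p \<and> (\<forall>x\<in>S. norm (complex_of_real (f x) - p x) \<le> \<delta>))"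


section \<open>Viscosity solutions\<close>

text \<open>\<open>\<phi>\<close> is twice continuously differentiable on \<open>U\<close> with gradient \<open>G\<close> and Hessian \<open>H\<close>.\<close>

definition C2_on ::
  "(real ^ 'n) set \<Rightarrow> (real ^ 'n \<Rightarrow> real) \<Rightarrow> (real ^ 'n \<Rightarrow> real ^ 'n) \<Rightarrow> (real ^ 'n \<Rightarrow> real ^ 'n ^ 'n) \<Rightarrow> bool"
where
  "C2_on U \<phi> G H \<longleftrightarrow>
     (\<forall>x\<in>U. (\<phi> has_derivative (\<lambda>v. G x \<bullet> v)) (at x) \<and> (G has_derivative (\<lambda>v. H x *v v)) (at x)) \<and>
     continuous_on U H"

text \<open>
  \<open>\<phi>\<close> touches \<open>u\<close> at \<open>x\<^sub>0\<close>, up to an additive constant and locally relative to the set \<open>D\<close>.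
\<close>

definition touches_from_above ::
  "(real ^ 'n) set \<Rightarrow> (real ^ 'n \<Rightarrow> real) \<Rightarrow> (real ^ 'n \<Rightarrow> real) \<Rightarrow> (real ^ 'n) set \<Rightarrow> real ^ 'n \<Rightarrow> bool"
where
  "touches_from_above D u \<phi> U x\<^sub>0 \<longleftrightarrow>
     open U \<and> x\<^sub>0 \<in> U \<and> (\<forall>x\<in>U \<inter> D. u x - \<phi> x \<le> u x\<^sub>0 - \<phi> x\<^sub>0)"

definition touches_from_below ::
  "(real ^ 'n) set \<Rightarrow> (real ^ 'n \<Rightarrow> real) \<Rightarrow> (real ^ 'n \<Rightarrow> real) \<Rightarrow> (real ^ 'n) set \<Rightarrow> real ^ 'n \<Rightarrow> bool"
where
  "touches_from_below D u \<phi> U x\<^sub>0 \<longleftrightarrow>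
     open U \<and> x\<^sub>0 \<in> U \<and> (\<forall>x\<in>U \<inter> D. u x\<^sub>0 - \<phi> x\<^sub>0 \<le> u x - \<phi> x)"

text \<open>
  The problem is \<open>F(D\<^sup>2u) = 0\<close> in the strip of width \<open>r\<close>, \<open>u = 0\<close> on its upper boundary and
  \<open>\<partial>\<^sub>\<nu>u = h\<close> on its lower boundary.  The Neumann condition is understood in the usual viscosity
  sense, in which at a boundary point either the boundary inequality or the equation may hold; since
  \<open>\<nu>\<close> points into the strip, a subsolution satisfies \<open>\<partial>\<^sub>\<nu>u \<ge> h\<close>.  The Dirichlet condition is
  pointwise.  Continuity on the closed strip is imposed once, in the definition of a solution.
\<close>

definition viscosity_subsolution ::
  "real ^ 'n \<Rightarrow> real \<Rightarrow> (real ^ 'n ^ 'n \<Rightarrow> real) \<Rightarrow> (real ^ 'n \<Rightarrow> real) \<Rightarrow> (real ^ 'n \<Rightarrow> real) \<Rightarrow> bool"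
where
  "viscosity_subsolution \<nu> r F h u \<longleftrightarrow>
     (\<forall>x\<^sub>0 U \<phi> G H. C2_on U \<phi> G H \<longrightarrow> touches_from_above (closure (strip \<nu> r)) u \<phi> U x\<^sub>0 \<longrightarrow>
        (x\<^sub>0 \<in> strip \<nu> r \<longrightarrow> F (H x\<^sub>0) \<ge> 0) \<and>
        (x\<^sub>0 \<in> hyperplane \<nu> 0 \<longrightarrow> F (H x\<^sub>0) \<ge> 0 \<or> G x\<^sub>0 \<bullet> \<nu> \<ge> h x\<^sub>0)) \<and>
     (\<forall>x\<in>hyperplane \<nu> r. u x \<le> 0)"

definition viscosity_supersolution ::
  "real ^ 'n \<Rightarrow> real \<Rightarrow> (real ^ 'n ^ 'n \<Rightarrow> real) \<Rightarrow> (real ^ 'n \<Rightarrow> real) \<Rightarrow> (real ^ 'n \<Rightarrow> real) \<Rightarrow> bool"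
where
  "viscosity_supersolution \<nu> r F h u \<longleftrightarrow>
     (\<forall>x\<^sub>0 U \<phi> G H. C2_on U \<phi> G H \<longrightarrow> touches_from_below (closure (strip \<nu> r)) u \<phi> U x\<^sub>0 \<longrightarrow>
        (x\<^sub>0 \<in> strip \<nu> r \<longrightarrow> F (H x\<^sub>0) \<le> 0) \<and>
        (x\<^sub>0 \<in> hyperplane \<nu> 0 \<longrightarrow> F (H x\<^sub>0) \<le> 0 \<or> G x\<^sub>0 \<bullet> \<nu> \<le> h x\<^sub>0)) \<and>
     (\<forall>x\<in>hyperplane \<nu> r. u x \<ge> 0)"

definition bounded_viscosity_solution ::
  "real ^ 'n \<Rightarrow> real \<Rightarrow> (real ^ 'n ^ 'n \<Rightarrow> real) \<Rightarrow> (real ^ 'n \<Rightarrow> real) \<Rightarrow> (real ^ 'n \<Rightarrow> real) \<Rightarrow> bool"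
where
  "bounded_viscosity_solution \<nu> r F h u \<longleftrightarrow>
     continuous_on (closure (strip \<nu> r)) u \<and> bounded (u ` closure (strip \<nu> r)) \<and>
     viscosity_subsolution \<nu> r F h u \<and> viscosity_supersolution \<nu> r F h u"

end

theory Submission
  imports Defs
begin

text \<open>
  Let \<open>S \<epsilon>\<close> and \<open>I \<epsilon>\<close> be the supremum and the infimum of \<open>u \<epsilon>\<close> on the lower boundary \<open>\<Sigma>\<^sub>0\<close>. Linear functions
  of \<open>x \<bullet> \<nu>\<close> solve the equation, and comparison with them (\<open>linear_barrier\<close>) gives
  \<open>I \<epsilon> (1 - x \<bullet> \<nu>) \<le> u \<epsilon> x \<le> S \<epsilon> (1 - x \<bullet> \<nu>)\<close>. So it is enough to show that \<open>S\<close> and \<open>I\<close> have a common limit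
  \<open>m\<close> as \<open>\<epsilon> \<rightarrow> 0\<close>; then \<open>u \<epsilon>\<close> converges uniformly to \<open>m (1 - x \<bullet> \<nu>)\<close>, and the effective slope is \<open>- m\<close>.

  The difference \<open>S - I\<close> tends to zero (\<open>boundary_oscillation_vanishes\<close>). Indeed, if \<open>\<tau>\<close> is an almost period of
  \<open>g\<close>, then \<open>u \<epsilon>\<close> and its translate by \<open>\<epsilon> \<tau>\<close> have almost the same Neumann data, and by the comparison
  principle (\<open>strip_comparison\<close>) they almost agree. Almost periods are relatively dense
  (\<open>almost_periods_relatively_dense\<close>), so the translates of a point of \<open>\<Sigma>\<^sub>0\<close> come within a distance of order
  \<open>\<epsilon>\<close> of any other point; the remaining distance is harmless, since the solutions have a common modulus of
  continuity along \<open>\<Sigma>\<^sub>0\<close> that depends on the data only through a bound for \<open>g\<close>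
  (\<open>tangential_equicontinuity\<close>).

  The quantities \<open>S \<epsilon>\<close> and \<open>I \<epsilon>\<close> are monotone in \<open>\<epsilon>\<close> (\<open>sup_boundary_value_monotone\<close>). For \<open>\<epsilon>' = s \<epsilon>\<close> with
  \<open>s \<le> 1\<close> the function \<open>u \<epsilon>' (s x) / s\<close> solves the equation with the same Neumann data as \<open>u \<epsilon>\<close>, and on the upper
  boundary it is at most \<open>S \<epsilon>' (1 - s) / s\<close>. Comparison gives \<open>S \<epsilon>' \<le> (1 - s) S \<epsilon>' + s S \<epsilon>\<close>, hence
  \<open>S \<epsilon>' \<le> S \<epsilon>\<close>; likewise \<open>I \<epsilon> \<le> I \<epsilon>'\<close>. Thus the intervals from \<open>I \<epsilon>\<close> to \<open>S \<epsilon>\<close> are nested and shrink to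
  a point.

  Both the comparison principle and the equicontinuity concern merely continuous viscosity solutions, and both
  are proved by doubling the variables (\<open>doubling_maximum_principle\<close>), which rests on the theorem on sums
  (\<open>sums_second_order\<close>). For the latter the two functions are replaced by \<open>C\<^sup>1\<^sup>,\<^sup>1\<close> envelopes (\<open>c11_envelope\<close>).
  The gradients of these are Lipschitz, hence differentiable almost everywhere (\<open>rademacher_vector\<close>), and a
  small linear tilt moves the maximum to a point where both envelopes have second-order expansions: the tilts for
  which this fails form the image of a null set under a Lipschitz map. Supersolutions are treated as subsolutions
  of the dual operator \<open>- F (- M)\<close> after a change of sign.
\<close>

section \<open>Lipschitz functions on the line\<close>

text \<open>
  The two measures add up to Lebesgue measure on intervals, and intervals determine a measure. What
  matters is the consequence that each of them is dominated by Lebesgue measure.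
\<close>

lemma interval_measure_add_eq_lborel:
  fixes F1 F2 :: "real \<Rightarrow> real"
  assumes mono: "mono F1" "mono F2" and cont: "continuous_on UNIV F1" "continuous_on UNIV F2"
    and sum: "\<And>x. F1 x + F2 x = x" and A: "A \<in> sets borel"
  shows "emeasure (interval_measure F1) A + emeasure (interval_measure F2) A = emeasure lborel A"
proof -
  define M where "M = measure_of UNIV (sets borel)
      (\<lambda>A. emeasure (interval_measure F1) A + emeasure (interval_measure F2) A)"
  have sets_M: "sets M = sets borel"
    unfolding M_def using sets.sets_measure_of_eq[of borel] by simp
  have em: "emeasure M A = emeasure (interval_measure F1) A + emeasure (interval_measure F2) A"
    if "A \<in> sets borel" for A
  proof (rule emeasure_measure_of[OF M_def])
    show "countably_additive (sets M)
       (\<lambda>A. emeasure (interval_measure F1) A + emeasure (interval_measure F2) A)"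
      unfolding countably_additive_def sets_M
      by (auto simp flip: suminf_add simp: suminf_emeasure)
  qed (use that sets_M in \<open>auto simp: positive_def\<close>)
  have Ioo: "emeasure (interval_measure F) {l<..<u} = F u - F l"
    if "mono F" "continuous_on UNIV F" "l \<le> u" for F :: "real \<Rightarrow> real" and l u
  proof -
    have m: "\<And>x y. x \<le> y \<Longrightarrow> F x \<le> F y" using that by (auto simp: mono_def)
    have c: "\<And>a. continuous (at_right a) F"
      using that(2) by (meson UNIV_I continuous_at_imp_continuous_at_within continuous_on_eq_continuous_at open_UNIV)
    have z: "emeasure (interval_measure F) {u} = 0"
      using emeasure_interval_measure_Icc[of u u F] m that(2) by auto
    have "emeasure (interval_measure F) {l<..u} = F u - F l"
      using emeasure_interval_measure_Ioc[of l u F] m c that by auto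
    moreover have "emeasure (interval_measure F) ({l<..u} - {u}) = emeasure (interval_measure F) {l<..u} - emeasure (interval_measure F) {u}" if "l < u"
      by (rule emeasure_Diff) (use z that in auto)
    moreover have "{l<..u} - {u} = {l<..<u}" by auto
    ultimately show ?thesis using z that by (cases "l = u") auto
  qed
  have "lborel = M"
  proof (rule lborel_eqI)
    fix l u :: real
    assume "\<And>b. b \<in> Basis \<Longrightarrow> l \<bullet> b \<le> u \<bullet> b"
    then have "l \<le> u" by simp
    moreover have "F1 l \<le> F1 u" "F2 l \<le> F2 u" using mono \<open>l \<le> u\<close> by (auto simp: mono_def)
    moreover have "F1 u - F1 l + (F2 u - F2 l) = u - l" using sum[of u] sum[of l] by simp
    ultimately show "emeasure M (box l u) = ennreal (\<Prod>b\<in>Basis. (u - l) \<bullet> b)"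
      using mono cont by (simp add: em Ioo flip: ennreal_plus)
  qed (simp add: sets_M)
  then show ?thesis using em[OF A] by simp
qed

text \<open>
  With a Lipschitz constant \<open>K\<close>, both \<open>(x + f x / K) / 2\<close> and \<open>(x - f x / K) / 2\<close> are nondecreasing and
  continuous, and they add up to \<open>x\<close>. The Stieltjes measure of the first one is therefore absolutely
  continuous with respect to Lebesgue measure, and its Radon-Nikodym density yields a density for \<open>f\<close>.
\<close>

lemma lipschitz_eq_indefinite_integral:
  fixes f :: "real \<Rightarrow> real"
  assumes lip: "\<And>x y. \<bar>f x - f y\<bar> \<le> C * \<bar>x - y\<bar>"
  obtains g where "\<And>a b. a \<le> b \<Longrightarrow> (g has_integral (f b - f a)) {a..b}"
proof -
  \<comment> \<open>Division by \<open>K\<close> needs a positive constant.\<close>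
  define K where "K = \<bar>C\<bar> + 1"
  have K: "K > 0" "\<And>x y. \<bar>f x - f y\<bar> \<le> K * \<bar>x - y\<bar>"
  proof -
    fix x y
    have "C * \<bar>x - y\<bar> \<le> K * \<bar>x - y\<bar>" unfolding K_def by (intro mult_right_mono) auto
    then show "\<bar>f x - f y\<bar> \<le> K * \<bar>x - y\<bar>" using lip[of x y] by linarith
  qed (simp add: K_def)
  define F1 F2 where "F1 = (\<lambda>x. (x + f x / K) / 2)" and "F2 = (\<lambda>x. (x - f x / K) / 2)"
  have fK: "\<bar>f x / K - f y / K\<bar> \<le> \<bar>x - y\<bar>" for x y
    using K(1) K(2)[of x y] by (simp add: divide_simps mult.commute flip: diff_divide_distrib)
  have m: "mono F1" "mono F2"
    unfolding mono_def F1_def F2_def using fK by (smt (verit, best) divide_right_mono)+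
  have cf: "continuous_on UNIV f"
    by (rule lipschitz_on_continuous_on[of K]) (use K in \<open>auto simp: lipschitz_on_def dist_real_def\<close>)
  have c: "continuous_on UNIV F1" "continuous_on UNIV F2"
    unfolding F1_def F2_def using cf K by (auto intro!: continuous_intros)
  have s: "F1 x + F2 x = x" for x unfolding F1_def F2_def by (simp add: field_simps)
  define \<mu> where "\<mu> = interval_measure F1"
  have "absolutely_continuous lborel \<mu>"
    unfolding absolutely_continuous_def
  proof
    fix A :: "real set" assume "A \<in> null_sets lborel"
    then have "A \<in> sets borel" "emeasure lborel A = 0" by auto
    then show "A \<in> null_sets \<mu>"
      using interval_measure_add_eq_lborel[OF m c s, of A] by (auto simp: \<mu>_def null_sets_def)
  qed
  then obtain \<rho> where \<rho>: "\<rho> \<in> borel_measurable lborel" "density lborel \<rho> = \<mu>"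
    using sigma_finite_measure.Radon_Nikodym[OF sigma_finite_lborel, of \<mu>] by (auto simp: \<mu>_def)
  define r where "r = (\<lambda>x. enn2real (\<rho> x))"
  have r: "(r has_integral (F1 b - F1 a)) {a..b}" if "a \<le> b" for a b
  proof -
    have "F1 a \<le> F1 b" using m(1) that by (auto simp: mono_def)
    have e: "emeasure \<mu> {a..b} = ennreal (F1 b - F1 a)"
      unfolding \<mu>_def using emeasure_interval_measure_Icc[of a b F1] m(1) c(1) that by (auto simp: mono_def)
    then have i: "(\<integral>\<^sup>+x. \<rho> x * indicator {a..b} x \<partial>lborel) = ennreal (F1 b - F1 a)"
      using \<rho> by (metis atLeastAtMost_borel emeasure_density sets_lborel)
    then have "AE x in lborel. \<rho> x * indicator {a..b} x \<noteq> \<infinity>"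
      using \<rho>(1) by (intro nn_integral_PInf_AE) auto
    then have "AE x in lborel. ennreal (r x * indicator {a..b} x) = \<rho> x * indicator {a..b} x"
      by eventually_elim (auto simp: r_def indicator_def less_top split: if_splits)
    then have "(\<integral>\<^sup>+x. ennreal (r x * indicator {a..b} x) \<partial>lborel) = ennreal (F1 b - F1 a)"
      using i by (simp cong: nn_integral_cong_AE)
    then have "((\<lambda>x. r x * indicator {a..b} x) has_integral (F1 b - F1 a)) UNIV"
      using \<rho>(1) \<open>F1 a \<le> F1 b\<close>
      by (intro nn_integral_has_integral) (auto simp: r_def indicator_def)
    moreover have "(\<lambda>x. r x * indicator {a..b} x) = (\<lambda>x. if x \<in> {a..b} then r x else 0)"
      by (auto simp: indicator_def)
    ultimately show ?thesis by (simp only: has_integral_restrict_UNIV)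
  qed
  show ?thesis
  proof (rule that)
    fix a b :: real assume "a \<le> b"
    have "((\<lambda>x. K * (2 * r x - 1)) has_integral (K * (2 * (F1 b - F1 a) - (b - a)))) {a..b}"
      using r[OF \<open>a \<le> b\<close>] has_integral_const_real[of "1::real" a b] \<open>a \<le> b\<close>
      by (intro has_integral_mult_right has_integral_diff) auto
    moreover have "K * (2 * (F1 b - F1 a) - (b - a)) = f b - f a"
      unfolding F1_def using K(1) by (simp add: field_simps)
    ultimately show "((\<lambda>x. K * (2 * r x - 1)) has_integral (f b - f a)) {a..b}" by simp
  qed
qed

text \<open>
  Lebesgue's differentiation theorem, applied to the density of \<open>f\<close>.
\<close>

lemma lipschitz_right_derivative_ae:
  fixes f :: "real \<Rightarrow> real"
  assumes lip: "\<And>x y. \<bar>f x - f y\<bar> \<le> C * \<bar>x - y\<bar>"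
  obtains N D where "negligible N"
    "\<And>x. x \<notin> N \<Longrightarrow> ((\<lambda>h. (f (x + h) - f x) / h) \<longlongrightarrow> D x) (at_right 0)"
proof -
  obtain g where g: "\<And>a b. a \<le> b \<Longrightarrow> (g has_integral (f b - f a)) {a..b}"
    using lipschitz_eq_indefinite_integral[of f C] lip by blast
  have int: "g integrable_on cbox a b" for a b
    using g[of a b] by (cases "a \<le> b") (auto simp: integrable_on_def)
  obtain N where N: "negligible N"
    "\<And>x e. x \<notin> N \<Longrightarrow> 0 < e \<Longrightarrow> \<exists>d>0. \<forall>h. 0 < h \<and> h < d \<longrightarrow>
            norm (integral (cbox x (x + h *\<^sub>R One)) g /\<^sub>R h ^ DIM(real) - g x) < e"
    using integrable_ccontinuous_explicit[of g, OF int] by blast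
  show ?thesis
  proof (rule that[OF N(1)])
    fix x assume "x \<notin> N"
    show "((\<lambda>h. (f (x + h) - f x) / h) \<longlongrightarrow> g x) (at_right 0)"
      unfolding tendsto_iff
    proof safe
      fix e :: real assume "e > 0"
      then obtain d where d: "d > 0" "\<And>h. 0 < h \<Longrightarrow> h < d \<Longrightarrow>
            norm (integral (cbox x (x + h *\<^sub>R One)) g /\<^sub>R h ^ DIM(real) - g x) < e"
        using N(2)[OF \<open>x \<notin> N\<close>] by blast
      show "\<forall>\<^sub>F h in at_right 0. dist ((f (x + h) - f x) / h) (g x) < e"
        unfolding eventually_at_right_field
      proof (intro exI[of _ d] conjI allI impI)
        fix h assume h: "0 < h" "h < d"
        have "integral {x..x+h} g = f (x + h) - f x"
          using g[of x "x+h"] h by (simp add: integral_unique)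
        then show "dist ((f (x + h) - f x) / h) (g x) < e"
          using d(2)[OF h] by (simp add: dist_real_def divide_inverse_commute)
      qed (use d in auto)
    qed
  qed
qed

section \<open>Rademacher's theorem\<close>

text \<open>
  Only the steps \<open>1 / (i + 1)\<close> are used: a sequence of continuous functions has a measurable set of
  convergence and a measurable limit, and the dominated convergence theorem applies to it. For Lipschitz
  functions these steps determine the one-sided derivative, see \<open>dir_quotient_tendsto_at_right\<close> below.
\<close>

definition dir_quotient :: "('a::real_normed_vector \<Rightarrow> real) \<Rightarrow> 'a \<Rightarrow> nat \<Rightarrow> 'a \<Rightarrow> real" where
  "dir_quotient f v i x = real (Suc i) * (f (x + v /\<^sub>R real (Suc i)) - f x)"

text \<open>
  Where the quotients diverge, this is the unspecified default value of \<open>lim\<close>.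
\<close>

definition dir_derivative :: "('a::real_normed_vector \<Rightarrow> real) \<Rightarrow> 'a \<Rightarrow> 'a \<Rightarrow> real" where
  "dir_derivative f v x = lim (\<lambda>i. dir_quotient f v i x)"

lemma dir_quotient_add:
  "dir_quotient f (v + w) i x = dir_quotient f v i x + dir_quotient f w i (x + v /\<^sub>R real (Suc i))"
  by (simp add: dir_quotient_def algebra_simps)

context
  fixes f :: "'a::euclidean_space \<Rightarrow> real" and C :: real
  assumes lip: "\<And>x y. \<bar>f x - f y\<bar> \<le> C * norm (x - y)"
begin

lemma lip_continuous: "continuous_on UNIV f"
proof -
  have "C * norm (x - y) \<le> \<bar>C\<bar> * norm (x - y)" for x y :: 'a
    by (intro mult_right_mono) auto
  then show ?thesis
    by (intro lipschitz_on_continuous_on[of "\<bar>C\<bar>"])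
      (auto simp: lipschitz_on_def dist_norm intro!: order_trans[OF lip])
qed

lemma dir_quotient_measurable [measurable]: "dir_quotient f v i \<in> borel_measurable borel"
  unfolding dir_quotient_def
  by (intro borel_measurable_continuous_onI continuous_intros
      continuous_on_compose2[OF lip_continuous]) auto

lemma lip_nonneg: "C \<ge> 0"
proof -
  obtain b :: 'a where "b \<in> Basis" using nonempty_Basis by blast
  then show ?thesis using order_trans[OF abs_ge_zero lip[of b 0]] by simp
qed

lemma dir_quotient_bound: "\<bar>dir_quotient f v i x\<bar> \<le> C * norm v"
proof -
  have "\<bar>dir_quotient f v i x\<bar> = real (Suc i) * \<bar>f (x + v /\<^sub>R real (Suc i)) - f x\<bar>"
    by (simp add: dir_quotient_def abs_mult)
  also have "\<dots> \<le> real (Suc i) * (C * norm (v /\<^sub>R real (Suc i)))"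
    by (intro mult_left_mono order_trans[OF lip]) (auto simp: lip_nonneg)
  also have "\<dots> = C * norm v" by (simp add: field_simps)
  finally show ?thesis .
qed

lemma dir_derivative_measurable [measurable]: "dir_derivative f v \<in> borel_measurable borel"
  unfolding dir_derivative_def by (rule borel_measurable_lim_metric) simp

text \<open>
  On each line in the direction \<open>v\<close> the exceptional set \<open>N\<close> is null by the one-dimensional result.
  Integrating the indicator of \<open>N\<close> at \<open>x + t v\<close> over \<open>x\<close> and \<open>t\<close> in both orders then shows that the
  measure of \<open>N\<close>, multiplied by the infinite length of the \<open>t\<close>-axis, is zero.
\<close>

lemma dir_quotient_convergent_ae: "negligible {x. \<not> convergent (\<lambda>i. dir_quotient f v i x)}"
proof -
  define N where "N = {x. \<not> convergent (\<lambda>i. dir_quotient f v i x)}"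
  have "{x \<in> space borel. Cauchy (\<lambda>i. dir_quotient f v i x)} \<in> sets borel"
    by (rule sets_Collect_Cauchy) simp
  then have "- {x. convergent (\<lambda>i. dir_quotient f v i x)} \<in> sets borel"
    by (simp add: Cauchy_convergent_iff)
  then have [measurable]: "N \<in> sets borel"
    by (simp add: N_def Collect_neg_eq)
  have line: "{t. x + t *\<^sub>R v \<in> N} \<in> null_sets lborel" for x
  proof -
    define \<phi> where "\<phi> = (\<lambda>t. f (x + t *\<^sub>R v))"
    have "\<bar>\<phi> s - \<phi> t\<bar> \<le> (C * norm v) * \<bar>s - t\<bar>" for s t
      using lip[of "x + s *\<^sub>R v" "x + t *\<^sub>R v"]
      by (simp add: \<phi>_def mult_ac flip: scaleR_diff_left)
    from lipschitz_right_derivative_ae[OF this] obtain N1 D where N1: "negligible N1"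
      and D: "\<And>t. t \<notin> N1 \<Longrightarrow> ((\<lambda>h. (\<phi> (t + h) - \<phi> t) / h) \<longlongrightarrow> D t) (at_right 0)" by blast
    have seq: "filterlim (\<lambda>i. 1 / real (Suc i)) (at_right 0) sequentially"
      unfolding filterlim_at
      using LIMSEQ_inverse_real_of_nat by (auto simp: inverse_eq_divide)
    have "{t. x + t *\<^sub>R v \<in> N} \<subseteq> N1"
    proof
      fix t assume t: "t \<in> {t. x + t *\<^sub>R v \<in> N}"
      show "t \<in> N1"
      proof (rule ccontr)
        assume "t \<notin> N1"
        from filterlim_compose[OF D[OF this] seq]
        have "(\<lambda>i. dir_quotient f v i (x + t *\<^sub>R v)) \<longlonglongrightarrow> D t"
          by (simp add: dir_quotient_def \<phi>_def algebra_simps inverse_eq_divide)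
        then show False using t by (auto simp: N_def convergent_def)
      qed
    qed
    then have "negligible {t. x + t *\<^sub>R v \<in> N}" using N1 negligible_subset by blast
    moreover have "{t. x + t *\<^sub>R v \<in> N} \<in> sets borel" by measurable
    ultimately show ?thesis by (metis negligible_iff_null_sets null_sets_completion_iff sets_lborel)
  qed
  have shift: "(\<integral>\<^sup>+x. indicator N (x + t *\<^sub>R v) \<partial>lborel) = emeasure lborel N" for t
  proof -
    have "emeasure lborel N = (\<integral>\<^sup>+x. indicator N x \<partial>(distr lborel borel ((+) (t *\<^sub>R v))))"
      by (simp add: lborel_distr_plus)
    also have "\<dots> = (\<integral>\<^sup>+x. indicator N (x + t *\<^sub>R v) \<partial>lborel)"
      by (subst nn_integral_distr) (auto simp: add.commute)
    finally show ?thesis by simp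
  qed
  have "emeasure lborel N * \<infinity> = (\<integral>\<^sup>+t. (\<integral>\<^sup>+x. indicator N (x + t *\<^sub>R v) \<partial>lborel) \<partial>(lborel :: real measure))"
    by (simp add: shift emeasure_lborel_UNIV)
  also have "\<dots> = (\<integral>\<^sup>+x. (\<integral>\<^sup>+t. indicator N (x + t *\<^sub>R v) \<partial>(lborel :: real measure)) \<partial>lborel)"
    by (rule lborel_pair.Fubini') measurable
  also have "\<dots> = (\<integral>\<^sup>+x. 0 \<partial>(lborel :: 'a measure))"
  proof (rule nn_integral_cong)
    fix x :: 'a
    have "(\<integral>\<^sup>+t. indicator N (x + t *\<^sub>R v) \<partial>(lborel :: real measure))
        = (\<integral>\<^sup>+t. indicator {t. x + t *\<^sub>R v \<in> N} t \<partial>lborel)"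
      by (intro nn_integral_cong) (auto simp: indicator_def)
    also have "\<dots> = emeasure lborel {t. x + t *\<^sub>R v \<in> N}"
      using line[of x] by (intro nn_integral_indicator) auto
    finally show "(\<integral>\<^sup>+t. indicator N (x + t *\<^sub>R v) \<partial>(lborel :: real measure)) = 0"
      using line[of x] by auto
  qed
  finally have "emeasure lborel N = 0" by (auto simp: ennreal_mult_eq_top_iff)
  then have "N \<in> null_sets lborel" by auto
  then show ?thesis by (simp add: N_def negligible_iff_null_sets null_sets_completionI)
qed

lemma dir_quotient_tendsto:
  assumes "x \<notin> {x. \<not> convergent (\<lambda>i. dir_quotient f v i x)}"
  shows "(\<lambda>i. dir_quotient f v i x) \<longlonglongrightarrow> dir_derivative f v x"
  using assms by (simp add: dir_derivative_def convergent_LIMSEQ_iff)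

lemma AE_dir_quotient_tendsto:
  "AE x in lborel. (\<lambda>i. dir_quotient f v i x) \<longlonglongrightarrow> dir_derivative f v x"
proof -
  have "AE x in lebesgue. x \<notin> {x. \<not> convergent (\<lambda>i. dir_quotient f v i x)}"
    using AE_not_in dir_quotient_convergent_ae[of v] unfolding negligible_iff_null_sets by blast
  then have "AE x in lborel. x \<notin> {x. \<not> convergent (\<lambda>i. dir_quotient f v i x)}"
    by (simp only: AE_completion_iff)
  then show ?thesis by eventually_elim (rule dir_quotient_tendsto)
qed

lemma integral_dir_quotient_tendsto:
  shows "integrable lborel (\<lambda>x. indicator (cbox a b) x * dir_derivative f v x)"
    and "(\<lambda>i. LINT x|lborel. indicator (cbox a b) x * dir_quotient f v i x)
      \<longlonglongrightarrow> (LINT x|lborel. indicator (cbox a b) x * dir_derivative f v x)"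
    and "\<And>i. integrable lborel (\<lambda>x. indicator (cbox a b) x * dir_quotient f v i x)"
proof -
  let ?w = "\<lambda>x. indicator (cbox a b) x * (C * norm v)"
  have w: "integrable lborel ?w" by (auto intro!: integrable_mult_left integrable_real_indicator emeasure_bounded_finite)
  have lim: "AE x in lborel. (\<lambda>i. indicator (cbox a b) x * dir_quotient f v i x)
      \<longlonglongrightarrow> indicator (cbox a b) x * dir_derivative f v x"
    using AE_dir_quotient_tendsto[of v] by eventually_elim (intro tendsto_intros)
  have bd: "AE x in lborel. norm (indicator (cbox a b) x * dir_quotient f v i x) \<le> ?w x" for i
    using dir_quotient_bound[of v i] by (auto simp: indicator_def)
  note dom = integrable_dominated_convergence[OF _ _ w lim bd]
    integrable_dominated_convergence2[OF _ _ w lim bd] integral_dominated_convergence[OF _ _ w lim bd]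
  show "integrable lborel (\<lambda>x. indicator (cbox a b) x * dir_derivative f v x)"
    "(\<lambda>i. LINT x|lborel. indicator (cbox a b) x * dir_quotient f v i x)
      \<longlonglongrightarrow> (LINT x|lborel. indicator (cbox a b) x * dir_derivative f v x)"
    "\<And>i. integrable lborel (\<lambda>x. indicator (cbox a b) x * dir_quotient f v i x)"
    by (rule dom; measurable)+
qed

text \<open>
  A small translation changes the indicator of a box only near its frontier, which is a null set.
\<close>

lemma integral_shifted_dir_quotient_tendsto_0:
  shows "(\<lambda>i. LINT x|lborel. indicator (cbox a b) (x - v /\<^sub>R real (Suc i)) * dir_quotient f w i x
              - indicator (cbox a b) x * dir_quotient f w i x) \<longlonglongrightarrow> 0"
    (is "(\<lambda>i. LINT x|lborel. ?g i x) \<longlonglongrightarrow> 0")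
proof -
  obtain R where R: "cbox a b \<subseteq> cball 0 R"
    using bounded_cbox[of a b] by (auto simp: bounded_pos subset_iff)
  let ?K = "cball (0::'a) (R + norm v)"
  let ?w = "\<lambda>x. indicator ?K x * (C * norm w)"
  have w: "integrable lborel ?w"
    by (auto intro!: integrable_mult_left integrable_real_indicator emeasure_bounded_finite)
  have s0: "(\<lambda>i. v /\<^sub>R real (Suc i)) \<longlonglongrightarrow> 0"
    using tendsto_scaleR[OF LIMSEQ_inverse_real_of_nat tendsto_const[of v]] by simp
  have "frontier (cbox a b) \<in> null_sets lborel"
    using negligible_convex_frontier[of "cbox a b"] negligible_iff_null_sets null_sets_completion_iff
    by (metis borel_closed convex_box(1) frontier_closed sets_lborel)
  then have "AE x in lborel. x \<notin> frontier (cbox a b)" by (rule AE_not_in)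
  then have lim: "AE x in lborel. (\<lambda>i. ?g i x) \<longlonglongrightarrow> 0"
  proof eventually_elim
    case (elim x)
    then consider "x \<in> interior (cbox a b)" | "x \<in> - cbox a b"
      by (auto simp: frontier_def)
    moreover have shift: "(\<lambda>i. x - v /\<^sub>R real (Suc i)) \<longlonglongrightarrow> x"
      using tendsto_diff[OF tendsto_const[of x] s0] by simp
    ultimately have ev: "\<forall>\<^sub>F i in sequentially. indicator (cbox a b) (x - v /\<^sub>R real (Suc i)) = (indicator (cbox a b) x :: real)"
    proof cases
      case 1
      have "\<forall>\<^sub>F i in sequentially. x - v /\<^sub>R real (Suc i) \<in> interior (cbox a b)"
        by (rule topological_tendstoD[OF shift open_interior 1])
      then show ?thesis
        by (rule eventually_mono)
          (use 1 interior_subset[of "cbox a b"] in \<open>auto simp: indicator_def simp del: interior_cbox\<close>)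
    next
      case 2
      have "\<forall>\<^sub>F i in sequentially. x - v /\<^sub>R real (Suc i) \<in> - cbox a b"
        by (rule topological_tendstoD[OF shift _ 2]) (auto intro: closed_cbox)
      then show ?thesis by (rule eventually_mono) (use 2 in \<open>auto simp: indicator_def\<close>)
    qed
    show ?case
      by (rule tendsto_eventually, rule eventually_mono[OF ev]) simp
  qed
  have bd: "AE x in lborel. norm (?g i x) \<le> ?w x" for i
  proof (rule AE_I2)
    fix x
    have "norm (v /\<^sub>R real (Suc i)) \<le> norm v" by (simp add: divide_simps mult_le_cancel_left1)
    moreover have "norm y \<le> R" if "y \<in> cbox a b" for y using R that by auto
    ultimately have out: "x \<notin> cbox a b" "x - v /\<^sub>R real (Suc i) \<notin> cbox a b" if "x \<notin> ?K"
      using that norm_triangle_sub[of x "v /\<^sub>R real (Suc i)"] norm_ge_zero[of v]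
      by (smt (verit) mem_cball_0)+
    show "norm (?g i x) \<le> ?w x"
    proof (cases "x \<in> ?K")
      case True
      have "\<bar>?g i x\<bar> \<le> \<bar>dir_quotient f w i x\<bar>" by (simp add: indicator_def)
      with True dir_quotient_bound[of w i x] show ?thesis by simp
    next
      case False
      with out show ?thesis by (simp add: indicator_def)
    qed
  qed
  have "(\<lambda>i. LINT x|lborel. ?g i x) \<longlonglongrightarrow> (LINT x|(lborel :: 'a measure). 0)"
    by (rule integral_dominated_convergence[OF _ _ w lim bd]) measurable
  then show ?thesis by simp
qed

text \<open>
  The quotient in the direction \<open>v + w\<close> is the quotient in the direction \<open>v\<close> plus that in the direction
  \<open>w\<close> at a shifted point. A change of variables moves the shift from the quotient to the box, where it
  disappears in the limit.
\<close>

lemma LINT_dir_derivative_add: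
  "(LINT x|lborel. indicator (cbox a b) x * dir_derivative f (v + w) x) =
   (LINT x|lborel. indicator (cbox a b) x * dir_derivative f v x) +
   (LINT x|lborel. indicator (cbox a b) x * dir_derivative f w x)"
proof -
  let ?I = "indicator (cbox a b) :: 'a \<Rightarrow> real"
  let ?s = "\<lambda>i. v /\<^sub>R real (Suc i)"
  have *: "(LINT x|lborel. ?I x * dir_quotient f (v + w) i x) =
      (LINT x|lborel. ?I x * dir_quotient f v i x) + (LINT x|lborel. ?I x * dir_quotient f w i x)
      + (LINT x|lborel. ?I (x - ?s i) * dir_quotient f w i x - ?I x * dir_quotient f w i x)" for i
  proof -
    have int1: "integrable lborel (\<lambda>x. ?I x * dir_quotient f w i (x + ?s i))"
      using Bochner_Integration.integrable_diff[OF integral_dir_quotient_tendsto(3)[of a b "v + w" i] integral_dir_quotient_tendsto(3)[of a b v i]]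
      by (simp add: dir_quotient_add algebra_simps)
    have "(LINT x|lborel. ?I (x - ?s i) * dir_quotient f w i x)
        = (LINT x|distr lborel borel ((+) (?s i)). ?I (x - ?s i) * dir_quotient f w i x)"
      by (simp add: lborel_distr_plus)
    also have "\<dots> = (LINT x|lborel. ?I x * dir_quotient f w i (x + ?s i))"
      by (subst integral_distr) (auto simp: add.commute)
    finally have eq: "(LINT x|lborel. ?I (x - ?s i) * dir_quotient f w i x)
      = (LINT x|lborel. ?I x * dir_quotient f w i (x + ?s i))" .
    have "integrable (distr lborel borel ((+) (?s i))) (\<lambda>x. ?I (x - ?s i) * dir_quotient f w i x)"
      by (subst integrable_distr_eq) (use int1 in \<open>auto simp: add.commute\<close>)
    then have int2: "integrable lborel (\<lambda>x. ?I (x - ?s i) * dir_quotient f w i x)"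
      by (simp add: lborel_distr_plus)
    have "(LINT x|lborel. ?I x * dir_quotient f (v + w) i x) =
      (LINT x|lborel. ?I x * dir_quotient f v i x) + (LINT x|lborel. ?I x * dir_quotient f w i (x + ?s i))"
      using integral_dir_quotient_tendsto(3)[of a b v i] int1
      by (simp add: dir_quotient_add distrib_left)
    then show ?thesis
      using integral_dir_quotient_tendsto(3)[of a b w i] int2 eq by simp
  qed
  have "(\<lambda>i. LINT x|lborel. ?I x * dir_quotient f (v + w) i x) \<longlonglongrightarrow>
      (LINT x|lborel. ?I x * dir_derivative f v x) + (LINT x|lborel. ?I x * dir_derivative f w x) + 0"
    unfolding * by (intro tendsto_add integral_dir_quotient_tendsto(2) integral_shifted_dir_quotient_tendsto_0)
  from LIMSEQ_unique[OF integral_dir_quotient_tendsto(2) this] show ?thesis by simp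
qed

text \<open>
  The defect of additivity has integral zero over every box, so it vanishes at its Lebesgue points.
\<close>

lemma dir_derivative_add_ae:
  obtains N where "negligible N"
    "\<And>x. x \<notin> N \<Longrightarrow> dir_derivative f (v + w) x = dir_derivative f v x + dir_derivative f w x"
proof -
  define g where "g = (\<lambda>x. dir_derivative f (v + w) x - dir_derivative f v x - dir_derivative f w x)"
  have g: "g integrable_on cbox a b \<and> integral (cbox a b) g = 0" for a b
  proof -
    have si: "set_integrable lborel (cbox a b) (dir_derivative f u)" for u
      using integral_dir_quotient_tendsto(1)[of a b u] by (simp add: set_integrable_def)
    have "integral (cbox a b) (dir_derivative f u)
        = (LINT x|lborel. indicator (cbox a b) x * dir_derivative f u x)" for u
      using set_borel_integral_eq_integral(2)[OF si] by (simp add: set_lebesgue_integral_def)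
    with set_borel_integral_eq_integral(1)[OF si] LINT_dir_derivative_add[of a b v w] show ?thesis
      unfolding g_def by (simp add: integral_diff integrable_diff)
  qed
  obtain N where N: "negligible N"
    "\<And>x e. x \<notin> N \<Longrightarrow> 0 < e \<Longrightarrow> \<exists>d>0. \<forall>h. 0 < h \<and> h < d \<longrightarrow>
            norm (integral (cbox x (x + h *\<^sub>R One)) g /\<^sub>R h ^ DIM('a) - g x) < e"
    using integrable_ccontinuous_explicit[of g] g by blast
  show ?thesis
  proof (rule that[OF N(1)])
    fix x assume x: "x \<notin> N"
    have "\<bar>g x\<bar> < e" if "e > 0" for e
    proof -
      obtain d where d: "d > 0" "\<forall>h. 0 < h \<and> h < d \<longrightarrow>
            norm (integral (cbox x (x + h *\<^sub>R One)) g /\<^sub>R h ^ DIM('a) - g x) < e"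
        using N(2)[OF x \<open>e > 0\<close>] by blast
      then show ?thesis using d(2)[rule_format, of "d/2"] g by simp
    qed
    from this[of "\<bar>g x\<bar>"] have "g x = 0" by force
    then show "dir_derivative f (v + w) x = dir_derivative f v x + dir_derivative f w x"
      by (simp add: g_def)
  qed
qed

text \<open>
  For a step \<open>h\<close> between \<open>1 / (m + 1)\<close> and \<open>1 / m\<close>, the quotients with the steps \<open>h\<close> and \<open>1 / m\<close> differ by at
  most \<open>2 K / m\<close>, where \<open>K\<close> is the Lipschitz constant along the line.
\<close>

lemma dir_quotient_tendsto_at_right:
  assumes lim: "(\<lambda>i. dir_quotient f v i x) \<longlonglongrightarrow> l"
  shows "((\<lambda>h. (f (x + h *\<^sub>R v) - f x) / h) \<longlongrightarrow> l) (at_right 0)"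
proof -
  define G where "G = (\<lambda>h. f (x + h *\<^sub>R v) - f x)"
  define K where "K = C * norm v"
  have K: "K \<ge> 0" by (simp add: K_def lip_nonneg)
  have GL: "\<bar>G s - G t\<bar> \<le> K * \<bar>s - t\<bar>" for s t
    using lip[of "x + s *\<^sub>R v" "x + t *\<^sub>R v"]
    by (simp add: G_def K_def mult_ac flip: scaleR_diff_left)
  have G0: "G 0 = 0" by (simp add: G_def)
  define k where "k = (\<lambda>h::real. nat \<lfloor>1 / h\<rfloor>)"
  have est: "\<bar>G h / h - real (k h) * G (1 / real (k h))\<bar> \<le> 2 * K / real (k h)" if h: "0 < h" "h < 1" for h
  proof -
    define m where "m = real (k h)"
    have "1 / h \<ge> 1" using h by simp
    then have "\<lfloor>1 / h\<rfloor> \<ge> 1" by simp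
    then have m: "m \<ge> 1" "m \<le> 1 / h" "1 / h < m + 1"
      unfolding m_def k_def by linarith+
    have mh: "m * h \<le> 1" "1 < (m + 1) * h" using m h by (simp_all add: field_simps)
    have "G h / h - m * G (1 / m) = (G h - G (1 / m)) / h + (G (1 / m) - G 0) * (1 / h - m)"
      using h by (simp add: G0 field_simps)
    also have "\<bar>\<dots>\<bar> \<le> \<bar>G h - G (1 / m)\<bar> / h + \<bar>G (1 / m) - G 0\<bar> * (1 / h - m)"
      using m h by (intro order_trans[OF abs_triangle_ineq]) (simp add: abs_mult)
    also have "\<dots> \<le> K * \<bar>h - 1 / m\<bar> / h + K * \<bar>1 / m - 0\<bar> * (1 / h - m)"
      using m h by (intro add_mono divide_right_mono mult_right_mono GL) auto
    also have "\<bar>h - 1 / m\<bar> = 1 / m - h" using mh m by (simp add: field_simps)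
    also have "K * (1 / m - h) / h \<le> K / m"
    proof -
      have "(1 / m - h) / h = (1 - m * h) / (m * h)" using m h by (simp add: field_simps)
      also have "\<dots> \<le> h / (m * h)" using mh m h by (intro divide_right_mono) (auto simp: algebra_simps)
      also have "\<dots> = 1 / m" using h by simp
      finally have "(1 / m - h) / h \<le> 1 / m" .
      from mult_left_mono[OF this K] show ?thesis by simp
    qed
    also have "K * \<bar>1 / m - 0\<bar> * (1 / h - m) \<le> K * \<bar>1 / m - 0\<bar> * 1"
      using m h K by (intro mult_left_mono) auto
    finally show ?thesis using m by (simp add: m_def)
  qed
  have k_lim: "filterlim k sequentially (at_right 0)"
  proof -
    have "filterlim (\<lambda>h::real. 1 / h) at_top (at_right 0)"
      using filterlim_inverse_at_top_right by (simp add: inverse_eq_divide)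
    then have "filterlim (\<lambda>h::real. \<lfloor>1 / h\<rfloor>) at_top (at_right 0)"
      by (rule filterlim_compose[OF filterlim_floor_sequentially])
    then show ?thesis unfolding k_def
      by (rule filterlim_compose[OF filterlim_nat_sequentially])
  qed
  have "(\<lambda>m. real m * G (1 / real m)) \<longlonglongrightarrow> l"
    by (subst filterlim_sequentially_Suc[symmetric])
       (use lim in \<open>simp add: dir_quotient_def G_def inverse_eq_divide\<close>)
  from filterlim_compose[OF this k_lim]
  have l1: "((\<lambda>h. real (k h) * G (1 / real (k h))) \<longlongrightarrow> l) (at_right 0)" .
  have "(\<lambda>m. 2 * K / real m) \<longlonglongrightarrow> 0" by (rule lim_const_over_n)
  from filterlim_compose[OF this k_lim]
  have "((\<lambda>h. 2 * K / real (k h)) \<longlongrightarrow> 0) (at_right 0)" .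
  moreover have "\<forall>\<^sub>F h in at_right 0. norm (G h / h - real (k h) * G (1 / real (k h))) \<le> 2 * K / real (k h)"
    unfolding eventually_at_right_field using est by (intro exI[of _ 1]) auto
  ultimately have "((\<lambda>h. G h / h - real (k h) * G (1 / real (k h))) \<longlongrightarrow> 0) (at_right 0)"
    by (rule Lim_null_comparison[rotated])
  from tendsto_add[OF this l1] show ?thesis by (simp add: G_def)
qed

lemma dir_derivative_scale:
  assumes c: "c > 0" and conv: "x \<notin> {x. \<not> convergent (\<lambda>i. dir_quotient f v i x)}"
    "x \<notin> {x. \<not> convergent (\<lambda>i. dir_quotient f (c *\<^sub>R v) i x)}"
  shows "dir_derivative f (c *\<^sub>R v) x = c * dir_derivative f v x"
proof -
  have "((\<lambda>h. (f (x + h *\<^sub>R v) - f x) / h) \<longlongrightarrow> dir_derivative f v x) (at_right 0)"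
    by (rule dir_quotient_tendsto_at_right[OF dir_quotient_tendsto[OF conv(1)]])
  moreover have "filterlim (\<lambda>h. c * h) (at_right 0) (at_right 0)"
    unfolding filterlim_at using c
    by (auto simp: eventually_at_right_field intro!: tendsto_eq_intros exI[of _ 1])
  ultimately have "((\<lambda>h. (f (x + (c * h) *\<^sub>R v) - f x) / (c * h)) \<longlongrightarrow> dir_derivative f v x) (at_right 0)"
    by (rule filterlim_compose)
  from tendsto_mult[OF tendsto_const[of c] this]
  have "((\<lambda>h. (f (x + h *\<^sub>R (c *\<^sub>R v)) - f x) / h) \<longlongrightarrow> c * dir_derivative f v x) (at_right 0)"
    using c by (simp add: mult.commute)
  moreover have "((\<lambda>h. (f (x + h *\<^sub>R (c *\<^sub>R v)) - f x) / h) \<longlongrightarrow> dir_derivative f (c *\<^sub>R v) x) (at_right 0)"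
    by (rule dir_quotient_tendsto_at_right[OF dir_quotient_tendsto[OF conv(2)]])
  ultimately show ?thesis
    by (intro tendsto_unique[OF trivial_limit_at_right_real])
qed

text \<open>
  A negative factor \<open>c\<close> is reduced to \<open>- c\<close> by additivity for the pair \<open>c v\<close>, \<open>- c v\<close>.
\<close>

lemma dir_derivative_scale_ae:
  obtains N where "negligible N" "\<And>x. x \<notin> N \<Longrightarrow> dir_derivative f (c *\<^sub>R v) x = c * dir_derivative f v x"
proof -
  define E where "E u = {x. \<not> convergent (\<lambda>i. dir_quotient f u i x)}" for u
  have E: "negligible (E u)" for u unfolding E_def by (rule dir_quotient_convergent_ae)
  have zero: "dir_derivative f 0 x = 0" for x
    by (simp add: dir_derivative_def dir_quotient_def)
  consider "c = 0" | "c > 0" | "c < 0" by linarith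
  then show ?thesis
  proof cases
    case 1
    then show ?thesis using that[of "{}"] zero by simp
  next
    case 2
    show ?thesis
      by (rule that[of "E v \<union> E (c *\<^sub>R v)"])
        (use E dir_derivative_scale[OF 2] in \<open>auto simp: E_def\<close>)
  next
    case 3
    obtain N where N: "negligible N"
      "\<And>x. x \<notin> N \<Longrightarrow> dir_derivative f (c *\<^sub>R v + (-c) *\<^sub>R v) x = dir_derivative f (c *\<^sub>R v) x + dir_derivative f ((-c) *\<^sub>R v) x"
      using dir_derivative_add_ae[of "c *\<^sub>R v" "(-c) *\<^sub>R v"] by blast
    show ?thesis
    proof (rule that[of "N \<union> E v \<union> E ((-c) *\<^sub>R v)"])
      fix x assume x: "x \<notin> N \<union> E v \<union> E ((-c) *\<^sub>R v)"
      then have "dir_derivative f ((-c) *\<^sub>R v) x = (-c) * dir_derivative f v x"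
        using 3 by (intro dir_derivative_scale) (auto simp: E_def)
      with N(2)[of x] x zero show "dir_derivative f (c *\<^sub>R v) x = c * dir_derivative f v x" by simp
    qed (use N E in auto)
  qed
qed

lemma dir_derivative_linear_ae:
  obtains N where "negligible N"
    "\<And>x. x \<notin> N \<Longrightarrow> dir_derivative f v x = v \<bullet> (\<Sum>b\<in>Basis. dir_derivative f b x *\<^sub>R b)"
proof -
  have "\<exists>N. negligible N \<and> (\<forall>x. x \<notin> N \<longrightarrow>
      dir_derivative f (\<Sum>b\<in>S. c b *\<^sub>R b) x = (\<Sum>b\<in>S. c b * dir_derivative f b x))"
    if "finite S" for S :: "'a set" and c :: "'a \<Rightarrow> real"
    using that
  proof (induction S)
    case empty
    show ?case by (intro exI[of _ "{}"]) (simp add: dir_derivative_def dir_quotient_def)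
  next
    case (insert b S)
    then obtain N1 where N1: "negligible N1" "\<And>x. x \<notin> N1 \<Longrightarrow>
      dir_derivative f (\<Sum>b\<in>S. c b *\<^sub>R b) x = (\<Sum>b\<in>S. c b * dir_derivative f b x)" by blast
    obtain N2 where N2: "negligible N2" "\<And>x. x \<notin> N2 \<Longrightarrow> dir_derivative f (c b *\<^sub>R b) x = c b * dir_derivative f b x"
      using dir_derivative_scale_ae by blast
    obtain N3 where N3: "negligible N3" "\<And>x. x \<notin> N3 \<Longrightarrow> dir_derivative f (c b *\<^sub>R b + (\<Sum>b\<in>S. c b *\<^sub>R b)) x
       = dir_derivative f (c b *\<^sub>R b) x + dir_derivative f (\<Sum>b\<in>S. c b *\<^sub>R b) x"
      using dir_derivative_add_ae by blast
    show ?case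
      by (rule exI[of _ "N1 \<union> N2 \<union> N3"]) (use N1 N2 N3 insert.hyps in auto)
  qed
  from this[of Basis "\<lambda>b. v \<bullet> b"] obtain N where N: "negligible N" "\<And>x. x \<notin> N \<Longrightarrow>
      dir_derivative f (\<Sum>b\<in>Basis. (v \<bullet> b) *\<^sub>R b) x = (\<Sum>b\<in>Basis. (v \<bullet> b) * dir_derivative f b x)"
    by auto
  show ?thesis
    by (rule that[OF N(1)]) (use N(2) in \<open>simp add: euclidean_representation inner_sum_right mult.commute\<close>)
qed

text \<open>
  Outside a null set the derivatives along a countable dense set of directions exist and are given by one
  linear form. On the unit sphere finitely many of these directions come within \<open>e1\<close> of every other one,
  and the Lipschitz condition carries the estimate over, uniformly in the direction.
\<close>

theorem rademacher:
  obtains N where "negligible N" "\<And>x. x \<notin> N \<Longrightarrow> f differentiable (at x)"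
proof -
  obtain V :: "'a set" where V: "countable V" "\<And>X. open X \<Longrightarrow> X \<noteq> {} \<Longrightarrow> \<exists>v\<in>V. v \<in> X"
    using countable_dense_setE by metis
  define L where "L x = (\<Sum>b\<in>Basis. dir_derivative f b x *\<^sub>R b)" for x
  have "\<forall>v. \<exists>N. negligible N \<and> (\<forall>x. x \<notin> N \<longrightarrow> dir_derivative f v x = v \<bullet> L x)"
    unfolding L_def using dir_derivative_linear_ae by metis
  then obtain N1 where N1: "\<And>v. negligible (N1 v)" "\<And>v x. x \<notin> N1 v \<Longrightarrow> dir_derivative f v x = v \<bullet> L x"
    by metis
  define E where "E u = {x. \<not> convergent (\<lambda>i. dir_quotient f u i x)}" for u
  have E: "negligible (E u)" for u unfolding E_def by (rule dir_quotient_convergent_ae)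
  define N where "N = (\<Union>v\<in>V. N1 v \<union> E v)"
  have "negligible N"
    unfolding N_def using V(1) N1 E by (intro negligible_countable_Union) auto
  moreover have "f differentiable (at x)" if "x \<notin> N" for x
  proof -
    have lim: "((\<lambda>h. (f (x + h *\<^sub>R v) - f x) / h) \<longlongrightarrow> v \<bullet> L x) (at_right 0)" if "v \<in> V" for v
      using dir_quotient_tendsto_at_right[OF dir_quotient_tendsto[of x v]] N1(2)[of x v] \<open>x \<notin> N\<close> that
      by (auto simp: N_def E_def)
    have "(f has_derivative (\<lambda>h. h \<bullet> L x)) (at x)"
      unfolding has_derivative_at_alt
    proof (intro conjI allI impI)
      show "bounded_linear (\<lambda>h. h \<bullet> L x)" by (rule bounded_linear_inner_left)
      fix e :: real assume "e > 0"
      \<comment> \<open>With this value the three errors estimated below add up to \<open>e * t\<close>.\<close>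
      define e1 where "e1 = e / (C + 1 + norm (L x))"
      have CL: "C + 1 + norm (L x) > 0" using lip_nonneg norm_ge_zero[of "L x"] by linarith
      have "e1 > 0" using \<open>e > 0\<close> CL by (simp add: e1_def)
      have "sphere (0::'a) 1 \<subseteq> (\<Union>v\<in>V. ball v e1)"
      proof
        fix u :: 'a
        obtain v where "v \<in> V" "v \<in> ball u e1" using V(2)[of "ball u e1"] \<open>e1 > 0\<close> by auto
        then show "u \<in> (\<Union>v\<in>V. ball v e1)" by (auto simp: dist_commute)
      qed
      then obtain W where W: "W \<subseteq> V" "finite W" "sphere (0::'a) 1 \<subseteq> (\<Union>v\<in>W. ball v e1)"
        by (rule compactE_image[OF compact_sphere, rotated]) auto
      have "\<forall>\<^sub>F h in at_right 0. \<forall>v\<in>W. \<bar>(f (x + h *\<^sub>R v) - f x) / h - v \<bullet> L x\<bar> < e1"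
        using W lim \<open>e1 > 0\<close> by (intro eventually_ball_finite) (auto simp: tendsto_iff dist_real_def)
      then obtain d where d: "d > 0" "\<And>h v. 0 < h \<Longrightarrow> h < d \<Longrightarrow> v \<in> W \<Longrightarrow> \<bar>(f (x + h *\<^sub>R v) - f x) / h - v \<bullet> L x\<bar> < e1"
        unfolding eventually_at_right_field by auto
      show "\<exists>d>0. \<forall>y. norm (y - x) < d \<longrightarrow> norm (f y - f x - (y - x) \<bullet> L x) \<le> e * norm (y - x)"
      proof (intro exI[of _ d] conjI d(1) allI impI)
        fix y assume y: "norm (y - x) < d"
        show "norm (f y - f x - (y - x) \<bullet> L x) \<le> e * norm (y - x)"
        proof (cases "y = x")
          case False
          define t where "t = norm (y - x)"
          define u where "u = (y - x) /\<^sub>R t"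
          have t: "t > 0" "t < d" using False y by (auto simp: t_def)
          have yu: "y = x + t *\<^sub>R u" using t by (simp add: u_def)
          have "u \<in> sphere 0 1" using t by (simp add: u_def t_def)
          then obtain v where v: "v \<in> W" "norm (u - v) < e1"
            using W(3) by (auto simp: dist_norm norm_minus_commute)
          have "t * ((f (x + t *\<^sub>R v) - f x) / t - v \<bullet> L x) = f (x + t *\<^sub>R v) - f x - t * (v \<bullet> L x)"
            using t by (subst right_diff_distrib) simp
          then have "f y - f x - (y - x) \<bullet> L x =
             (f (x + t *\<^sub>R u) - f (x + t *\<^sub>R v)) + t * ((f (x + t *\<^sub>R v) - f x) / t - v \<bullet> L x) + t * ((v - u) \<bullet> L x)"
            by (simp add: yu inner_diff_left right_diff_distrib)
          also have "\<bar>\<dots>\<bar> \<le> \<bar>f (x + t *\<^sub>R u) - f (x + t *\<^sub>R v)\<bar>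
              + t * \<bar>(f (x + t *\<^sub>R v) - f x) / t - v \<bullet> L x\<bar> + t * \<bar>(v - u) \<bullet> L x\<bar>"
            using t by (intro order_trans[OF abs_triangle_ineq] add_mono) (auto simp: abs_mult)
          also have "\<dots> \<le> C * (t * e1) + t * e1 + t * (e1 * norm (L x))"
          proof (intro add_mono)
            have "\<bar>f (x + t *\<^sub>R u) - f (x + t *\<^sub>R v)\<bar> \<le> C * (t * norm (u - v))"
              using lip[of "x + t *\<^sub>R u" "x + t *\<^sub>R v"] t by (simp flip: scaleR_diff_right)
            also have "\<dots> \<le> C * (t * e1)" using lip_nonneg t v by (intro mult_left_mono) auto
            finally show "\<bar>f (x + t *\<^sub>R u) - f (x + t *\<^sub>R v)\<bar> \<le> C * (t * e1)" .
            show "t * \<bar>(f (x + t *\<^sub>R v) - f x) / t - v \<bullet> L x\<bar> \<le> t * e1"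
              using d(2)[OF t v(1)] t by (intro mult_left_mono) auto
            have "\<bar>(v - u) \<bullet> L x\<bar> \<le> norm (v - u) * norm (L x)" by (rule Cauchy_Schwarz_ineq2)
            also have "\<dots> \<le> e1 * norm (L x)" using v by (intro mult_right_mono) (auto simp: norm_minus_commute)
            finally show "t * \<bar>(v - u) \<bullet> L x\<bar> \<le> t * (e1 * norm (L x))" using t by simp
          qed
          also have "\<dots> = t * (e1 * (C + 1 + norm (L x)))" by (simp add: algebra_simps)
          also have "\<dots> = e * t" using CL by (simp add: e1_def)
          finally show ?thesis by (simp add: t_def)
        qed simp
      qed
    qed
    then show ?thesis unfolding differentiable_def by blast
  qed
  ultimately show ?thesis using that by blast
qed

end

lemma rademacher_vector:
  fixes G :: "'a::euclidean_space \<Rightarrow> 'b::euclidean_space"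
  assumes lip: "\<And>x y. norm (G x - G y) \<le> C * norm (x - y)"
  obtains N where "negligible N" "\<And>x. x \<notin> N \<Longrightarrow> G differentiable (at x)"
proof -
  have "\<bar>G x \<bullet> b - G y \<bullet> b\<bar> \<le> C * norm (x - y)" if "b \<in> Basis" for b x y
    using Basis_le_norm[OF that, of "G x - G y"] lip[of x y] by (simp add: inner_diff_left)
  then have "\<forall>b\<in>Basis. \<exists>N. negligible N \<and> (\<forall>x. x \<notin> N \<longrightarrow> (\<lambda>x. G x \<bullet> b) differentiable (at x))"
    by (metis rademacher)
  then obtain N where N: "\<And>b. b \<in> Basis \<Longrightarrow> negligible (N b)"
    "\<And>b x. b \<in> Basis \<Longrightarrow> x \<notin> N b \<Longrightarrow> (\<lambda>x. G x \<bullet> b) differentiable (at x)" by metis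
  show ?thesis
  proof (rule that[of "\<Union>(N ` Basis)"])
    show "negligible (\<Union>(N ` Basis))" using N by (intro negligible_Union) auto
    fix x assume "x \<notin> \<Union>(N ` Basis)"
    then show "G differentiable (at x)"
      using N(2) by (subst differentiable_componentwise_within) auto
  qed
qed

section \<open>Envelopes of class \<open>C\<^sup>1\<^sup>,\<^sup>1\<close>\<close>

text \<open>
  The point \<open>x\<close> is a convex combination of \<open>y\<close> and \<open>x - t (y - x)\<close>, and at the latter the majorant
  deviates from its linear part by a term of order \<open>t\<^sup>2\<close>. Convexity, division by \<open>t\<close> and \<open>t \<rightarrow> 0\<close> give
  the claim.
\<close>

lemma convex_quadratic_majorant_imp_subgradient:
  fixes k :: "'a::real_inner \<Rightarrow> real"
  assumes conv: "convex_on UNIV k" and maj: "\<And>y. k y \<le> k x + P \<bullet> (y - x) + c * (norm (y - x))\<^sup>2"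
  shows "k x + P \<bullet> (y - x) \<le> k y"
proof -
  define e where "e = y - x"
  have "k x + P \<bullet> e - t * (c * (norm e)\<^sup>2) \<le> k y" if t: "t > 0" for t
  proof -
    have x: "x = (t / (1 + t)) *\<^sub>R y + (1 / (1 + t)) *\<^sub>R (x - t *\<^sub>R e)"
    proof -
      have "(t / (1 + t)) *\<^sub>R y + (1 / (1 + t)) *\<^sub>R (x - t *\<^sub>R e) = (1 / (1 + t)) *\<^sub>R (t *\<^sub>R y + (x - t *\<^sub>R e))"
        by (simp add: scaleR_right_distrib)
      also have "t *\<^sub>R y + (x - t *\<^sub>R e) = (1 + t) *\<^sub>R x" by (simp add: e_def algebra_simps)
      finally show ?thesis using t by simp
    qed
    have "k x \<le> (t / (1 + t)) * k y + (1 / (1 + t)) * k (x - t *\<^sub>R e)"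
    proof -
      have "1 - 1 / (1 + t) = t / (1 + t)" using t by (simp add: field_simps)
      then show ?thesis
        using convex_onD[OF conv, of "1 / (1 + t)" y "x - t *\<^sub>R e"] t by (simp flip: x)
    qed
    then have "(1 + t) * k x \<le> (1 + t) * ((t / (1 + t)) * k y + (1 / (1 + t)) * k (x - t *\<^sub>R e))"
      using t by (intro mult_left_mono) auto
    also have "\<dots> = t * k y + k (x - t *\<^sub>R e)" using t by (simp add: distrib_left)
    also have "k (x - t *\<^sub>R e) \<le> k x - t * (P \<bullet> e) + t\<^sup>2 * (c * (norm e)\<^sup>2)"
      using maj[of "x - t *\<^sub>R e"] t by (simp add: power_mult_distrib mult_ac)
    finally have "t * (k x + P \<bullet> e - t * (c * (norm e)\<^sup>2)) \<le> t * k y"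
      by (simp add: algebra_simps power2_eq_square)
    then show ?thesis using t by simp
  qed
  then have "\<forall>\<^sub>F t in at_right 0. k x + P \<bullet> e - t * (c * (norm e)\<^sup>2) \<le> k y"
    by (simp add: eventually_at_right_field) (metis zero_less_one)
  moreover have "((\<lambda>t. k x + P \<bullet> e - t * (c * (norm e)\<^sup>2)) \<longlongrightarrow> k x + P \<bullet> e - 0 * (c * (norm e)\<^sup>2)) (at_right 0)"
    by (intro tendsto_intros)
  ultimately show ?thesis
    by (simp add: e_def tendsto_upperbound trivial_limit_at_right_real)
qed

text \<open>
  This is the regularization of Lasry and Lions: the supremal convolution
  \<open>s z = sup (u h - |z - h|\<^sup>2 / (4\<eta>))\<close>, followed by the infimal convolution
  \<open>a x = inf (s z + |x - z|\<^sup>2 / (2\<eta>))\<close>. The second step makes \<open>a\<close> semiconcave and, because \<open>s\<close> was built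
  with the wider paraboloids, it leaves \<open>a\<close> semiconvex; together this is the two-sided bound in the
  third property, so that \<open>a\<close> is of class \<open>C\<^sup>1\<^sup>,\<^sup>1\<close>. By the first two properties \<open>a\<close> lies above the
  supremal convolution of \<open>u\<close> with parameter \<open>\<eta>\<close>, but below each paraboloid of opening \<open>1 / (2\<eta>)\<close> that lies
  above that convolution.
\<close>

lemma c11_envelope:
  fixes u :: "'a::euclidean_space \<Rightarrow> real"
  assumes D: "compact D" "D \<noteq> {}" and u: "continuous_on D u" and \<eta>: "\<eta> > 0"
  obtains a G where
    "\<And>x h. h \<in> D \<Longrightarrow> u h - (norm (x - h))\<^sup>2 / (2 * \<eta>) \<le> a x"
    "\<And>z c x. (\<And>y h. h \<in> D \<Longrightarrow> u h - (norm (y - h))\<^sup>2 / (2 * \<eta>) \<le> c + (norm (y - z))\<^sup>2 / (2 * \<eta>))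
        \<Longrightarrow> a x \<le> c + (norm (x - z))\<^sup>2 / (2 * \<eta>)"
    "\<And>x y. \<bar>a y - a x - G x \<bullet> (y - x)\<bar> \<le> (norm (y - x))\<^sup>2 / (2 * \<eta>)"
proof -
  obtain h0 where h0: "h0 \<in> D" using D by blast
  \<comment> \<open>After expansion of the square, \<open>s z + |z|\<^sup>2 / (4\<eta>)\<close> is a supremum of affine functions of \<open>z\<close>,
    hence convex.\<close>
  define S where "S z = (SUP h\<in>D. u h - (norm h)\<^sup>2 / (4 * \<eta>) + (z \<bullet> h) / (2 * \<eta>))" for z
  define s where "s z = S z - (norm z)\<^sup>2 / (4 * \<eta>)" for z
  have bdd: "bdd_above ((\<lambda>h. u h - (norm h)\<^sup>2 / (4 * \<eta>) + (z \<bullet> h) / (2 * \<eta>)) ` D)" for z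
    using \<eta> by (intro bounded_imp_bdd_above compact_imp_bounded compact_continuous_image D continuous_intros u) auto
  have S_ge: "u h - (norm h)\<^sup>2 / (4 * \<eta>) + (z \<bullet> h) / (2 * \<eta>) \<le> S z" if "h \<in> D" for h z
    unfolding S_def by (rule cSUP_upper[OF that bdd])
  have S_le: "S z \<le> c" if "\<And>h. h \<in> D \<Longrightarrow> u h - (norm h)\<^sup>2 / (4 * \<eta>) + (z \<bullet> h) / (2 * \<eta>) \<le> c" for z c
    unfolding S_def by (rule cSUP_least[OF D(2) that])
  have sq: "(norm (z - h))\<^sup>2 / (4 * \<eta>) = (norm z)\<^sup>2 / (4 * \<eta>) - (z \<bullet> h) / (2 * \<eta>) + (norm h)\<^sup>2 / (4 * \<eta>)" for z h :: 'a
    using \<eta> by (simp add: power2_norm_eq_inner inner_diff inner_add inner_commute field_simps)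
  have s_ge: "u h - (norm (z - h))\<^sup>2 / (4 * \<eta>) \<le> s z" if "h \<in> D" for h z
    using S_ge[OF that, of z] unfolding sq s_def by simp
  have s_le: "s z \<le> c" if "\<And>h. h \<in> D \<Longrightarrow> u h - (norm (z - h))\<^sup>2 / (4 * \<eta>) \<le> c" for z c
    using S_le[of z "c + (norm z)\<^sup>2 / (4 * \<eta>)"] that unfolding sq s_def by fastforce
  have S_convex: "convex_on UNIV S"
  proof (rule convex_onI)
    fix t :: real and x y :: 'a assume t: "0 < t" "t < 1"
    show "S ((1 - t) *\<^sub>R x + t *\<^sub>R y) \<le> (1 - t) * S x + t * S y"
    proof (rule S_le)
      fix h assume "h \<in> D"
      let ?c = "u h - (norm h)\<^sup>2 / (4 * \<eta>)"
      have "?c + ((1 - t) *\<^sub>R x + t *\<^sub>R y) \<bullet> h / (2 * \<eta>)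
          = (1 - t) * (?c + x \<bullet> h / (2 * \<eta>)) + t * (?c + y \<bullet> h / (2 * \<eta>))"
      proof -
        have "((1 - t) *\<^sub>R x + t *\<^sub>R y) \<bullet> h / (2 * \<eta>) = (1 - t) * (x \<bullet> h / (2 * \<eta>)) + t * (y \<bullet> h / (2 * \<eta>))"
          by (simp add: inner_add_left add_divide_distrib)
        moreover have "?c = (1 - t) * ?c + t * ?c" by (simp add: left_diff_distrib)
        ultimately show ?thesis unfolding distrib_left by linarith
      qed
      also have "\<dots> \<le> (1 - t) * S x + t * S y"
        using t S_ge[OF \<open>h \<in> D\<close>] by (intro add_mono mult_left_mono) auto
      finally show "?c + ((1 - t) *\<^sub>R x + t *\<^sub>R y) \<bullet> h / (2 * \<eta>) \<le> (1 - t) * S x + t * S y" .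
    qed
  qed simp
  have S_cont: "continuous_on UNIV S"
    by (rule convex_on_continuous[OF open_UNIV S_convex])
  then have s_cont: "continuous_on UNIV s"
    unfolding s_def using \<eta> by (intro continuous_intros) auto
  define m where "m x z = s z + (norm (x - z))\<^sup>2 / (2 * \<eta>)" for x z
  \<comment> \<open>Quadratic growth in \<open>z\<close>, so that the infimum over \<open>z\<close> is attained.\<close>
  have m_lower: "u h0 + ((norm (z - (2 *\<^sub>R x - h0)))\<^sup>2 - 2 * (norm (x - h0))\<^sup>2) / (4 * \<eta>) \<le> m x z" for x z
  proof -
    have "((norm (z - (2 *\<^sub>R x - h0)))\<^sup>2 - 2 * (norm (x - h0))\<^sup>2) / (4 * \<eta>)
       = (norm (x - z))\<^sup>2 / (2 * \<eta>) - (norm (z - h0))\<^sup>2 / (4 * \<eta>)"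
      using \<eta> by (simp add: power2_norm_eq_inner inner_diff inner_add inner_commute field_simps)
    then show ?thesis using s_ge[OF h0, of z] by (simp add: m_def)
  qed
  have "\<exists>z. \<forall>z'. m x z \<le> m x z'" for x
  proof -
    \<comment> \<open>Outside this ball around \<open>2 x - h0\<close> the lower bound exceeds the value at \<open>z = x\<close>.\<close>
    define R where "R = norm (x - (2 *\<^sub>R x - h0)) + sqrt \<bar>4 * \<eta> * (m x x - u h0) + 2 * (norm (x - h0))\<^sup>2\<bar>"
    have R: "R \<ge> 0" unfolding R_def by (intro add_nonneg_nonneg) auto
    have "\<exists>z\<in>cball (2 *\<^sub>R x - h0) R. \<forall>z'\<in>cball (2 *\<^sub>R x - h0) R. m x z \<le> m x z'"
      by (rule continuous_attains_inf)
        (use \<eta> R in \<open>auto simp: m_def intro!: continuous_intros continuous_on_subset[OF s_cont]\<close>)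
    then obtain z where z: "\<And>z'. z' \<in> cball (2 *\<^sub>R x - h0) R \<Longrightarrow> m x z \<le> m x z'" by blast
    have "m x z \<le> m x x" by (rule z) (simp add: R_def dist_norm norm_minus_commute)
    have "m x z \<le> m x z'" for z'
    proof (cases "z' \<in> cball (2 *\<^sub>R x - h0) R")
      case False
      let ?q = "\<bar>4 * \<eta> * (m x x - u h0) + 2 * (norm (x - h0))\<^sup>2\<bar>"
      have "sqrt ?q \<le> norm (z' - (2 *\<^sub>R x - h0))"
      proof -
        have "R < norm (z' - (2 *\<^sub>R x - h0))" using False by (simp add: dist_norm norm_minus_commute)
        then show ?thesis using norm_ge_zero[of "x - (2 *\<^sub>R x - h0)"] unfolding R_def by linarith
      qed
      then have "?q \<le> (norm (z' - (2 *\<^sub>R x - h0)))\<^sup>2"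
        by (rule sqrt_le_D)
      then have "4 * \<eta> * (m x x - u h0) \<le> (norm (z' - (2 *\<^sub>R x - h0)))\<^sup>2 - 2 * (norm (x - h0))\<^sup>2" by linarith
      then have "m x x - u h0 \<le> ((norm (z' - (2 *\<^sub>R x - h0)))\<^sup>2 - 2 * (norm (x - h0))\<^sup>2) / (4 * \<eta>)"
        using \<eta> by (simp add: pos_le_divide_eq mult.commute)
      with m_lower[of z' x] \<open>m x z \<le> m x x\<close> show ?thesis by linarith
    qed (use z in auto)
    then show ?thesis by blast
  qed
  then obtain Z where Z: "\<And>x z'. m x (Z x) \<le> m x z'" by metis
  define a where "a x = m x (Z x)" for x
  define G where "G x = (x - Z x) /\<^sub>R \<eta>" for x
  have upper: "a y \<le> a x + G x \<bullet> (y - x) + (norm (y - x))\<^sup>2 / (2 * \<eta>)" for x y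
  proof -
    have "a y \<le> m y (Z x)" unfolding a_def by (rule Z)
    also have "\<dots> = a x + G x \<bullet> (y - x) + (norm (y - x))\<^sup>2 / (2 * \<eta>)"
      using \<eta> unfolding a_def G_def m_def
      by (simp add: power2_norm_eq_inner inner_diff inner_add inner_commute field_simps)
    finally show ?thesis .
  qed
  \<comment> \<open>Completing squares exhibits \<open>k\<close> as the minimum over \<open>z\<close> of a function that is jointly convex in
    \<open>x\<close> and \<open>z\<close>. This is where the ratio of the two parameters enters.\<close>
  define k where "k x = a x + (norm x)\<^sup>2 / (2 * \<eta>)" for x
  have m_k: "m x z + (norm x)\<^sup>2 / (2 * \<eta>) = S z + (norm (z - 2 *\<^sub>R x))\<^sup>2 / (4 * \<eta>)" for x z
    using \<eta> unfolding m_def s_def by (simp add: power2_norm_eq_inner inner_diff inner_add inner_commute field_simps)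
  have nsq: "(norm ((1 - t) *\<^sub>R x + t *\<^sub>R y))\<^sup>2 \<le> (1 - t) * (norm x)\<^sup>2 + t * (norm y)\<^sup>2"
    if "0 < t" "t < 1" for t and x y :: 'a
  proof -
    have "(1 - t) * (norm x)\<^sup>2 + t * (norm y)\<^sup>2 - (norm ((1 - t) *\<^sub>R x + t *\<^sub>R y))\<^sup>2 = t * (1 - t) * (norm (x - y))\<^sup>2"
      by (simp add: power2_norm_eq_inner inner_diff inner_add inner_commute algebra_simps)
    moreover have "\<dots> \<ge> 0" using that by simp
    ultimately show ?thesis by linarith
  qed
  have k_convex: "convex_on UNIV k"
  proof (rule convex_onI)
    fix t :: real and x y :: 'a assume t: "0 < t" "t < 1"
    let ?x = "(1 - t) *\<^sub>R x + t *\<^sub>R y" and ?z = "(1 - t) *\<^sub>R Z x + t *\<^sub>R Z y"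
    have "k ?x \<le> m ?x ?z + (norm ?x)\<^sup>2 / (2 * \<eta>)" using Z[of ?x ?z] by (simp add: k_def a_def)
    also have "\<dots> = S ?z + (norm (?z - 2 *\<^sub>R ?x))\<^sup>2 / (4 * \<eta>)" by (rule m_k)
    also have "?z - 2 *\<^sub>R ?x = (1 - t) *\<^sub>R (Z x - 2 *\<^sub>R x) + t *\<^sub>R (Z y - 2 *\<^sub>R y)" by (simp add: algebra_simps)
    also have "S ?z + (norm ((1 - t) *\<^sub>R (Z x - 2 *\<^sub>R x) + t *\<^sub>R (Z y - 2 *\<^sub>R y)))\<^sup>2 / (4 * \<eta>)
      \<le> ((1 - t) * S (Z x) + t * S (Z y)) + ((1 - t) * (norm (Z x - 2 *\<^sub>R x))\<^sup>2 + t * (norm (Z y - 2 *\<^sub>R y))\<^sup>2) / (4 * \<eta>)"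
      using t \<eta> by (intro add_mono divide_right_mono nsq convex_onD[OF S_convex]) auto
    also have "\<dots> = (1 - t) * (S (Z x) + (norm (Z x - 2 *\<^sub>R x))\<^sup>2 / (4 * \<eta>)) + t * (S (Z y) + (norm (Z y - 2 *\<^sub>R y))\<^sup>2 / (4 * \<eta>))"
      by (simp add: algebra_simps add_divide_distrib diff_divide_distrib)
    also have "\<dots> = (1 - t) * k x + t * k y" by (simp add: k_def a_def flip: m_k)
    finally show "k ?x \<le> (1 - t) * k x + t * k y" .
  qed simp
  have lower: "a x + G x \<bullet> (y - x) - (norm (y - x))\<^sup>2 / (2 * \<eta>) \<le> a y" for x y
  proof -
    have sq2: "(norm y)\<^sup>2 / (2 * \<eta>) = (norm x)\<^sup>2 / (2 * \<eta>) + (x /\<^sub>R \<eta>) \<bullet> (y - x) + (norm (y - x))\<^sup>2 / (2 * \<eta>)" for y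
      using \<eta> by (simp add: power2_norm_eq_inner inner_diff inner_add inner_commute field_simps)
    have "k y \<le> k x + (G x + x /\<^sub>R \<eta>) \<bullet> (y - x) + (1 / \<eta>) * (norm (y - x))\<^sup>2" for y
      using upper[of y x] sq2[of y] unfolding k_def by (simp add: inner_add_left)
    from convex_quadratic_majorant_imp_subgradient[OF k_convex this, of y]
    show ?thesis using sq2[of y] unfolding k_def by (simp add: inner_add_left)
  qed
  show ?thesis
  proof (rule that)
    show "u h - (norm (x - h))\<^sup>2 / (2 * \<eta>) \<le> a x" if "h \<in> D" for x h
    proof -
      have "(norm (Z x - h))\<^sup>2 \<le> 2 * (norm (x - Z x))\<^sup>2 + 2 * (norm (x - h))\<^sup>2"
      proof -
        have "2 * (norm (x - Z x))\<^sup>2 + 2 * (norm (x - h))\<^sup>2 - (norm (Z x - h))\<^sup>2 = (norm (2 *\<^sub>R x - Z x - h))\<^sup>2"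
          by (simp add: power2_norm_eq_inner inner_diff inner_add inner_commute algebra_simps)
        then show ?thesis using zero_le_power2[of "norm (2 *\<^sub>R x - Z x - h)"] by linarith
      qed
      then have "(norm (Z x - h))\<^sup>2 / (4 * \<eta>) \<le> (2 * (norm (x - Z x))\<^sup>2 + 2 * (norm (x - h))\<^sup>2) / (4 * \<eta>)"
        using \<eta> by (intro divide_right_mono) auto
      also have "\<dots> = (norm (x - Z x))\<^sup>2 / (2 * \<eta>) + (norm (x - h))\<^sup>2 / (2 * \<eta>)"
        using \<eta> by (simp add: field_simps)
      finally show ?thesis using s_ge[OF that, of "Z x"] by (simp add: a_def m_def)
    qed
    show "a x \<le> c + (norm (x - z))\<^sup>2 / (2 * \<eta>)"
      if *: "\<And>y h. h \<in> D \<Longrightarrow> u h - (norm (y - h))\<^sup>2 / (2 * \<eta>) \<le> c + (norm (y - z))\<^sup>2 / (2 * \<eta>)" for z c x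
    proof -
      have "s z \<le> c"
      proof (rule s_le)
        \<comment> \<open>The hypothesis at the midpoint \<open>y\<close> of \<open>h\<close> and \<open>z\<close> is optimal.\<close>
        fix h assume h: "h \<in> D"
        have "(1/2) *\<^sub>R (h + z) - h = (1/2) *\<^sub>R (z - h)" "(1/2) *\<^sub>R (h + z) - z = - ((1/2) *\<^sub>R (z - h))"
          by (simp_all add: algebra_simps flip: scaleR_add_left)
        then have "(norm ((1/2) *\<^sub>R (h + z) - h))\<^sup>2 = (norm (z - h))\<^sup>2 / 4" "(norm ((1/2) *\<^sub>R (h + z) - z))\<^sup>2 = (norm (z - h))\<^sup>2 / 4"
          by (simp_all add: power_divide)
        with *[OF h, of "(1/2) *\<^sub>R (h + z)"]
        have "u h - (norm (z - h))\<^sup>2 / 4 / (2 * \<eta>) \<le> c + (norm (z - h))\<^sup>2 / 4 / (2 * \<eta>)" by simp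
        moreover have "(norm (z - h))\<^sup>2 / (4 * \<eta>) = (norm (z - h))\<^sup>2 / 4 / (2 * \<eta>) + (norm (z - h))\<^sup>2 / 4 / (2 * \<eta>)"
          using \<eta> by (simp add: field_simps)
        ultimately show "u h - (norm (z - h))\<^sup>2 / (4 * \<eta>) \<le> c" by linarith
      qed
      then show ?thesis using Z[of x z] by (simp add: a_def m_def)
    qed
    show "\<bar>a y - a x - G x \<bullet> (y - x)\<bar> \<le> (norm (y - x))\<^sup>2 / (2 * \<eta>)" for x y
      using upper[of y x] lower[of x y] by linarith
  qed
qed

text \<open>
  The expansions around \<open>x\<close> and \<open>y\<close> are compared at the point \<open>x + w\<close>, where \<open>w\<close> has the direction of
  \<open>G x - G y\<close> and the length of \<open>x - y\<close>.
\<close>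

lemma c11_gradient_lipschitz:
  fixes G :: "'a::real_inner \<Rightarrow> 'a"
  assumes c: "c \<ge> 0" and c11: "\<And>x y. \<bar>a y - a x - G x \<bullet> (y - x)\<bar> \<le> c * (norm (y - x))\<^sup>2"
  shows "norm (G x - G y) \<le> 6 * c * norm (x - y)"
proof (cases "G x = G y")
  case False
  define g where "g = norm (G x - G y)"
  define t where "t = norm (x - y)"
  have g: "g > 0" using False by (simp add: g_def)
  define w where "w = (t / g) *\<^sub>R (G x - G y)"
  have nw: "norm w = t" using g by (simp add: w_def g_def t_def)
  define z where "z = x + w"
  have nz: "norm (z - y) \<le> 2 * t"
    using norm_triangle_ineq[of "x - y" w] nw by (simp add: z_def t_def algebra_simps)
  have "(G x - G y) \<bullet> w = g * t"
    using g by (simp add: w_def g_def dot_square_norm power2_eq_square)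
  moreover have "(G x - G y) \<bullet> w = (a z - a y - G y \<bullet> (z - y)) - (a z - a x - G x \<bullet> (z - x)) - (a x - a y - G y \<bullet> (x - y))"
    by (simp add: z_def algebra_simps)
  moreover have "\<bar>a z - a y - G y \<bullet> (z - y)\<bar> \<le> c * (2 * t)\<^sup>2"
    using c nz by (intro order_trans[OF c11] mult_left_mono power_mono) auto
  moreover have "\<bar>a z - a x - G x \<bullet> (z - x)\<bar> \<le> c * t\<^sup>2" using c11[of z x] nw by (simp add: z_def)
  moreover have "\<bar>a x - a y - G y \<bullet> (x - y)\<bar> \<le> c * t\<^sup>2" using c11[of x y] by (simp add: t_def)
  ultimately have "g * t \<le> 6 * c * t\<^sup>2" by (simp add: power_mult_distrib)
  then have "t > 0 \<Longrightarrow> g \<le> 6 * c * t" by (simp add: power2_eq_square)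
  moreover have "t = 0 \<Longrightarrow> g \<le> 6 * c * t" using False by (simp add: t_def g_def)
  ultimately show ?thesis using norm_ge_zero[of "x - y"] unfolding g_def t_def by linarith
qed (use c in simp)

text \<open>
  The mean value theorem on the segment from \<open>x\<close> to \<open>x + h\<close> reduces the expansion of \<open>a\<close> to the
  differentiability of its gradient \<open>G\<close> at the single point \<open>x\<close>.
\<close>

lemma c11_second_order_expansion:
  fixes G :: "'a::real_inner \<Rightarrow> 'a"
  assumes c11: "\<And>x y. \<bar>a y - a x - G x \<bullet> (y - x)\<bar> \<le> c * (norm (y - x))\<^sup>2"
    and T: "(G has_derivative T) (at x)" and e: "e > 0"
  shows "\<exists>d>0. \<forall>h. norm h < d \<longrightarrow> \<bar>a (x + h) - a x - G x \<bullet> h - (h \<bullet> T h) / 2\<bar> \<le> e * (norm h)\<^sup>2"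
proof -
  have der: "(a has_derivative (\<lambda>h. G x \<bullet> h)) (at x)" for x
    unfolding has_derivative_at_alt
  proof (intro conjI allI impI)
    show "bounded_linear ((\<bullet>) (G x))" by (rule bounded_linear_inner_right)
    fix e :: real assume "e > 0"
    define d where "d = e / (\<bar>c\<bar> + 1)"
    show "\<exists>d>0. \<forall>y. norm (y - x) < d \<longrightarrow> norm (a y - a x - G x \<bullet> (y - x)) \<le> e * norm (y - x)"
    proof (intro exI[of _ d] conjI allI impI)
      fix y assume "norm (y - x) < d"
      have "norm (a y - a x - G x \<bullet> (y - x)) \<le> c * (norm (y - x))\<^sup>2" using c11 by simp
      also have "\<dots> \<le> (\<bar>c\<bar> + 1) * (norm (y - x))\<^sup>2" by (intro mult_right_mono) auto
      also have "\<dots> = (\<bar>c\<bar> + 1) * norm (y - x) * norm (y - x)" by (simp add: power2_eq_square)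
      also have "\<dots> \<le> (\<bar>c\<bar> + 1) * d * norm (y - x)"
        using \<open>norm (y - x) < d\<close> by (intro mult_right_mono mult_left_mono) auto
      also have "\<dots> = e * norm (y - x)" by (simp add: d_def)
      finally show "norm (a y - a x - G x \<bullet> (y - x)) \<le> e * norm (y - x)" .
    qed (use \<open>e > 0\<close> in \<open>simp add: d_def\<close>)
  qed
  obtain d where d: "d > 0" "\<And>y. norm (y - x) < d \<Longrightarrow> norm (G y - G x - T (y - x)) \<le> e * norm (y - x)"
    using T e unfolding has_derivative_at_alt by blast
  have lin: "T (s *\<^sub>R h) = s *\<^sub>R T h" for s h
    using has_derivative_linear[OF T] by (simp add: linear_cmul)
  show ?thesis
  proof (intro exI[of _ d] conjI d(1) allI impI)
    fix h :: 'a assume h: "norm h < d"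
    define \<phi> where "\<phi> = (\<lambda>s::real. a (x + s *\<^sub>R h) - s\<^sup>2 * ((h \<bullet> T h) / 2))"
    have "(\<phi> has_derivative (\<lambda>r. r * (G (x + s *\<^sub>R h) \<bullet> h - s * (h \<bullet> T h)))) (at s within {0..1})" for s
      unfolding \<phi>_def
      by (auto intro!: derivative_eq_intros has_derivative_compose[OF _ der] simp: algebra_simps)
    then obtain s where s: "s \<in> {0<..<1}" "\<phi> 1 - \<phi> 0 = G (x + s *\<^sub>R h) \<bullet> h - s * (h \<bullet> T h)"
      using mvt_simple[of 0 1 \<phi> "\<lambda>s r. r * (G (x + s *\<^sub>R h) \<bullet> h - s * (h \<bullet> T h))"] by auto
    have "a (x + h) - a x - G x \<bullet> h - (h \<bullet> T h) / 2 = \<phi> 1 - \<phi> 0 - G x \<bullet> h" by (simp add: \<phi>_def)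
    also have "\<dots> = (G (x + s *\<^sub>R h) - G x - T (s *\<^sub>R h)) \<bullet> h"
      by (simp add: s lin algebra_simps inner_commute)
    also have "\<bar>\<dots>\<bar> \<le> norm (G (x + s *\<^sub>R h) - G x - T (s *\<^sub>R h)) * norm h" by (rule Cauchy_Schwarz_ineq2)
    also have "\<dots> \<le> e * norm (s *\<^sub>R h) * norm h"
    proof (rule mult_right_mono)
      have "s * norm h \<le> 1 * norm h" using s by (intro mult_right_mono) auto
      then show "norm (G (x + s *\<^sub>R h) - G x - T (s *\<^sub>R h)) \<le> e * norm (s *\<^sub>R h)"
        using d(2)[of "x + s *\<^sub>R h"] h s by simp
    qed simp
    also have "\<dots> \<le> e * norm h * norm h"
      using s e by (intro mult_right_mono mult_left_mono) (auto simp: mult_left_le_one_le)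
    finally show "\<bar>a (x + h) - a x - G x \<bullet> h - (h \<bullet> T h) / 2\<bar> \<le> e * (norm h)\<^sup>2"
      by (simp add: power2_eq_square)
  qed
qed

section \<open>The theorem on sums\<close>

lemma negligible_cylinder:
  assumes "negligible (N :: 'a::euclidean_space set)"
  shows "negligible (N \<times> (UNIV :: 'b::euclidean_space set))" "negligible ((UNIV :: 'b set) \<times> N)"
proof -
  obtain N' where N': "N \<subseteq> N'" "N' \<in> null_sets lborel"
    using assms by (metis negligible_iff_null_sets null_sets_completion_iff2)
  have "N' \<times> (UNIV :: 'b set) \<in> null_sets (lborel \<Otimes>\<^sub>M lborel)"
    using N'(2) by (intro lborel.times_in_null_sets1) auto
  moreover have "(UNIV :: 'b set) \<times> N' \<in> null_sets (lborel \<Otimes>\<^sub>M lborel)"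
    using N'(2) by (intro lborel.times_in_null_sets2) auto
  ultimately have "negligible (N' \<times> (UNIV :: 'b set))" "negligible ((UNIV :: 'b set) \<times> N')"
    by (simp_all add: negligible_iff_null_sets lborel_prod null_sets_completionI)
  then show "negligible (N \<times> (UNIV :: 'b set))" "negligible ((UNIV :: 'b set) \<times> N)"
    using N'(1) by (meson Sigma_mono negligible_subset subset_refl)+
qed

text \<open>
  By semiconcavity, the tangent paraboloid of \<open>q\<close> at \<open>x0\<close> with opening \<open>1 / (2\<eta>)\<close> lies above \<open>q\<close>; after
  completion of the square it is one of the paraboloids with which the envelope \<open>a\<close> is compared.
\<close>

lemma envelope_le_quadratic:
  assumes env: "\<And>z c x. (\<And>y h. h \<in> D \<Longrightarrow> u h - (norm (y - h))\<^sup>2 / (2 * \<eta>) \<le> c + (norm (y - z))\<^sup>2 / (2 * \<eta>))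
        \<Longrightarrow> a x \<le> c + (norm (x - z))\<^sup>2 / (2 * \<eta>)"
    and \<eta>: "\<eta> > 0" and q: "\<And>x h. h \<in> D \<Longrightarrow> u h - (norm (x - h))\<^sup>2 / (2 * \<eta>) \<le> q x"
    and semi: "\<And>x. q x \<le> q x0 + g \<bullet> (x - x0) + (norm (x - x0))\<^sup>2 / (2 * \<eta>)"
  shows "a x0 \<le> q (x0 :: 'a::real_inner)"
proof -
  define z where "z = x0 - \<eta> *\<^sub>R g"
  define c where "c = q x0 - \<eta> * (norm g)\<^sup>2 / 2"
  have eq: "q x0 + g \<bullet> (x - x0) + (norm (x - x0))\<^sup>2 / (2 * \<eta>) = c + (norm (x - z))\<^sup>2 / (2 * \<eta>)" for x
  proof -
    have "x - z = (x - x0) + \<eta> *\<^sub>R g" by (simp add: z_def)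
    then have "(norm (x - z))\<^sup>2 = (norm (x - x0))\<^sup>2 + 2 * \<eta> * (g \<bullet> (x - x0)) + \<eta>\<^sup>2 * (norm g)\<^sup>2"
      unfolding power2_norm_eq_inner by (simp only: inner_add_left inner_add_right) (simp add: inner_commute power2_eq_square)
    then show ?thesis using \<eta> by (simp add: c_def field_simps power2_eq_square)
  qed
  have "a x0 \<le> c + (norm (x0 - z))\<^sup>2 / (2 * \<eta>)"
    by (rule env) (use q semi eq in \<open>metis order_trans\<close>)
  with eq[of x0] show ?thesis by simp
qed

lemma inner_le_square_imp_zero:
  assumes "\<And>v. g \<bullet> v \<le> c * (norm v)\<^sup>2"
  shows "g = (0 :: 'a::real_inner)"
proof (rule ccontr)
  assume "g \<noteq> 0"
  define t where "t = 1 / (2 * (\<bar>c\<bar> + 1))"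
  have t: "t > 0" "c * t \<le> 1 / 2" by (auto simp: t_def divide_simps)
  have "t * (norm g)\<^sup>2 \<le> c * t * (t * (norm g)\<^sup>2)"
    using assms[of "t *\<^sub>R g"] t(1) by (simp add: power_mult_distrib dot_square_norm power2_eq_square mult_ac)
  also have "\<dots> \<le> 1 / 2 * (t * (norm g)\<^sup>2)" using t by (intro mult_right_mono) auto
  finally show False using t \<open>g \<noteq> 0\<close> by simp
qed

lemma nonpos_if_le_small_multiples:
  fixes q :: real
  assumes "\<And>e. e > 0 \<Longrightarrow> q \<le> e * K"
  shows "q \<le> 0"
proof (rule ccontr)
  assume "\<not> q \<le> 0"
  define e where "e = q / (2 * (\<bar>K\<bar> + 1))"
  have e: "e > 0" "e * (\<bar>K\<bar> + 1) = q / 2" using \<open>\<not> q \<le> 0\<close> by (auto simp: e_def field_simps)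
  have "q \<le> e * K" by (rule assms[OF e(1)])
  also have "\<dots> \<le> e * (\<bar>K\<bar> + 1)" using e(1) by (intro mult_left_mono) auto
  finally show False using \<open>\<not> q \<le> 0\<close> e(2) by linarith
qed

text \<open>
  Two functions whose sum has, apart from the coupling by the quadratic form of \<open>B\<close>, a maximum at the
  origin that is strict with quadratic margin \<open>\<tau>\<close>. The origin may lie on the boundary of the domains;
  this happens when the functions come from boundary points of the strip.
\<close>

locale sums_at_origin =
  fixes u1 u2 :: "'a::euclidean_space \<Rightarrow> real" and D1 D2 :: "'a set" and B :: "'a \<Rightarrow> 'a" and \<tau> :: real
  assumes D1: "compact D1" "0 \<in> D1" and D2: "compact D2" "0 \<in> D2"
    and u1: "continuous_on D1 u1" and u2: "continuous_on D2 u2"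
    and B: "linear B" "\<And>x y. B x \<bullet> y = x \<bullet> B y" and \<tau>: "\<tau> > 0"
    and max0: "\<And>h k. h \<in> D1 \<Longrightarrow> k \<in> D2 \<Longrightarrow>
      u1 h + u2 k \<le> u1 0 + u2 0 + (h - k) \<bullet> B (h - k) / 2 - \<tau> * ((norm h)\<^sup>2 + (norm k)\<^sup>2)"
begin

definition "\<beta> = onorm B"
definition "R = (SOME r. r \<ge> 0 \<and> D1 \<subseteq> cball 0 r \<and> D2 \<subseteq> cball 0 r)"

lemma B_bound: "norm (B x) \<le> \<beta> * norm x"
  unfolding \<beta>_def by (rule onorm[OF B(1)[unfolded linear_conv_bounded_linear]])

lemma beta_nonneg: "\<beta> \<ge> 0"
  unfolding \<beta>_def by (rule onorm_pos_le[OF B(1)[unfolded linear_conv_bounded_linear]])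

lemma R: "R \<ge> 0" "\<And>h. h \<in> D1 \<Longrightarrow> norm h \<le> R" "\<And>k. k \<in> D2 \<Longrightarrow> norm k \<le> R"
proof -
  have "bounded (D1 \<union> D2)" using D1 D2 by (auto simp: compact_imp_bounded)
  then obtain r where "\<And>x. x \<in> D1 \<union> D2 \<Longrightarrow> norm x \<le> r" "r > 0" unfolding bounded_pos by auto
  then have "\<exists>r. r \<ge> 0 \<and> D1 \<subseteq> cball 0 r \<and> D2 \<subseteq> cball 0 r" by (intro exI[of _ r]) auto
  from someI_ex[OF this]
  show "R \<ge> 0" "\<And>h. h \<in> D1 \<Longrightarrow> norm h \<le> R" "\<And>k. k \<in> D2 \<Longrightarrow> norm k \<le> R"
    unfolding R_def[symmetric] by auto
qed

definition "Q x y = (x - y) \<bullet> B (x - y) / 2"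

lemma Q_expand: "Q (x + s) (y + t) = Q x y + B (x - y) \<bullet> (s - t) + (s - t) \<bullet> B (s - t) / 2"
proof -
  have "x + s - (y + t) = (x - y) + (s - t)" by simp
  then show ?thesis unfolding Q_def
    by (simp only: linear_add[OF B(1)] inner_add_left inner_add_right B(2)[symmetric])
      (simp add: inner_commute[of "s - t"] B(2)[of "s - t" "x - y"] field_simps)
qed

lemma Q_quad_bound: "\<bar>w \<bullet> B w / 2\<bar> \<le> \<beta> / 2 * (norm w)\<^sup>2"
proof -
  have "\<bar>w \<bullet> B w\<bar> \<le> norm w * norm (B w)" by (rule Cauchy_Schwarz_ineq2)
  also have "\<dots> \<le> norm w * (\<beta> * norm w)" by (intro mult_left_mono B_bound) auto
  finally show ?thesis by (simp add: power2_eq_square mult_ac)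
qed

text \<open>
  Maximization over \<open>h\<close> and \<open>k\<close> gives the supremal convolutions of \<open>u1\<close> at \<open>x\<close> and of \<open>u2\<close> at \<open>y\<close>, minus
  the coupling and a linear tilt.
\<close>

definition "\<Psi> \<eta> p1 p2 x y h k =
  u1 h + u2 k - (norm (x - h))\<^sup>2 / (2 * \<eta>) - (norm (y - k))\<^sup>2 / (2 * \<eta>) - Q x y - p1 \<bullet> x - p2 \<bullet> y"

text \<open>
  For \<open>\<rho> \<le> 1\<close> the error terms in the following estimate are at most \<open>K\<close> if \<open>d \<le> 1\<close>, and at most \<open>K d\<^sup>2\<close>
  if \<open>d \<ge> 1\<close>.
\<close>

definition "K = 4 * \<beta> * R + 2 * \<beta> + 2 * R + 2"

text \<open>
  Replacing \<open>(x, y)\<close> by \<open>(h, k)\<close> changes coupling and tilt by terms that are small compared to the penalty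
  \<open>d\<^sup>2 / (2\<eta>)\<close>, unless \<open>d\<close> is small itself.
\<close>

lemma Psi_bound:
  assumes h: "h \<in> D1" and k: "k \<in> D2" and \<eta>: "\<eta> > 0" and p: "norm p1 \<le> \<rho>" "norm p2 \<le> \<rho>"
    and d: "norm (x - h, y - k) = d"
  shows "\<Psi> \<eta> p1 p2 x y h k \<le> u1 0 + u2 0 - \<tau> * ((norm h)\<^sup>2 + (norm k)\<^sup>2)
      + (4 * \<beta> * R * d + 2 * \<beta> * d\<^sup>2 + 2 * \<rho> * R + 2 * \<rho> * d) - d\<^sup>2 / (2 * \<eta>)"
proof -
  define s t where "s = x - h" and "t = y - k"
  have xy: "x = h + s" "y = k + t" by (simp_all add: s_def t_def)
  have d2: "d\<^sup>2 = (norm s)\<^sup>2 + (norm t)\<^sup>2" using d by (auto simp: s_def t_def norm_Pair)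
  have d0: "d \<ge> 0" using d by auto
  have st: "norm s \<le> d" "norm t \<le> d"
    using norm_fst_le[of "x - h" "y - k"] norm_snd_le[of "y - k" "x - h"] d by (auto simp: s_def t_def)
  have "norm (s - t) \<le> 2 * d" using norm_triangle_ineq4[of s t] st by linarith
  have hk: "norm (h - k) \<le> 2 * R" using norm_triangle_ineq4[of h k] R(2)[OF h] R(3)[OF k] by linarith
  have "Q h k - Q x y = - (B (h - k) \<bullet> (s - t)) - (s - t) \<bullet> B (s - t) / 2"
    unfolding xy Q_expand by simp
  also have "\<dots> \<le> (\<beta> * (2 * R)) * (2 * d) + \<beta> / 2 * (2 * d)\<^sup>2"
  proof -
    have "\<bar>B (h - k) \<bullet> (s - t)\<bar> \<le> norm (B (h - k)) * norm (s - t)" by (rule Cauchy_Schwarz_ineq2)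
    also have "\<dots> \<le> (\<beta> * (2 * R)) * (2 * d)"
      using \<open>norm (s - t) \<le> 2 * d\<close> hk beta_nonneg R(1)
      by (intro mult_mono order_trans[OF B_bound]) (auto intro: mult_left_mono)
    finally have "\<bar>B (h - k) \<bullet> (s - t)\<bar> \<le> (\<beta> * (2 * R)) * (2 * d)" .
    moreover have "\<bar>(s - t) \<bullet> B (s - t) / 2\<bar> \<le> \<beta> / 2 * (2 * d)\<^sup>2"
      using \<open>norm (s - t) \<le> 2 * d\<close> beta_nonneg
      by (intro order_trans[OF Q_quad_bound] mult_left_mono power_mono) auto
    ultimately show ?thesis by linarith
  qed
  finally have Qd: "Q h k - Q x y \<le> 4 * \<beta> * R * d + 2 * \<beta> * d\<^sup>2" by (simp add: power_mult_distrib)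
  have lin: "- (p \<bullet> z) \<le> \<rho> * (R + d)" if "norm p \<le> \<rho>" "norm z \<le> R + d" for p z :: 'a
  proof -
    have "\<bar>p \<bullet> z\<bar> \<le> norm p * norm z" by (rule Cauchy_Schwarz_ineq2)
    also have "\<dots> \<le> \<rho> * (R + d)" using that by (intro mult_mono) (auto intro: order_trans[OF norm_ge_zero])
    finally show ?thesis by linarith
  qed
  have "norm x \<le> R + d" "norm y \<le> R + d"
    using norm_triangle_ineq[of h s] norm_triangle_ineq[of k t] st R(2)[OF h] R(3)[OF k] unfolding xy by linarith+
  from lin[OF p(1) this(1)] lin[OF p(2) this(2)] Qd max0[OF h k]
  have "u1 h + u2 k - Q x y - p1 \<bullet> x - p2 \<bullet> y \<le> u1 0 + u2 0 - \<tau> * ((norm h)\<^sup>2 + (norm k)\<^sup>2)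
     + (4 * \<beta> * R * d + 2 * \<beta> * d\<^sup>2) + 2 * (\<rho> * (R + d))"
    unfolding Q_def by linarith
  moreover have "d\<^sup>2 / (2 * \<eta>) = (norm s)\<^sup>2 / (2 * \<eta>) + (norm t)\<^sup>2 / (2 * \<eta>)" by (simp add: d2 add_divide_distrib)
  ultimately show ?thesis unfolding \<Psi>_def by (simp add: s_def t_def algebra_simps)
qed

text \<open>
  A maximizer over the compact set with \<open>d \<le> 1\<close> is a global one, because for \<open>d > 1\<close> the penalty pushes \<open>\<Psi>\<close>
  below its value at the origin. Comparison with that value also localizes the maximizer.
\<close>

lemma Psi_max:
  assumes \<eta>: "\<eta> > 0" "2 * K * \<eta> < 1" and p: "norm p1 \<le> \<rho>" "norm p2 \<le> \<rho>" "\<rho> \<le> 1"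
  obtains x y h k where "h \<in> D1" "k \<in> D2"
    "\<And>x' y' h' k'. h' \<in> D1 \<Longrightarrow> k' \<in> D2 \<Longrightarrow> \<Psi> \<eta> p1 p2 x' y' h' k' \<le> \<Psi> \<eta> p1 p2 x y h k"
    "norm (x - h, y - k) \<le> 1"
    "(norm (x - h, y - k))\<^sup>2 \<le> 2 * \<eta> * K"
    "\<tau> * ((norm h)\<^sup>2 + (norm k)\<^sup>2) \<le> K * norm (x - h, y - k) + 2 * \<rho> * R"
proof -
  have K: "K \<ge> 2" unfolding K_def using beta_nonneg R(1) by simp
  have \<rho>: "\<rho> \<ge> 0" using p(1) norm_ge_zero order_trans by blast
  define f where "f = (\<lambda>(h, k, s, t). \<Psi> \<eta> p1 p2 (h + s) (k + t) h k)"
  define S where "S = D1 \<times> D2 \<times> cball (0::'a \<times> 'a) 1"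
  have contB: "continuous_on X (\<lambda>x. B (g x))" if "continuous_on X g" for X and g :: "'a \<times> 'a \<times> 'a \<times> 'a \<Rightarrow> 'a"
    using that B(1) linear_conv_bounded_linear bounded_linear.continuous_on by blast
  have "continuous_on S f"
    unfolding f_def \<Psi>_def Q_def case_prod_unfold S_def using \<eta>
    by (auto intro!: continuous_intros contB continuous_on_compose2[OF u1] continuous_on_compose2[OF u2])
  moreover have "compact S" unfolding S_def using D1 D2 by (intro compact_Times) auto
  moreover have "S \<noteq> {}" using D1 D2 by (auto simp: S_def)
  ultimately obtain z where z: "z \<in> S" "\<And>z'. z' \<in> S \<Longrightarrow> f z' \<le> f z"
    using continuous_attains_sup by metis
  obtain h k s t where hk: "z = (h, k, s, t)" by (cases z)
  have S: "h \<in> D1" "k \<in> D2" "norm (s, t) \<le> 1" using z(1) by (auto simp: hk S_def)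
  have zero: "\<Psi> \<eta> p1 p2 0 0 0 0 = u1 0 + u2 0" by (simp add: \<Psi>_def Q_def)
  have "(0, 0, 0, 0) \<in> S" using D1 D2 by (auto simp: S_def norm_Pair)
  from z(2)[OF this] have ge0: "u1 0 + u2 0 \<le> \<Psi> \<eta> p1 p2 (h + s) (k + t) h k"
    by (simp add: f_def hk zero)
  have all: "\<Psi> \<eta> p1 p2 x' y' h' k' \<le> \<Psi> \<eta> p1 p2 (h + s) (k + t) h k" if "h' \<in> D1" "k' \<in> D2" for x' y' h' k'
  proof (cases "norm (x' - h', y' - k') \<le> 1")
    case True
    then have "(h', k', x' - h', y' - k') \<in> S" using that by (simp add: S_def)
    from z(2)[OF this] show ?thesis by (simp add: f_def hk)
  next
    case False
    define d where "d = norm (x' - h', y' - k')"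
    have d: "d > 1" using False by (simp add: d_def)
    then have dd: "d \<le> d\<^sup>2" "1 \<le> d\<^sup>2" by (simp_all add: power2_eq_square mult_le_cancel_left1 less_1_mult order_less_imp_le)
    have "4 * \<beta> * R * d + 2 * \<beta> * d\<^sup>2 + 2 * \<rho> * R + 2 * \<rho> * d
        \<le> 4 * \<beta> * R * d\<^sup>2 + 2 * \<beta> * d\<^sup>2 + 2 * R * d\<^sup>2 + 2 * d\<^sup>2"
    proof (intro add_mono)
      show "4 * \<beta> * R * d \<le> 4 * \<beta> * R * d\<^sup>2" using dd beta_nonneg R(1) by (intro mult_left_mono) auto
      have "\<rho> * R \<le> 1 * R" using p R(1) by (intro mult_right_mono) auto
      also have "\<dots> \<le> d\<^sup>2 * R" using dd R(1) by (intro mult_right_mono) auto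
      finally show "2 * \<rho> * R \<le> 2 * R * d\<^sup>2" by (simp add: mult.commute)
      have "\<rho> * d \<le> 1 * d\<^sup>2" using p \<rho> dd d by (intro mult_mono) auto
      then show "2 * \<rho> * d \<le> 2 * d\<^sup>2" by simp
    qed simp
    also have "\<dots> = K * d\<^sup>2" by (simp add: K_def algebra_simps)
    also have "\<dots> \<le> d\<^sup>2 / (2 * \<eta>)"
    proof -
      have "K \<le> 1 / (2 * \<eta>)" using \<eta> by (simp add: field_simps)
      then have "K * d\<^sup>2 \<le> 1 / (2 * \<eta>) * d\<^sup>2" by (intro mult_right_mono) auto
      then show ?thesis by simp
    qed
    finally have "\<Psi> \<eta> p1 p2 x' y' h' k' \<le> u1 0 + u2 0"
    proof -
      have "0 \<le> \<tau> * ((norm h')\<^sup>2 + (norm k')\<^sup>2)" using \<tau> by simp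
      moreover assume "4 * \<beta> * R * d + 2 * \<beta> * d\<^sup>2 + 2 * \<rho> * R + 2 * \<rho> * d \<le> d\<^sup>2 / (2 * \<eta>)"
      ultimately show ?thesis using Psi_bound[OF that \<eta>(1) p(1,2) d_def[symmetric]] by linarith
    qed
    with ge0 show ?thesis by linarith
  qed
  define d where "d = norm (s, t)"
  have d: "0 \<le> d" "d \<le> 1" using S by (auto simp: d_def)
  have "norm (h + s - h, k + t - k) = d" by (simp add: d_def)
  from Psi_bound[OF S(1,2) \<eta>(1) p(1,2) this] ge0
  have main: "d\<^sup>2 / (2 * \<eta>) + \<tau> * ((norm h)\<^sup>2 + (norm k)\<^sup>2) \<le> 4 * \<beta> * R * d + 2 * \<beta> * d\<^sup>2 + 2 * \<rho> * R + 2 * \<rho> * d"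
    by linarith
  have "d\<^sup>2 \<le> d" using d by (simp add: power2_eq_square mult_left_le)
  have r1: "4 * \<beta> * R * d + 2 * \<beta> * d\<^sup>2 + 2 * \<rho> * d \<le> (4 * \<beta> * R + 2 * \<beta> + 2) * d"
  proof -
    have "2 * \<beta> * d\<^sup>2 \<le> 2 * \<beta> * d" using \<open>d\<^sup>2 \<le> d\<close> beta_nonneg by (intro mult_left_mono) auto
    moreover have "2 * \<rho> * d \<le> 2 * d" using p d by (intro mult_right_mono) auto
    ultimately show ?thesis by (simp add: algebra_simps)
  qed
  have r2: "(4 * \<beta> * R + 2 * \<beta> + 2) * d \<le> K * d" unfolding K_def using d R(1) by (intro mult_right_mono) auto
  have r3: "(4 * \<beta> * R + 2 * \<beta> + 2) * d + 2 * \<rho> * R \<le> K"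
  proof -
    have "(4 * \<beta> * R + 2 * \<beta> + 2) * d \<le> (4 * \<beta> * R + 2 * \<beta> + 2) * 1"
      using d beta_nonneg R(1) by (intro mult_left_mono) auto
    moreover have "2 * \<rho> * R \<le> 2 * R" using p R(1) by (intro mult_right_mono) auto
    ultimately show ?thesis by (simp add: K_def)
  qed
  have t0: "\<tau> * ((norm h)\<^sup>2 + (norm k)\<^sup>2) \<ge> 0" "d\<^sup>2 / (2 * \<eta>) \<ge> 0" using \<tau> \<eta> by auto
  have "d\<^sup>2 / (2 * \<eta>) \<le> K" using main r1 r3 t0 by linarith
  then have "d\<^sup>2 \<le> 2 * \<eta> * K" using \<eta> by (simp add: field_simps)
  moreover have "\<tau> * ((norm h)\<^sup>2 + (norm k)\<^sup>2) \<le> K * d + 2 * \<rho> * R" using main r1 r2 t0 by linarith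
  ultimately show ?thesis
    using that[of h k "h + s" "k + t"] S all by (simp add: d_def)
qed

lemma Q_semiconcave:
  assumes "\<eta> > 0" "\<beta> * \<eta> \<le> 1"
  shows "(s :: 'a) \<bullet> B s / 2 \<le> (norm s)\<^sup>2 / (2 * \<eta>)"
proof -
  have "s \<bullet> B s / 2 \<le> \<beta> / 2 * (norm s)\<^sup>2" using Q_quad_bound[of s] by linarith
  also have "\<dots> \<le> (1 / \<eta>) / 2 * (norm s)\<^sup>2"
    using assms by (intro mult_right_mono divide_right_mono) (auto simp: field_simps)
  finally show ?thesis using assms by simp
qed

text \<open>
  Let \<open>a\<close> and \<open>b\<close> be the envelopes of \<open>u1\<close> and \<open>u2\<close>. A maximizer of \<open>\<Psi>\<close> also maximizes
  \<open>a x + b y - Q x y - p1 \<bullet> x - p2 \<bullet> y\<close>, so there the tilt \<open>(p1, p2)\<close> equals \<open>\<Gamma> (x, y)\<close>, the gradient of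
  \<open>a + b - Q\<close>. The map \<open>\<Gamma>\<close> is Lipschitz and sends the null set on which the gradients of \<open>a\<close> or \<open>b\<close> are not
  differentiable to a null set. Hence there are arbitrarily small tilts whose maximizers avoid that set.
  At such a maximizer \<open>a\<close> and \<open>b\<close> have second-order expansions; the necessary condition for a maximum is
  the inequality between the Hessians. As \<open>a\<close> lies above the supremal convolution, with equality at \<open>x\<close>
  where the supremum is attained at \<open>h\<close>, its expansion translated from \<open>x\<close> to \<open>h\<close> touches \<open>u1\<close> from above;
  likewise for \<open>b\<close> and \<open>u2\<close>.
\<close>

theorem sums_second_order:
  assumes \<sigma>: "\<sigma> > 0"
  obtains h k p q X Y where "h \<in> D1" "k \<in> D2" "norm h < \<sigma>" "norm k < \<sigma>" "norm p < \<sigma>" "norm q < \<sigma>"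
    "linear X" "linear Y"
    "\<exists>d>0. \<forall>h'\<in>D1. norm (h' - h) < d \<longrightarrow>
       u1 h' \<le> u1 h + p \<bullet> (h' - h) + (h' - h) \<bullet> X (h' - h) / 2 + \<sigma> * (norm (h' - h))\<^sup>2"
    "\<exists>d>0. \<forall>k'\<in>D2. norm (k' - k) < d \<longrightarrow>
       u2 k' \<le> u2 k + q \<bullet> (k' - k) + (k' - k) \<bullet> Y (k' - k) / 2 + \<sigma> * (norm (k' - k))\<^sup>2"
    "\<And>\<xi> \<zeta>. \<xi> \<bullet> X \<xi> + \<zeta> \<bullet> Y \<zeta> \<le> (\<xi> - \<zeta>) \<bullet> B (\<xi> - \<zeta>)"
proof -
  have K: "K \<ge> 2" "K \<ge> 2 * \<beta>" unfolding K_def using beta_nonneg R(1) by simp_all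
  \<comment> \<open>The points will satisfy \<open>|h|, |k| < \<kappa>\<close> and the slopes will be at most \<open>\<kappa> (1 + 4\<beta>)\<close>. The sizes
    \<open>\<kappa>'\<close> of the displacements \<open>x - h\<close>, \<open>y - k\<close> and \<open>\<rho>\<close> of the tilt are chosen such that the last bound
    of \<open>Psi_max\<close> gives the former.\<close>
  define \<kappa> where "\<kappa> = \<sigma> / (2 * (1 + 4 * \<beta>))"
  have \<kappa>: "\<kappa> > 0" "\<kappa> * (1 + 4 * \<beta>) < \<sigma>" "\<kappa> < \<sigma>"
  proof -
    show "\<kappa> > 0" using \<sigma> beta_nonneg by (simp add: \<kappa>_def)
    have "\<kappa> * (1 + 4 * \<beta>) = \<sigma> / 2" using beta_nonneg by (simp add: \<kappa>_def field_simps)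
    then show *: "\<kappa> * (1 + 4 * \<beta>) < \<sigma>" using \<sigma> by simp
    have "\<kappa> * 1 \<le> \<kappa> * (1 + 4 * \<beta>)" using \<open>\<kappa> > 0\<close> beta_nonneg by (intro mult_left_mono) auto
    with * show "\<kappa> < \<sigma>" by simp
  qed
  define \<kappa>' where "\<kappa>' = min \<kappa> (\<tau> * \<kappa>\<^sup>2 / (4 * K))"
  have \<kappa>': "\<kappa>' > 0" "\<kappa>' \<le> \<kappa>" "K * \<kappa>' \<le> \<tau> * \<kappa>\<^sup>2 / 4"
  proof -
    show "\<kappa>' > 0" using \<kappa> \<tau> K by (simp add: \<kappa>'_def)
    have "K * \<kappa>' \<le> K * (\<tau> * \<kappa>\<^sup>2 / (4 * K))" using K by (intro mult_left_mono) (auto simp: \<kappa>'_def)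
    also have "\<dots> = \<tau> * \<kappa>\<^sup>2 / 4" using K by simp
    finally show "K * \<kappa>' \<le> \<tau> * \<kappa>\<^sup>2 / 4" .
  qed (simp add: \<kappa>'_def)
  define \<rho> where "\<rho> = min (min 1 \<kappa>) (\<tau> * \<kappa>\<^sup>2 / (8 * (R + 1)))"
  have \<rho>: "\<rho> > 0" "\<rho> \<le> 1" "\<rho> \<le> \<kappa>" "2 * \<rho> * R \<le> \<tau> * \<kappa>\<^sup>2 / 4"
  proof -
    show "\<rho> > 0" using \<kappa> \<tau> R(1) by (simp add: \<rho>_def)
    have "2 * \<rho> * R \<le> 2 * \<rho> * (R + 1)" using \<open>\<rho> > 0\<close> by simp
    also have "\<dots> \<le> 2 * (\<tau> * \<kappa>\<^sup>2 / (8 * (R + 1))) * (R + 1)"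
      using R(1) by (intro mult_right_mono mult_left_mono) (auto simp: \<rho>_def)
    also have "\<dots> = \<tau> * \<kappa>\<^sup>2 / 4" using R(1) by (simp add: field_simps)
    finally show "2 * \<rho> * R \<le> \<tau> * \<kappa>\<^sup>2 / 4" .
  qed (simp_all add: \<rho>_def)
  define \<eta> where "\<eta> = min (1 / (4 * K)) (\<kappa>'\<^sup>2 / (2 * K))"
  have \<eta>: "\<eta> > 0" "2 * K * \<eta> < 1" "2 * \<eta> * K \<le> \<kappa>'\<^sup>2" "\<beta> * \<eta> \<le> 1"
  proof -
    show "\<eta> > 0" using \<kappa>' K by (simp add: \<eta>_def)
    have "\<eta> * K \<le> 1 / (4 * K) * K" using K by (intro mult_right_mono) (auto simp: \<eta>_def)
    also have "\<dots> = 1 / 4" using K by simp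
    finally have *: "\<eta> * K \<le> 1 / 4" .
    then show "2 * K * \<eta> < 1" by (simp add: mult_ac)
    have "\<eta> * K \<le> \<kappa>'\<^sup>2 / (2 * K) * K" using K by (intro mult_right_mono) (auto simp: \<eta>_def)
    also have "\<dots> = \<kappa>'\<^sup>2 / 2" using K by simp
    finally show "2 * \<eta> * K \<le> \<kappa>'\<^sup>2" by simp
    have "\<beta> * \<eta> \<le> K * \<eta>" using K beta_nonneg \<open>\<eta> > 0\<close> by (intro mult_right_mono) auto
    with * show "\<beta> * \<eta> \<le> 1" by (simp add: mult_ac)
  qed
  have D: "D1 \<noteq> {}" "D2 \<noteq> {}" using D1 D2 by auto
  obtain a Ga where a:
    "\<And>x h. h \<in> D1 \<Longrightarrow> u1 h - (norm (x - h))\<^sup>2 / (2 * \<eta>) \<le> a x"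
    "\<And>z c x. (\<And>y h. h \<in> D1 \<Longrightarrow> u1 h - (norm (y - h))\<^sup>2 / (2 * \<eta>) \<le> c + (norm (y - z))\<^sup>2 / (2 * \<eta>))
        \<Longrightarrow> a x \<le> c + (norm (x - z))\<^sup>2 / (2 * \<eta>)"
    "\<And>x y. \<bar>a y - a x - Ga x \<bullet> (y - x)\<bar> \<le> (norm (y - x))\<^sup>2 / (2 * \<eta>)"
    using c11_envelope[OF D1(1) D(1) u1 \<eta>(1)] by blast
  obtain b Gb where b:
    "\<And>x h. h \<in> D2 \<Longrightarrow> u2 h - (norm (x - h))\<^sup>2 / (2 * \<eta>) \<le> b x"
    "\<And>z c x. (\<And>y h. h \<in> D2 \<Longrightarrow> u2 h - (norm (y - h))\<^sup>2 / (2 * \<eta>) \<le> c + (norm (y - z))\<^sup>2 / (2 * \<eta>))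
        \<Longrightarrow> b x \<le> c + (norm (x - z))\<^sup>2 / (2 * \<eta>)"
    "\<And>x y. \<bar>b y - b x - Gb x \<bullet> (y - x)\<bar> \<le> (norm (y - x))\<^sup>2 / (2 * \<eta>)"
    using c11_envelope[OF D2(1) D(2) u2 \<eta>(1)] by blast
  have a3: "\<bar>a y - a x - Ga x \<bullet> (y - x)\<bar> \<le> (1 / (2 * \<eta>)) * (norm (y - x))\<^sup>2"
    and b3: "\<bar>b y - b x - Gb x \<bullet> (y - x)\<bar> \<le> (1 / (2 * \<eta>)) * (norm (y - x))\<^sup>2" for x y
    using a(3)[of y x] b(3)[of y x] by simp_all
  have c0: "1 / (2 * \<eta>) \<ge> 0" using \<eta>(1) by simp
  have Ga_lip: "norm (Ga x - Ga y) \<le> 6 * (1 / (2 * \<eta>)) * norm (x - y)"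
    and Gb_lip: "norm (Gb x - Gb y) \<le> 6 * (1 / (2 * \<eta>)) * norm (x - y)" for x y
    by (rule c11_gradient_lipschitz[OF c0], rule a3, rule c11_gradient_lipschitz[OF c0], rule b3)
  obtain Na where Na: "negligible Na" "\<And>x. x \<notin> Na \<Longrightarrow> Ga differentiable (at x)"
    using rademacher_vector[of Ga, OF Ga_lip] by blast
  obtain Nb where Nb: "negligible Nb" "\<And>x. x \<notin> Nb \<Longrightarrow> Gb differentiable (at x)"
    using rademacher_vector[of Gb, OF Gb_lip] by blast
  define N where "N = Na \<times> (UNIV :: 'a set) \<union> (UNIV :: 'a set) \<times> Nb"
  have N: "negligible N" unfolding N_def by (intro negligible_Un negligible_cylinder Na(1) Nb(1))
  define \<Gamma> where "\<Gamma> = (\<lambda>(x, y). (Ga x - B (x - y), Gb y + B (x - y)))"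
  have "negligible (\<Gamma> ` N)"
  proof (rule negligible_locally_Lipschitz_image[OF _ N])
    fix z :: "'a \<times> 'a"
    let ?L = "2 * (6 * (1 / (2 * \<eta>)) + 2 * \<beta>)"
    have "norm (\<Gamma> w - \<Gamma> z) \<le> ?L * norm (w - z)" for w
    proof -
      obtain x y x' y' where wz: "w = (x, y)" "z = (x', y')" by (cases w, cases z)
      have n: "norm (x - x') \<le> norm (w - z)" "norm (y - y') \<le> norm (w - z)"
        using norm_fst_le[of "x - x'" "y - y'"] norm_snd_le[of "y - y'" "x - x'"] by (auto simp: wz)
      have Bd: "norm (B (x - y) - B (x' - y')) \<le> 2 * \<beta> * norm (w - z)"
      proof -
        have "B (x - y) - B (x' - y') = B ((x - x') - (y - y'))"
          by (simp add: linear_diff[OF B(1)])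
        also have "norm \<dots> \<le> \<beta> * norm ((x - x') - (y - y'))" by (rule B_bound)
        also have "\<dots> \<le> \<beta> * (2 * norm (w - z))"
          using norm_triangle_ineq4[of "x - x'" "y - y'"] n beta_nonneg by (intro mult_left_mono) auto
        finally show ?thesis by simp
      qed
      have g1: "norm (Ga x - Ga x') \<le> 6 * (1 / (2 * \<eta>)) * norm (w - z)"
        using \<eta>(1) n by (intro order_trans[OF Ga_lip] mult_left_mono) auto
      have g2: "norm (Gb y - Gb y') \<le> 6 * (1 / (2 * \<eta>)) * norm (w - z)"
        using \<eta>(1) n by (intro order_trans[OF Gb_lip] mult_left_mono) auto
      have e1: "norm ((Ga x - B (x - y)) - (Ga x' - B (x' - y'))) \<le> (6 * (1 / (2 * \<eta>)) + 2 * \<beta>) * norm (w - z)"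
        using norm_triangle_ineq4[of "Ga x - Ga x'" "B (x - y) - B (x' - y')"] g1 Bd
        by (simp add: algebra_simps)
      have e2: "norm ((Gb y + B (x - y)) - (Gb y' + B (x' - y'))) \<le> (6 * (1 / (2 * \<eta>)) + 2 * \<beta>) * norm (w - z)"
        using norm_triangle_ineq[of "Gb y - Gb y'" "B (x - y) - B (x' - y')"] g2 Bd
        by (simp add: algebra_simps)
      have "norm (\<Gamma> w - \<Gamma> z) \<le> norm ((Ga x - B (x - y)) - (Ga x' - B (x' - y'))) + norm ((Gb y + B (x - y)) - (Gb y' + B (x' - y')))"
        by (simp add: \<Gamma>_def wz norm_Pair sqrt_sum_squares_le_sum)
      with e1 e2 show ?thesis by (simp add: algebra_simps)
    qed
    then show "\<exists>T L. open T \<and> z \<in> T \<and> (\<forall>w\<in>N \<inter> T. norm (\<Gamma> w - \<Gamma> z) \<le> L * norm (w - z))"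
      by (intro exI[of _ UNIV] exI[of _ ?L]) auto
  qed simp
  moreover have "\<not> negligible (ball (0 :: 'a \<times> 'a) \<rho>)"
    using \<rho>(1) by (intro open_not_negligible) auto
  ultimately obtain P where P: "P \<in> ball 0 \<rho>" "P \<notin> \<Gamma> ` N" by (meson negligible_subset subsetI)
  obtain p1 p2 where p12: "P = (p1, p2)" by (cases P)
  have p: "norm p1 \<le> \<rho>" "norm p2 \<le> \<rho>"
    using P(1) norm_fst_le[of p1 p2] norm_snd_le[of p2 p1] by (auto simp: p12)
  obtain x y h k where hk: "h \<in> D1" "k \<in> D2" and
    mx: "\<And>x' y' h' k'. h' \<in> D1 \<Longrightarrow> k' \<in> D2 \<Longrightarrow> \<Psi> \<eta> p1 p2 x' y' h' k' \<le> \<Psi> \<eta> p1 p2 x y h k" and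
    "norm (x - h, y - k) \<le> 1" and
    dd: "(norm (x - h, y - k))\<^sup>2 \<le> 2 * \<eta> * K" and
    hk2: "\<tau> * ((norm h)\<^sup>2 + (norm k)\<^sup>2) \<le> K * norm (x - h, y - k) + 2 * \<rho> * R"
    by (rule Psi_max[OF \<eta>(1,2) p \<rho>(2)], rule that, assumption+)
  have dk: "norm (x - h, y - k) \<le> \<kappa>'"
    by (rule power2_le_imp_le[OF order_trans[OF dd \<eta>(3)]]) (use \<kappa>'(1) in simp)
  have "\<tau> * ((norm h)\<^sup>2 + (norm k)\<^sup>2) \<le> \<tau> * \<kappa>\<^sup>2 / 2"
  proof -
    have "K * norm (x - h, y - k) \<le> K * \<kappa>'" using K dk by (intro mult_left_mono) auto
    with hk2 \<kappa>'(3) \<rho>(4) show ?thesis by linarith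
  qed
  then have "(norm h)\<^sup>2 + (norm k)\<^sup>2 \<le> \<kappa>\<^sup>2 / 2" using \<tau> by simp
  moreover have "\<kappa>\<^sup>2 > 0" using \<kappa>(1) by simp
  ultimately have "(norm h)\<^sup>2 < \<kappa>\<^sup>2" "(norm k)\<^sup>2 < \<kappa>\<^sup>2"
    using zero_le_power2[of "norm h"] zero_le_power2[of "norm k"] by linarith+
  then have hk_small: "norm h < \<kappa>" "norm k < \<kappa>"
    using \<kappa>(1) by (auto intro: power_less_imp_less_base)
  have xy: "norm (x - y) \<le> 4 * \<kappa>"
  proof -
    have "norm (x - y) = norm ((x - h) - (y - k) + h - k)" by simp
    then have "norm (x - y) \<le> norm (x - h) + norm (y - k) + norm h + norm k"
      using norm_triangle_ineq4[of "(x - h) - (y - k) + h" k] norm_triangle_ineq[of "(x - h) - (y - k)" h]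
        norm_triangle_ineq4[of "x - h" "y - k"] by linarith
    moreover have "norm (x - h) \<le> \<kappa>" "norm (y - k) \<le> \<kappa>"
      using dk \<kappa>'(2) norm_fst_le[of "x - h" "y - k"] norm_snd_le[of "y - k" "x - h"] by linarith+
    ultimately show ?thesis using hk_small by linarith
  qed
  define m where "m = \<Psi> \<eta> p1 p2 x y h k"
  \<comment> \<open>The inequality between \<open>\<Psi>\<close> and its maximum passes to the envelopes, one variable at a time:
    with the other variable fixed, the coupling and the tilt form an admissible majorant.\<close>
  have ab: "a x' + b y' - Q x' y' - p1 \<bullet> x' - p2 \<bullet> y' \<le> m" for x' y'
  proof -
    have a_le: "a x' \<le> m + Q x' y' + p1 \<bullet> x' + p2 \<bullet> y' - (u2 k' - (norm (y' - k'))\<^sup>2 / (2 * \<eta>))"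
      if "k' \<in> D2" for k' x' y'
    proof (rule envelope_le_quadratic[OF a(2) \<eta>(1), where g = "B (x' - y') + p1" and
        q = "\<lambda>x. m + Q x y' + p1 \<bullet> x + p2 \<bullet> y' - (u2 k' - (norm (y' - k'))\<^sup>2 / (2 * \<eta>))"])
      show "u1 h' - (norm (x - h'))\<^sup>2 / (2 * \<eta>) \<le> m + Q x y' + p1 \<bullet> x + p2 \<bullet> y' - (u2 k' - (norm (y' - k'))\<^sup>2 / (2 * \<eta>))"
        if "h' \<in> D1" for x h'
        using mx[OF that \<open>k' \<in> D2\<close>, of x y'] by (simp add: m_def \<Psi>_def)
      show "m + Q x y' + p1 \<bullet> x + p2 \<bullet> y' - (u2 k' - (norm (y' - k'))\<^sup>2 / (2 * \<eta>))
        \<le> m + Q x' y' + p1 \<bullet> x' + p2 \<bullet> y' - (u2 k' - (norm (y' - k'))\<^sup>2 / (2 * \<eta>))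
          + (B (x' - y') + p1) \<bullet> (x - x') + (norm (x - x'))\<^sup>2 / (2 * \<eta>)" for x
        using Q_expand[of x' "x - x'" y' 0] Q_semiconcave[OF \<eta>(1,4), of "x - x'"]
        by (simp add: inner_add_left inner_diff_right)
    qed
    have "b y' \<le> m + Q x' y' + p1 \<bullet> x' + p2 \<bullet> y' - a x'"
    proof (rule envelope_le_quadratic[OF b(2) \<eta>(1), where g = "- B (x' - y') + p2" and
        q = "\<lambda>y. m + Q x' y + p1 \<bullet> x' + p2 \<bullet> y - a x'"])
      show "u2 k' - (norm (y - k'))\<^sup>2 / (2 * \<eta>) \<le> m + Q x' y + p1 \<bullet> x' + p2 \<bullet> y - a x'"
        if "k' \<in> D2" for y k'
        using a_le[OF that, of x' y] by linarith
      show "m + Q x' y + p1 \<bullet> x' + p2 \<bullet> y - a x' \<le> m + Q x' y' + p1 \<bullet> x' + p2 \<bullet> y' - a x'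
          + (- B (x' - y') + p2) \<bullet> (y - y') + (norm (y - y'))\<^sup>2 / (2 * \<eta>)" for y
        using Q_expand[of x' 0 y' "y - y'"] Q_semiconcave[OF \<eta>(1,4), of "y' - y"]
        by (simp add: inner_add_left inner_diff_left inner_diff_right norm_minus_commute)
    qed
    then show ?thesis by linarith
  qed
  have eq: "a x = u1 h - (norm (x - h))\<^sup>2 / (2 * \<eta>)" "b y = u2 k - (norm (y - k))\<^sup>2 / (2 * \<eta>)"
    using ab[of x y] a(1)[OF hk(1), of x] b(1)[OF hk(2), of y] unfolding m_def \<Psi>_def by linarith+
  have m_eq: "m = a x + b y - Q x y - p1 \<bullet> x - p2 \<bullet> y" unfolding m_def \<Psi>_def eq by simp
  have ab': "a (x + s) - a x + (b (y + t) - b y) \<le> B (x - y) \<bullet> (s - t) + (s - t) \<bullet> B (s - t) / 2 + p1 \<bullet> s + p2 \<bullet> t" for s t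
    using ab[of "x + s" "y + t"] unfolding m_eq Q_expand by (simp add: inner_add_right)
  \<comment> \<open>First-order conditions at the maximizer.\<close>
  have gx: "Ga x = p1 + B (x - y)"
  proof -
    have "(Ga x - (p1 + B (x - y))) \<bullet> s \<le> (1 / \<eta>) * (norm s)\<^sup>2" for s
      using ab'[of s 0] a(3)[of "x + s" x] Q_semiconcave[OF \<eta>(1,4), of s]
      by (simp add: inner_diff_left inner_add_left)
    from inner_le_square_imp_zero[OF this] show ?thesis by simp
  qed
  have gy: "Gb y = p2 - B (x - y)"
  proof -
    have "(Gb y - (p2 - B (x - y))) \<bullet> t \<le> (1 / \<eta>) * (norm t)\<^sup>2" for t
      using ab'[of 0 t] b(3)[of "y + t" y] Q_semiconcave[OF \<eta>(1,4), of "- t"]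
      by (simp add: inner_diff_left inner_add_left)
    from inner_le_square_imp_zero[OF this] show ?thesis by simp
  qed
  have "\<Gamma> (x, y) = P" by (simp add: \<Gamma>_def gx gy p12)
  with P(2) have "(x, y) \<notin> N" by blast
  then have "x \<notin> Na" "y \<notin> Nb" by (auto simp: N_def)
  with Na(2) Nb(2) obtain X Y where XY: "(Ga has_derivative X) (at x)" "(Gb has_derivative Y) (at y)"
    unfolding differentiable_def by blast
  have lin: "linear X" "linear Y" using XY has_derivative_linear by blast+
  have gsmall: "norm (p + B (x - y)) < \<sigma>" "norm (p - B (x - y)) < \<sigma>" if "norm p \<le> \<rho>" for p
  proof -
    have "norm (B (x - y)) \<le> \<beta> * (4 * \<kappa>)"
      using xy beta_nonneg by (intro order_trans[OF B_bound] mult_left_mono) auto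
    then have "norm p + norm (B (x - y)) \<le> \<kappa> * (1 + 4 * \<beta>)" using that \<rho>(3) by (simp add: algebra_simps)
    with \<kappa>(2) norm_triangle_ineq[of p "B (x - y)"] norm_triangle_ineq4[of p "B (x - y)"]
    show "norm (p + B (x - y)) < \<sigma>" "norm (p - B (x - y)) < \<sigma>" by linarith+
  qed
  show ?thesis
  proof (rule that[OF hk _ _ _ _ lin])
    show "norm h < \<sigma>" "norm k < \<sigma>" using hk_small \<kappa>(3) by linarith+
    show "norm (Ga x) < \<sigma>" "norm (Gb y) < \<sigma>" unfolding gx gy using gsmall p by auto
    show "\<exists>d>0. \<forall>h'\<in>D1. norm (h' - h) < d \<longrightarrow>
       u1 h' \<le> u1 h + Ga x \<bullet> (h' - h) + (h' - h) \<bullet> X (h' - h) / 2 + \<sigma> * (norm (h' - h))\<^sup>2"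
    proof -
      obtain d where d: "d > 0" "\<And>s. norm s < d \<Longrightarrow> \<bar>a (x + s) - a x - Ga x \<bullet> s - (s \<bullet> X s) / 2\<bar> \<le> \<sigma> * (norm s)\<^sup>2"
        using c11_second_order_expansion[OF a3 XY(1) \<sigma>] by blast
      show ?thesis
      proof (intro exI[of _ d] conjI d(1) ballI impI)
        fix h' assume h': "h' \<in> D1" "norm (h' - h) < d"
        show "u1 h' \<le> u1 h + Ga x \<bullet> (h' - h) + (h' - h) \<bullet> X (h' - h) / 2 + \<sigma> * (norm (h' - h))\<^sup>2"
          using d(2)[OF h'(2)] a(1)[OF h'(1), of "x + (h' - h)"] eq(1) by (simp add: abs_le_iff)
      qed
    qed
    show "\<exists>d>0. \<forall>k'\<in>D2. norm (k' - k) < d \<longrightarrow>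
       u2 k' \<le> u2 k + Gb y \<bullet> (k' - k) + (k' - k) \<bullet> Y (k' - k) / 2 + \<sigma> * (norm (k' - k))\<^sup>2"
    proof -
      obtain d where d: "d > 0" "\<And>s. norm s < d \<Longrightarrow> \<bar>b (y + s) - b y - Gb y \<bullet> s - (s \<bullet> Y s) / 2\<bar> \<le> \<sigma> * (norm s)\<^sup>2"
        using c11_second_order_expansion[OF b3 XY(2) \<sigma>] by blast
      show ?thesis
      proof (intro exI[of _ d] conjI d(1) ballI impI)
        fix k' assume k': "k' \<in> D2" "norm (k' - k) < d"
        show "u2 k' \<le> u2 k + Gb y \<bullet> (k' - k) + (k' - k) \<bullet> Y (k' - k) / 2 + \<sigma> * (norm (k' - k))\<^sup>2"
          using d(2)[OF k'(2)] b(1)[OF k'(1), of "y + (k' - k)"] eq(2) by (simp add: abs_le_iff)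
      qed
    qed
    \<comment> \<open>Second-order condition along the ray through \<open>(\<xi>, \<zeta>)\<close>, with \<open>r\<close> small enough for both expansions.\<close>
    show "\<xi> \<bullet> X \<xi> + \<zeta> \<bullet> Y \<zeta> \<le> (\<xi> - \<zeta>) \<bullet> B (\<xi> - \<zeta>)" for \<xi> \<zeta>
    proof -
      have "\<xi> \<bullet> X \<xi> + \<zeta> \<bullet> Y \<zeta> - (\<xi> - \<zeta>) \<bullet> B (\<xi> - \<zeta>) \<le> e * (2 * ((norm \<xi>)\<^sup>2 + (norm \<zeta>)\<^sup>2))" if e: "e > 0" for e
      proof -
        obtain d1 where d1: "d1 > 0" "\<And>s. norm s < d1 \<Longrightarrow> \<bar>a (x + s) - a x - Ga x \<bullet> s - (s \<bullet> X s) / 2\<bar> \<le> e * (norm s)\<^sup>2"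
          using c11_second_order_expansion[OF a3 XY(1) e] by blast
        obtain d2 where d2: "d2 > 0" "\<And>s. norm s < d2 \<Longrightarrow> \<bar>b (y + s) - b y - Gb y \<bullet> s - (s \<bullet> Y s) / 2\<bar> \<le> e * (norm s)\<^sup>2"
          using c11_second_order_expansion[OF b3 XY(2) e] by blast
        define r where "r = min d1 d2 / (2 * (norm \<xi> + norm \<zeta> + 1))"
        have den: "2 * (norm \<xi> + norm \<zeta> + 1) > 0" by (simp add: add_nonneg_pos)
        have r: "r > 0" using d1 d2 den by (simp add: r_def)
        have rr: "r * (2 * (norm \<xi> + norm \<zeta> + 1)) = min d1 d2" using den by (simp add: r_def)
        have "r * norm \<xi> < r * (2 * (norm \<xi> + norm \<zeta> + 1))" "r * norm \<zeta> < r * (2 * (norm \<xi> + norm \<zeta> + 1))"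
          using r by (intro mult_strict_left_mono; smt (verit) norm_ge_zero)+
        then have "norm (r *\<^sub>R \<xi>) < d1" "norm (r *\<^sub>R \<zeta>) < d2" unfolding rr using r by auto
        note est = d1(2)[OF this(1)] d2(2)[OF this(2)]
        have sc: "(r *\<^sub>R \<xi>) \<bullet> X (r *\<^sub>R \<xi>) = r\<^sup>2 * (\<xi> \<bullet> X \<xi>)" "(r *\<^sub>R \<zeta>) \<bullet> Y (r *\<^sub>R \<zeta>) = r\<^sup>2 * (\<zeta> \<bullet> Y \<zeta>)"
          "(r *\<^sub>R \<xi> - r *\<^sub>R \<zeta>) \<bullet> B (r *\<^sub>R \<xi> - r *\<^sub>R \<zeta>) = r\<^sup>2 * ((\<xi> - \<zeta>) \<bullet> B (\<xi> - \<zeta>))"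
          using lin B(1) by (simp_all add: linear_cmul power2_eq_square mult_ac flip: scaleR_diff_right)
        have ns: "(norm (r *\<^sub>R \<xi>))\<^sup>2 = r\<^sup>2 * (norm \<xi>)\<^sup>2" "(norm (r *\<^sub>R \<zeta>))\<^sup>2 = r\<^sup>2 * (norm \<zeta>)\<^sup>2"
          by (simp_all add: power_mult_distrib)
        have lins: "Ga x \<bullet> (r *\<^sub>R \<xi>) + Gb y \<bullet> (r *\<^sub>R \<zeta>)
          = B (x - y) \<bullet> (r *\<^sub>R \<xi> - r *\<^sub>R \<zeta>) + p1 \<bullet> (r *\<^sub>R \<xi>) + p2 \<bullet> (r *\<^sub>R \<zeta>)"
          unfolding gx gy by (simp add: inner_add_left inner_diff_left inner_diff_right algebra_simps)
        have "r\<^sup>2 * (\<xi> \<bullet> X \<xi>) / 2 + r\<^sup>2 * (\<zeta> \<bullet> Y \<zeta>) / 2 - r\<^sup>2 * ((\<xi> - \<zeta>) \<bullet> B (\<xi> - \<zeta>)) / 2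
            \<le> e * (r\<^sup>2 * (norm \<xi>)\<^sup>2) + e * (r\<^sup>2 * (norm \<zeta>)\<^sup>2)"
          using est ab'[of "r *\<^sub>R \<xi>" "r *\<^sub>R \<zeta>"] lins unfolding sc ns by linarith
        then have "r\<^sup>2 * (\<xi> \<bullet> X \<xi> + \<zeta> \<bullet> Y \<zeta> - (\<xi> - \<zeta>) \<bullet> B (\<xi> - \<zeta>)) \<le> r\<^sup>2 * (e * (2 * ((norm \<xi>)\<^sup>2 + (norm \<zeta>)\<^sup>2)))"
          unfolding distrib_left right_diff_distrib mult.left_commute[of "r\<^sup>2"] by linarith
        then show ?thesis using r by (simp add: mult_le_cancel_left_pos)
      qed
      from nonpos_if_le_small_multiples[OF this] show ?thesis by linarith
    qed
  qed
qed

end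

section \<open>Traces, Pucci operators and ellipticity\<close>

definition psd :: "real ^ 'n ^ 'n \<Rightarrow> bool" where
  "psd M \<longleftrightarrow> symmetric_matrix M \<and> (\<forall>x. 0 \<le> x \<bullet> (M *v x))"

definition outer :: "real ^ 'n \<Rightarrow> real ^ 'n ^ 'n" where
  "outer v = (\<chi> i j. v $ i * v $ j)"

lemma symmetric_matrix_nth:
  assumes "symmetric_matrix M" shows "M $ i $ j = M $ j $ i"
proof -
  have "transpose M $ i $ j = M $ j $ i" by (simp add: transpose_def)
  with assms show ?thesis by (simp add: symmetric_matrix_def)
qed

lemma symmetric_matrixI: "(\<And>i j. M $ i $ j = M $ j $ i) \<Longrightarrow> symmetric_matrix M"
  by (simp add: symmetric_matrix_def transpose_def vec_eq_iff)

lemma symmetric_matrix_arith [intro]: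
  "symmetric_matrix M \<Longrightarrow> symmetric_matrix N \<Longrightarrow> symmetric_matrix (M + N)"
  "symmetric_matrix M \<Longrightarrow> symmetric_matrix N \<Longrightarrow> symmetric_matrix (M - N)"
  "symmetric_matrix M \<Longrightarrow> symmetric_matrix (- M)"
  "symmetric_matrix M \<Longrightarrow> symmetric_matrix (c *\<^sub>R M)"
  "symmetric_matrix (outer v)" "symmetric_matrix (mat a)" "symmetric_matrix 0"
  by (auto intro!: symmetric_matrixI simp: symmetric_matrix_nth outer_def mult.commute mat_def)

lemma symmetric_matrix_inner: "symmetric_matrix M \<Longrightarrow> (M *v x) \<bullet> y = x \<bullet> (M *v y)"
  using vector_transpose_matrix[of x M] dot_lmul_matrix[of x M y] unfolding symmetric_matrix_def by simp

lemma outer_mult: "outer v *v x = (v \<bullet> x) *\<^sub>R v"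
  by (simp add: vec_eq_iff outer_def matrix_vector_mult_def inner_vec_def sum_distrib_left mult_ac)

lemma matrix_mult_arith:
  fixes M N :: "real ^ 'n ^ 'n"
  shows "(M - N) *v x = M *v x - N *v x" "(M + N) *v x = M *v x + N *v x" "(- M) *v x = - (M *v x)"
  "(c *\<^sub>R M) *v x = c *\<^sub>R (M *v x)"
proof -
  show "(- M) *v x = - (M *v x)" by (simp add: vec_eq_iff matrix_vector_mult_def sum_negf)
qed (rule matrix_vector_mult_diff_rdistrib matrix_vector_mult_add_rdistrib scaleR_matrix_vector_assoc[symmetric])+

lemma mat_eq_scaleR: "mat c = c *\<^sub>R (mat 1 :: real ^ 'n ^ 'n)"
  by (simp add: vec_eq_iff mat_def)

lemma mat_mult: "mat c *v x = c *\<^sub>R (x :: real ^ 'n)"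
  by (subst mat_eq_scaleR) (simp add: matrix_mult_arith)

lemma trace_mult: "trace (A ** B) = (\<Sum>i\<in>UNIV. \<Sum>j\<in>UNIV. A $ i $ j * B $ j $ i)"
  by (simp add: trace_def matrix_matrix_mult_def)

lemma trace_mult_outer: "trace (A ** outer v) = v \<bullet> (A *v v)"
  by (simp add: trace_mult outer_def inner_vec_def matrix_vector_mult_def sum_distrib_left mult_ac)

lemma trace_mult_scaleR: "trace (A ** (c *\<^sub>R B)) = c * trace (A ** (B :: real ^ 'n ^ 'n))"
  by (simp add: trace_mult sum_distrib_left mult_ac)

lemma trace_mult_mat: "trace (A ** mat c) = c * trace (A :: real ^ 'n ^ 'n)"
  by (subst mat_eq_scaleR) (simp add: trace_mult_scaleR)

lemma trace_mult_diff: "trace (A ** (B - C)) = trace (A ** B) - trace (A ** (C :: real ^ 'n ^ 'n))"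
  "trace ((B - C) ** A) = trace (B ** A) - trace (C ** A)"
  by (simp_all add: trace_mult right_diff_distrib left_diff_distrib sum_subtractf)

lemma quadform_axis: "axis i 1 \<bullet> (M *v axis j 1) = M $ i $ j" for M :: "real ^ 'n ^ 'n"
  by (simp add: inner_axis' matrix_vector_mult_basis column_def)

text \<open>
  Symmetric Gaussian elimination, by induction on the index set \<open>S\<close> that supports \<open>B\<close>. A diagonal entry
  \<open>c > 0\<close> allows to subtract \<open>v v\<^sup>T / c\<close>, where \<open>v\<close> is the corresponding column; the rest, a Schur
  complement, is again positive semidefinite, with smaller support, and the trace of \<open>A\<close> against
  \<open>v v\<^sup>T\<close> is a value of the quadratic form of \<open>A\<close>. A vanishing diagonal entry forces its whole row to
  vanish.
\<close>

lemma trace_mult_psd_nonneg_supported: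
  assumes A: "psd A" and "finite S" and B: "psd B" "\<And>i j. i \<notin> S \<Longrightarrow> B $ i $ j = 0"
  shows "0 \<le> trace (A ** B)"
  using \<open>finite S\<close> B
proof (induction S arbitrary: B)
  case empty
  then show ?case by (simp add: trace_mult)
next
  case (insert i S)
  have sym: "B $ j $ k = B $ k $ j" for j k
    using insert.prems(1) by (simp add: psd_def symmetric_matrix_nth)
  have quad: "0 \<le> x \<bullet> (B *v x)" for x using insert.prems(1) by (simp add: psd_def)
  define v where "v = B *v axis i 1"
  have v: "v $ j = B $ j $ i" for j
    by (simp add: v_def matrix_vector_mult_basis column_def)
  define c where "c = B $ i $ i"
  have shift: "(x - t *\<^sub>R axis i 1) \<bullet> (B *v (x - t *\<^sub>R axis i 1)) = x \<bullet> (B *v x) - 2 * t * (v \<bullet> x) + t\<^sup>2 * c" for x t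
  proof -
    have "axis i 1 \<bullet> (B *v x) = v \<bullet> x"
      using symmetric_matrix_inner[of B "axis i 1" x] insert.prems(1) by (simp add: psd_def v_def)
    moreover have "axis i 1 \<bullet> v = c" unfolding v_def c_def by (rule quadform_axis)
    ultimately show ?thesis
      by (simp add: matrix_vector_mult_diff_distrib matrix_vector_mult_scaleR inner_diff_left inner_diff_right
          inner_commute power2_eq_square algebra_simps flip: v_def)
  qed
  show ?case
  proof (cases "c = 0")
    case True
    have "v $ j = 0" for j
    proof -
      have "0 \<le> B $ j $ j" using quad[of "axis j 1"] by (simp add: quadform_axis)
      have "\<And>s. 2 * s * v $ j \<le> B $ j $ j"
        using shift[of "axis j 1"] quad[of "axis j 1 - s *\<^sub>R axis i 1" for s]
        by (simp add: True quadform_axis inner_axis)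
      from this[of "(B $ j $ j + 1) / (2 * v $ j)"] show ?thesis by (cases "v $ j = 0") auto
    qed
    then have "B $ i $ j = 0" for j using v sym by metis
    then show ?thesis using insert by (metis insertE)
  next
    case False
    have c: "c > 0" using False quad[of "axis i 1"] by (simp add: quadform_axis c_def)
    define B' where "B' = B - (1 / c) *\<^sub>R outer v"
    have "psd B'"
      unfolding psd_def
    proof
      show "symmetric_matrix B'" using insert.prems(1) unfolding B'_def psd_def by blast
      show "\<forall>x. 0 \<le> x \<bullet> (B' *v x)"
      proof
        fix x
        have "x \<bullet> (B' *v x) = x \<bullet> (B *v x) - (v \<bullet> x)\<^sup>2 / c"
          by (simp add: B'_def matrix_mult_arith outer_mult inner_diff_right inner_commute power2_eq_square)
        also have "\<dots> = (x - ((v \<bullet> x) / c) *\<^sub>R axis i 1) \<bullet> (B *v (x - ((v \<bullet> x) / c) *\<^sub>R axis i 1))"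
          unfolding shift using c by (simp add: power2_eq_square field_simps)
        finally show "0 \<le> x \<bullet> (B' *v x)" using quad by simp
      qed
    qed
    moreover have "B' $ j $ k = 0" if "j \<notin> S" for j k
    proof (cases "j = i")
      case True
      then show ?thesis using c by (simp add: B'_def outer_def v c_def sym[of i k])
    next
      case False
      then have "B $ j $ k = 0" "B $ j $ i = 0" using insert.prems(2) that by auto
      then show ?thesis by (simp add: B'_def outer_def v)
    qed
    ultimately have "0 \<le> trace (A ** B')" by (rule insert.IH)
    moreover have "trace (A ** B') = trace (A ** B) - (1 / c) * (v \<bullet> (A *v v))"
      by (simp add: B'_def trace_mult_diff trace_mult_scaleR trace_mult_outer)
    moreover have "0 \<le> (1 / c) * (v \<bullet> (A *v v))" using A c by (simp add: psd_def)
    ultimately show ?thesis by linarith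
  qed
qed

lemma trace_mult_psd_nonneg: "psd A \<Longrightarrow> psd B \<Longrightarrow> 0 \<le> trace (A ** B)"
  by (rule trace_mult_psd_nonneg_supported[of A UNIV B]) auto

text \<open>
  The difference is the trace of \<open>P\<close> against the projection onto the orthogonal complement of \<open>e\<close>.
\<close>

lemma psd_quadform_le_trace:
  assumes P: "psd P" and e: "norm e = 1"
  shows "e \<bullet> (P *v e) \<le> trace P"
proof -
  have "psd (mat 1 - outer e)"
    unfolding psd_def
  proof
    show "symmetric_matrix (mat 1 - outer e)" by blast
    show "\<forall>x. 0 \<le> x \<bullet> ((mat 1 - outer e) *v x)"
    proof
      fix x
      have "(e \<bullet> x)\<^sup>2 \<le> x \<bullet> x" using Cauchy_Schwarz_ineq[of e x] e by (simp add: dot_square_norm)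
      then show "0 \<le> x \<bullet> ((mat 1 - outer e) *v x)"
        by (simp add: matrix_mult_arith outer_mult mat_mult inner_diff_right inner_commute power2_eq_square)
    qed
  qed
  from trace_mult_psd_nonneg[OF P this] show ?thesis
    by (simp add: trace_mult_diff trace_mult_outer trace_mult_mat del: matrix_mul_rid)
qed

text \<open>
  With \<open>P = c Id - N \<ge> 0\<close> one has \<open>Tr (A N) = c Tr A - Tr (A P)\<close>, and \<open>Tr (A P) \<ge> l Tr P \<ge> l (e \<bullet> P e)\<close>.
\<close>

lemma pucci_plus_le:
  fixes N :: "real ^ 'n ^ 'n" and c l L :: real
  assumes l: "0 < l" "l \<le> L" and N: "symmetric_matrix N" and c: "0 \<le> c"
    and le: "\<And>x. x \<bullet> (N *v x) \<le> c * (norm x)\<^sup>2" and e: "norm e = 1"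
  shows "pucci_plus l L N \<le> c * (real CARD('n) * L) + l * (e \<bullet> (N *v e))"
  unfolding pucci_plus_def
proof (rule cSUP_least)
  have "mat l \<in> (elliptic_matrices l L :: (real ^ 'n ^ 'n) set)"
    using l by (auto simp: elliptic_matrices_def mat_mult mult_right_mono)
  then show "elliptic_matrices l L \<noteq> ({} :: (real ^ 'n ^ 'n) set)" by blast
  fix A :: "real ^ 'n ^ 'n" assume "A \<in> elliptic_matrices l L"
  then have A: "symmetric_matrix A" "\<And>x. l * (x \<bullet> x) \<le> x \<bullet> (A *v x)" "\<And>x. x \<bullet> (A *v x) \<le> L * (x \<bullet> x)"
    by (auto simp: elliptic_matrices_def)
  have Al: "psd (A - mat l)"
    using A by (auto simp: psd_def matrix_mult_arith mat_mult inner_diff_right)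
  have P: "psd (mat c - N)"
    using N le by (auto simp: psd_def matrix_mult_arith mat_mult inner_diff_right power2_norm_eq_inner)
  have "0 \<le> trace ((A - mat l) ** (mat c - N))" by (rule trace_mult_psd_nonneg[OF Al P])
  moreover have "trace ((A - mat l) ** (mat c - N)) = c * trace A - trace (A ** N) - l * trace (mat c - N)"
  proof -
    have "trace (mat l ** (mat c - N)) = l * trace (mat c - N)"
      by (subst trace_mul_sym) (rule trace_mult_mat)
    then show ?thesis by (simp only: trace_mult_diff(2)) (simp only: trace_mult_diff(1) trace_mult_mat)
  qed
  ultimately have "trace (A ** N) \<le> c * trace A - l * trace (mat c - N)" by simp
  also have "\<dots> \<le> c * (real CARD('n) * L) - l * (e \<bullet> ((mat c - N) *v e))"
  proof (intro diff_mono mult_left_mono)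
    have "A $ i $ i \<le> L" for i
      using A(3)[of "axis i 1"] by (simp add: quadform_axis)
    then show "trace A \<le> real CARD('n) * L"
      unfolding trace_def using sum_bounded_above[of UNIV "\<lambda>i. A $ i $ i" L] by simp
    show "e \<bullet> ((mat c - N) *v e) \<le> trace (mat c - N)" by (rule psd_quadform_le_trace[OF P e])
  qed (use l c in auto)
  also have "\<dots> = c * (real CARD('n) * L) - l * c + l * (e \<bullet> (N *v e))"
    using e by (simp add: matrix_mult_arith mat_mult inner_diff_right right_diff_distrib dot_square_norm)
  also have "\<dots> \<le> c * (real CARD('n) * L) + l * (e \<bullet> (N *v e))" using l c by simp
  finally show "trace (A ** N) \<le> c * (real CARD('n) * L) + l * (e \<bullet> (N *v e))" .
qed

text \<open>
  Ellipticity in the form in which it enters the maximum principle: if \<open>X - Y \<le> c Id\<close>, then \<open>F X\<close> exceeds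
  \<open>F Y\<close> by at most a multiple of \<open>c\<close>, and a single direction \<open>e\<close> in which \<open>X - Y\<close> is very negative
  makes \<open>F X\<close> smaller than \<open>F Y\<close>.
\<close>

definition elliptic_bound :: "real \<Rightarrow> real \<Rightarrow> (real ^ 'n ^ 'n \<Rightarrow> real) \<Rightarrow> bool" where
  "elliptic_bound l K F \<longleftrightarrow> 0 < l \<and> 0 < K \<and>
     (\<forall>X Y c e. symmetric_matrix X \<longrightarrow> symmetric_matrix Y \<longrightarrow> 0 \<le> c \<longrightarrow> norm e = 1 \<longrightarrow>
        (\<forall>x. x \<bullet> ((X - Y) *v x) \<le> c * (norm x)\<^sup>2) \<longrightarrow>
        F X - F Y \<le> c * K + l * (e \<bullet> ((X - Y) *v e)))"

lemma elliptic_boundD: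
  assumes "elliptic_bound l K F" "symmetric_matrix X" "symmetric_matrix Y" "0 \<le> c" "norm e = 1"
    "\<And>x. x \<bullet> ((X - Y) *v x) \<le> c * (norm x)\<^sup>2"
  shows "F X - F Y \<le> c * K + l * (e \<bullet> ((X - Y) *v e))"
  using assms unfolding elliptic_bound_def by blast

lemma uniformly_elliptic_imp_elliptic_bound:
  fixes F :: "real ^ 'n ^ 'n \<Rightarrow> real"
  assumes "uniformly_elliptic F"
  obtains l K where "elliptic_bound l K F"
proof -
  obtain l L where l: "0 < l" "l \<le> L" and F: "\<And>M N. symmetric_matrix M \<Longrightarrow> symmetric_matrix N \<Longrightarrow>
      F M - F N \<le> pucci_plus l L (M - N)"
    using assms unfolding uniformly_elliptic_def by blast
  have "elliptic_bound l (real CARD('n) * L) F"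
    unfolding elliptic_bound_def
  proof (intro conjI allI impI)
    fix X Y :: "real ^ 'n ^ 'n" and c :: real and e :: "real ^ 'n"
    assume *: "symmetric_matrix X" "symmetric_matrix Y" "0 \<le> c" "norm e = 1"
      "\<forall>x. x \<bullet> ((X - Y) *v x) \<le> c * (norm x)\<^sup>2"
    have "F X - F Y \<le> pucci_plus l L (X - Y)" using F * by blast
    also have "\<dots> \<le> c * (real CARD('n) * L) + l * (e \<bullet> ((X - Y) *v e))"
      using l * by (intro pucci_plus_le[of l L "X - Y"] symmetric_matrix_arith) auto
    finally show "F X - F Y \<le> c * (real CARD('n) * L) + l * (e \<bullet> ((X - Y) *v e))" .
  qed (use l in auto)
  then show ?thesis using that by blast
qed

text \<open>
  The operator of the equation satisfied by \<open>- u\<close> if \<open>F (D\<^sup>2u) = 0\<close>. Supersolutions become subsolutions of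
  the dual problem, so that each estimate has to be proved for subsolutions only.
\<close>

definition dual_operator :: "(real ^ 'n ^ 'n \<Rightarrow> real) \<Rightarrow> real ^ 'n ^ 'n \<Rightarrow> real" where
  "dual_operator F M = - F (- M)"

lemma dual_operator_involution [simp]: "dual_operator (dual_operator F) = F"
  by (simp add: dual_operator_def fun_eq_iff)

lemma elliptic_bound_dual:
  fixes F :: "real ^ 'n ^ 'n \<Rightarrow> real"
  assumes "elliptic_bound l K F" shows "elliptic_bound l K (dual_operator F)"
  unfolding elliptic_bound_def
proof (intro conjI allI impI)
  fix X Y :: "real ^ 'n ^ 'n" and c :: real and e :: "real ^ 'n"
  assume *: "symmetric_matrix X" "symmetric_matrix Y" "0 \<le> c" "norm e = 1"
      "\<forall>x. x \<bullet> ((X - Y) *v x) \<le> c * (norm x)\<^sup>2"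
  have eq: "- Y - - X = X - Y" by (simp only: minus_diff_minus minus_diff_eq)
  have "F (- Y) - F (- X) \<le> c * K + l * (e \<bullet> ((- Y - - X) *v e))"
    by (rule elliptic_boundD[OF assms]) (use * in \<open>simp_all only: eq symmetric_matrix_arith(3)\<close>)
  then have "F (- Y) - F (- X) \<le> c * K + l * (e \<bullet> ((X - Y) *v e))" unfolding eq .
  then show "dual_operator F X - dual_operator F Y \<le> c * K + l * (e \<bullet> ((X - Y) *v e))"
    by (simp add: dual_operator_def)
qed (use assms in \<open>auto simp: elliptic_bound_def\<close>)

section \<open>Strips and second-order jets\<close>

definition closed_strip :: "real ^ 'n \<Rightarrow> real \<Rightarrow> (real ^ 'n) set" where
  "closed_strip \<nu> r = {x. 0 \<le> x \<bullet> \<nu> \<and> x \<bullet> \<nu> \<le> r}"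

lemma closed_closed_strip: "closed (closed_strip \<nu> r)"
  unfolding closed_strip_def
  by (rule closed_Collect_conj; rule closed_Collect_le; intro continuous_intros)

lemma closure_strip:
  assumes "norm \<nu> = 1" "r > 0"
  shows "closure (strip \<nu> r) = closed_strip \<nu> r"
proof
  show "closure (strip \<nu> r) \<subseteq> closed_strip \<nu> r"
    by (rule closure_minimal[OF _ closed_closed_strip]) (auto simp: strip_def closed_strip_def)
  show "closed_strip \<nu> r \<subseteq> closure (strip \<nu> r)"
  proof
    fix x assume x: "x \<in> closed_strip \<nu> r"
    define y where "y = x + (r / 2 - x \<bullet> \<nu>) *\<^sub>R \<nu>"
    have \<nu>: "\<nu> \<bullet> \<nu> = 1" using assms by (simp add: dot_square_norm)
    have y: "y \<bullet> \<nu> = r / 2" by (simp add: y_def inner_add_left \<nu>)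
    have "(\<lambda>i. x + inverse (real (Suc i)) *\<^sub>R (y - x)) \<longlonglongrightarrow> x + 0 *\<^sub>R (y - x)"
      by (intro tendsto_intros LIMSEQ_inverse_real_of_nat)
    moreover have "x + inverse (real (Suc i)) *\<^sub>R (y - x) \<in> strip \<nu> r" for i
    proof -
      define s where "s = inverse (real (Suc i))"
      have s: "0 < s" "s \<le> 1" by (auto simp: s_def divide_simps)
      have "(x + s *\<^sub>R (y - x)) \<bullet> \<nu> = (1 - s) * (x \<bullet> \<nu>) + s * (r / 2)"
        by (simp add: inner_add_left inner_diff_left y algebra_simps)
      moreover have "0 \<le> (1 - s) * (x \<bullet> \<nu>)" "(1 - s) * (x \<bullet> \<nu>) \<le> (1 - s) * r"
        using s x by (auto simp: closed_strip_def intro!: mult_left_mono)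
      moreover have "0 < s * (r / 2)" "s * (r / 2) < s * r" using s assms by auto
      ultimately have "x + s *\<^sub>R (y - x) \<in> strip \<nu> r"
        unfolding strip_def mem_Collect_eq using left_diff_distrib[of 1 s r] by linarith
      then show ?thesis by (simp only: s_def)
    qed
    ultimately show "x \<in> closure (strip \<nu> r)"
      unfolding closure_sequential by (intro exI[of _ "\<lambda>i. x + inverse (real (Suc i)) *\<^sub>R (y - x)"]) auto
  qed
qed

text \<open>
  The subsolution property tested with quadratic polynomials only. The Dirichlet condition is kept
  apart, so that the notion passes to narrower strips and behaves well under scaling.
\<close>

definition jet_subsolution ::
  "real ^ 'n \<Rightarrow> real \<Rightarrow> (real ^ 'n ^ 'n \<Rightarrow> real) \<Rightarrow> (real ^ 'n \<Rightarrow> real) \<Rightarrow> (real ^ 'n \<Rightarrow> real) \<Rightarrow> bool"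
where
  "jet_subsolution \<nu> r F h w \<longleftrightarrow>
     (\<forall>x p X. symmetric_matrix X \<longrightarrow> 0 \<le> x \<bullet> \<nu> \<longrightarrow> x \<bullet> \<nu> < r \<longrightarrow>
        (\<exists>d>0. \<forall>y\<in>closed_strip \<nu> r. norm (y - x) < d \<longrightarrow>
           w y \<le> w x + p \<bullet> (y - x) + (y - x) \<bullet> (X *v (y - x)) / 2) \<longrightarrow>
        0 \<le> F X \<or> (x \<bullet> \<nu> = 0 \<and> h x \<le> p \<bullet> \<nu>))"

lemma jet_subsolutionD:
  assumes "jet_subsolution \<nu> r F h w" "symmetric_matrix X" "0 \<le> x \<bullet> \<nu>" "x \<bullet> \<nu> < r" "d > 0"
    "\<And>y. y \<in> closed_strip \<nu> r \<Longrightarrow> norm (y - x) < d \<Longrightarrow>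
       w y \<le> w x + p \<bullet> (y - x) + (y - x) \<bullet> (X *v (y - x)) / 2"
    "x \<bullet> \<nu> = 0 \<Longrightarrow> p \<bullet> \<nu> < h x"
  shows "0 \<le> F X"
  using assms(1)[unfolded jet_subsolution_def, rule_format, OF assms(2-4), of p] assms(5-7) by force

lemma C2_on_quadratic:
  assumes "symmetric_matrix X"
  shows "C2_on U (\<lambda>y. p \<bullet> (y - x) + (y - x) \<bullet> (X *v (y - x)) / 2) (\<lambda>y. p + X *v (y - x)) (\<lambda>_. X)"
  unfolding C2_on_def
proof (intro conjI ballI)
  fix y
  have X: "((\<lambda>y. X *v (y - x)) has_derivative (\<lambda>v. X *v v)) (at y)"
    by (rule has_derivative_compose[of "\<lambda>y. y - x" "\<lambda>v. v" _ _ "(*v) X" "(*v) X", unfolded o_def])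
      (auto intro!: derivative_eq_intros bounded_linear_imp_has_derivative matrix_vector_mul_bounded_linear)
  show "((\<lambda>y. p + X *v (y - x)) has_derivative (\<lambda>v. X *v v)) (at y)"
    using has_derivative_add[OF has_derivative_const X, of p] by simp
  have "((\<lambda>y. p \<bullet> (y - x) + (y - x) \<bullet> (X *v (y - x)) / 2) has_derivative
     (\<lambda>v. p \<bullet> v + ((y - x) \<bullet> (X *v v) + v \<bullet> (X *v (y - x))) / 2)) (at y)"
    by (auto intro!: derivative_eq_intros X)
  moreover have "p \<bullet> v + ((y - x) \<bullet> (X *v v) + v \<bullet> (X *v (y - x))) / 2 = (p + X *v (y - x)) \<bullet> v" for v
    using symmetric_matrix_inner[OF assms, of "y - x" v] by (simp add: inner_add_left inner_commute[of v])
  ultimately show "((\<lambda>y. p \<bullet> (y - x) + (y - x) \<bullet> (X *v (y - x)) / 2) has_derivative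
     (\<lambda>v. (p + X *v (y - x)) \<bullet> v)) (at y)" by simp
qed simp

lemma viscosity_subsolution_imp_jet:
  assumes \<nu>: "norm \<nu> = 1" "r > 0" and u: "viscosity_subsolution \<nu> r F h u"
  shows "jet_subsolution \<nu> r F h u"
  unfolding jet_subsolution_def
proof (intro allI impI, elim exE conjE)
  fix x p X d assume X: "symmetric_matrix X" and x: "0 \<le> x \<bullet> \<nu>" "x \<bullet> \<nu> < r" and "d > 0"
    and t: "\<forall>y\<in>closed_strip \<nu> r. norm (y - x) < d \<longrightarrow> u y \<le> u x + p \<bullet> (y - x) + (y - x) \<bullet> (X *v (y - x)) / 2"
  let ?\<phi> = "\<lambda>y. p \<bullet> (y - x) + (y - x) \<bullet> (X *v (y - x)) / 2"
  have "touches_from_above (closure (strip \<nu> r)) u ?\<phi> (ball x d) x"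
    unfolding touches_from_above_def closure_strip[OF \<nu>]
    using t \<open>d > 0\<close> by (auto simp: dist_norm norm_minus_commute)
  from u[unfolded viscosity_subsolution_def, THEN conjunct1, rule_format, OF C2_on_quadratic[OF X] this]
  show "0 \<le> F X \<or> (x \<bullet> \<nu> = 0 \<and> h x \<le> p \<bullet> \<nu>)"
    using x by (auto simp: strip_def hyperplane_def)
qed

lemma viscosity_supersolution_imp_jet:
  assumes \<nu>: "norm \<nu> = 1" "r > 0" and u: "viscosity_supersolution \<nu> r F h u"
  shows "jet_subsolution \<nu> r (dual_operator F) (\<lambda>x. - h x) (\<lambda>x. - u x)"
  unfolding jet_subsolution_def
proof (intro allI impI, elim exE conjE)
  fix x p X d assume X: "symmetric_matrix X" and x: "0 \<le> x \<bullet> \<nu>" "x \<bullet> \<nu> < r" and "d > 0"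
    and t: "\<forall>y\<in>closed_strip \<nu> r. norm (y - x) < d \<longrightarrow> - u y \<le> - u x + p \<bullet> (y - x) + (y - x) \<bullet> (X *v (y - x)) / 2"
  let ?\<phi> = "\<lambda>y. - p \<bullet> (y - x) + (y - x) \<bullet> (- X *v (y - x)) / 2"
  have mX: "symmetric_matrix (- X)" by (rule symmetric_matrix_arith(3)[OF X])
  have "touches_from_below (closure (strip \<nu> r)) u ?\<phi> (ball x d) x"
    unfolding touches_from_below_def closure_strip[OF \<nu>]
    using t \<open>d > 0\<close> by (auto simp: dist_norm norm_minus_commute matrix_mult_arith)
  from u[unfolded viscosity_supersolution_def, THEN conjunct1, rule_format, OF C2_on_quadratic[OF mX] this]
  show "0 \<le> dual_operator F X \<or> (x \<bullet> \<nu> = 0 \<and> - h x \<le> p \<bullet> \<nu>)"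
    using x by (auto simp: strip_def hyperplane_def dual_operator_def)
qed

text \<open>
  Scaling divides the Hessian by \<open>s\<close> and preserves the slope; positive homogeneity absorbs the factor.
\<close>

lemma jet_subsolution_scale:
  assumes w: "jet_subsolution \<nu> r F h w" and F: "positively_homogeneous F" and s: "s > 0"
  shows "jet_subsolution \<nu> (r / s) F (\<lambda>x. h (s *\<^sub>R x)) (\<lambda>x. w (s *\<^sub>R x) / s)"
  unfolding jet_subsolution_def
proof (intro allI impI, elim exE conjE)
  fix x p X d assume X: "symmetric_matrix X" and x: "0 \<le> x \<bullet> \<nu>" "x \<bullet> \<nu> < r / s" and "d > 0"
    and t: "\<forall>y\<in>closed_strip \<nu> (r / s). norm (y - x) < d \<longrightarrow>
       w (s *\<^sub>R y) / s \<le> w (s *\<^sub>R x) / s + p \<bullet> (y - x) + (y - x) \<bullet> (X *v (y - x)) / 2"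
  have X': "symmetric_matrix ((1 / s) *\<^sub>R X)" by (rule symmetric_matrix_arith(4)[OF X])
  have "w y \<le> w (s *\<^sub>R x) + p \<bullet> (y - s *\<^sub>R x) + (y - s *\<^sub>R x) \<bullet> (((1 / s) *\<^sub>R X) *v (y - s *\<^sub>R x)) / 2"
    if y: "y \<in> closed_strip \<nu> r" "norm (y - s *\<^sub>R x) < s * d" for y
  proof -
    define z where "z = y /\<^sub>R s"
    have yz: "y = s *\<^sub>R z" using s by (simp add: z_def)
    have "z \<in> closed_strip \<nu> (r / s)" using y s by (auto simp: z_def closed_strip_def field_simps)
    moreover have "norm (z - x) < d" using y(2) s by (simp add: yz flip: scaleR_diff_right)
    ultimately have "w (s *\<^sub>R z) / s \<le> w (s *\<^sub>R x) / s + p \<bullet> (z - x) + (z - x) \<bullet> (X *v (z - x)) / 2"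
      using t by blast
    then have "s * (w (s *\<^sub>R z) / s) \<le> s * (w (s *\<^sub>R x) / s + p \<bullet> (z - x) + (z - x) \<bullet> (X *v (z - x)) / 2)"
      using s by (intro mult_left_mono) auto
    then show ?thesis
      using s by (simp add: yz matrix_mult_arith matrix_vector_mult_scaleR distrib_left flip: scaleR_diff_right)
  qed
  then have "0 \<le> F ((1 / s) *\<^sub>R X) \<or> ((s *\<^sub>R x) \<bullet> \<nu> = 0 \<and> h (s *\<^sub>R x) \<le> p \<bullet> \<nu>)"
    using w[unfolded jet_subsolution_def, rule_format, OF X', of "s *\<^sub>R x" p] x s \<open>d > 0\<close>
    by (force simp: field_simps intro: exI[of _ "s * d"])
  moreover have "F ((1 / s) *\<^sub>R X) = (1 / s) * F X"
    using F X s by (simp add: positively_homogeneous_def)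
  ultimately show "0 \<le> F X \<or> (x \<bullet> \<nu> = 0 \<and> h (s *\<^sub>R x) \<le> p \<bullet> \<nu>)"
    using s by (auto simp: zero_le_divide_iff)
qed

text \<open>
  Below the height \<open>r'\<close> the two closed strips coincide locally.
\<close>

lemma jet_subsolution_mono_strip:
  assumes w: "jet_subsolution \<nu> r F h w" and r: "r' \<le> r"
  shows "jet_subsolution \<nu> r' F h w"
  unfolding jet_subsolution_def
proof (intro allI impI, elim exE conjE)
  fix x p X d assume X: "symmetric_matrix X" and x: "0 \<le> x \<bullet> \<nu>" "x \<bullet> \<nu> < r'" and "d > 0"
    and t: "\<forall>y\<in>closed_strip \<nu> r'. norm (y - x) < d \<longrightarrow>
       w y \<le> w x + p \<bullet> (y - x) + (y - x) \<bullet> (X *v (y - x)) / 2"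
  define d' where "d' = min d ((r' - x \<bullet> \<nu>) / (norm \<nu> + 1))"
  have n: "norm \<nu> + 1 > 0" by (smt (verit) norm_ge_zero)
  have d': "d' > 0" using \<open>d > 0\<close> x n by (simp add: d'_def)
  have "w y \<le> w x + p \<bullet> (y - x) + (y - x) \<bullet> (X *v (y - x)) / 2"
    if y: "y \<in> closed_strip \<nu> r" "norm (y - x) < d'" for y
  proof -
    have "(y - x) \<bullet> \<nu> \<le> norm (y - x) * norm \<nu>" by (rule norm_cauchy_schwarz)
    also have "\<dots> \<le> ((r' - x \<bullet> \<nu>) / (norm \<nu> + 1)) * (norm \<nu> + 1)"
      using y(2) x n by (intro mult_mono) (auto simp: d'_def)
    also have "\<dots> = r' - x \<bullet> \<nu>" using n by simp
    finally have "y \<in> closed_strip \<nu> r'" using y(1) by (simp add: closed_strip_def inner_diff_left)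
    then show ?thesis using t y(2) by (simp add: d'_def)
  qed
  then show "0 \<le> F X \<or> (x \<bullet> \<nu> = 0 \<and> h x \<le> p \<bullet> \<nu>)"
    using w[unfolded jet_subsolution_def, rule_format, OF X x(1), of p] x r d' by auto
qed

lemma jet_subsolution_translate:
  assumes w: "jet_subsolution \<nu> r F h w" and z: "z \<bullet> \<nu> = 0"
  shows "jet_subsolution \<nu> r F (\<lambda>x. h (x + z)) (\<lambda>x. w (x + z))"
  unfolding jet_subsolution_def
proof (intro allI impI, elim exE conjE)
  fix x p X d assume X: "symmetric_matrix X" and x: "0 \<le> x \<bullet> \<nu>" "x \<bullet> \<nu> < r" and "d > 0"
    and t: "\<forall>y\<in>closed_strip \<nu> r. norm (y - x) < d \<longrightarrow>
       w (y + z) \<le> w (x + z) + p \<bullet> (y - x) + (y - x) \<bullet> (X *v (y - x)) / 2"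
  have "w y \<le> w (x + z) + p \<bullet> (y - (x + z)) + (y - (x + z)) \<bullet> (X *v (y - (x + z))) / 2"
    if "y \<in> closed_strip \<nu> r" "norm (y - (x + z)) < d" for y
    using t[rule_format, of "y - z"] that z by (simp add: closed_strip_def inner_diff_left algebra_simps)
  then show "0 \<le> F X \<or> (x \<bullet> \<nu> = 0 \<and> h (x + z) \<le> p \<bullet> \<nu>)"
    using w[unfolded jet_subsolution_def, rule_format, OF X, of "x + z" p] x z \<open>d > 0\<close>
    by (auto simp: inner_add_left)
qed

section \<open>Comparison with linear functions\<close>

text \<open>
  On unbounded sets the supremum need not be attained. Subtraction of \<open>\<kappa> |x - x1|\<^sup>2\<close>, centred at an almost
  maximal point \<open>x1\<close>, creates a maximum at distance less than 1 from \<open>x1\<close>, and it perturbs the derivatives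
  only by terms of order \<open>\<kappa>\<close>.
\<close>

lemma near_maximum_point:
  fixes \<Psi> :: "'a::euclidean_space \<Rightarrow> real"
  assumes S: "closed S" "S \<noteq> {}" and cont: "continuous_on S \<Psi>" and bdd: "bdd_above (\<Psi> ` S)" and \<kappa>: "\<kappa> > 0"
  obtains x1 x2 where "x1 \<in> S" "x2 \<in> S" "norm (x2 - x1) < 1" "Sup (\<Psi> ` S) - \<kappa> < \<Psi> x2"
    "\<And>x. x \<in> S \<Longrightarrow> norm (x - x1) \<le> 1 \<Longrightarrow> \<Psi> x - \<kappa> * (norm (x - x1))\<^sup>2 \<le> \<Psi> x2 - \<kappa> * (norm (x2 - x1))\<^sup>2"
proof -
  obtain x1 where x1: "x1 \<in> S" "Sup (\<Psi> ` S) - \<kappa> < \<Psi> x1"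
    using less_cSUP_iff[OF S(2) bdd, of "Sup (\<Psi> ` S) - \<kappa>"] \<kappa> by auto
  define C where "C = S \<inter> cball x1 1"
  have "compact C" unfolding C_def by (rule closed_Int_compact[OF S(1) compact_cball])
  moreover have x1C: "x1 \<in> C" using x1 by (simp add: C_def)
  moreover have "continuous_on C (\<lambda>x. \<Psi> x - \<kappa> * (norm (x - x1))\<^sup>2)"
    unfolding C_def by (intro continuous_intros continuous_on_subset[OF cont]) auto
  ultimately have "\<exists>x\<in>C. \<forall>y\<in>C. \<Psi> y - \<kappa> * (norm (y - x1))\<^sup>2 \<le> \<Psi> x - \<kappa> * (norm (x - x1))\<^sup>2"
    by (intro continuous_attains_sup) auto
  then obtain x where x: "x \<in> C" "\<And>y. y \<in> C \<Longrightarrow> \<Psi> y - \<kappa> * (norm (y - x1))\<^sup>2 \<le> \<Psi> x - \<kappa> * (norm (x - x1))\<^sup>2"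
    by blast
  have xS: "x \<in> S" using x by (simp add: C_def)
  have "0 \<le> \<kappa> * (norm (x - x1))\<^sup>2" using \<kappa> by simp
  with x(2)[OF x1C] x1(2) have xm: "Sup (\<Psi> ` S) - \<kappa> < \<Psi> x - \<kappa> * (norm (x - x1))\<^sup>2" "Sup (\<Psi> ` S) - \<kappa> < \<Psi> x" by simp_all
  have "\<Psi> x \<le> Sup (\<Psi> ` S)" by (rule cSUP_upper[OF xS bdd])
  with xm(1) have "\<kappa> * (norm (x - x1))\<^sup>2 < \<kappa> * 1" by linarith
  then have "norm (x - x1) < 1" using \<kappa> by (simp add: power_less_one_iff abs_square_less_1)
  then show ?thesis
    using that[OF x1(1) xS _ xm(2)] x(2) by (auto simp: C_def dist_norm norm_minus_commute)
qed

text \<open>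
  If \<open>w\<close> exceeded the linear function, then the difference plus \<open>\<mu> (x \<bullet> \<nu>)\<^sup>2\<close> would have an almost maximum
  below the upper boundary. There \<open>w\<close> is touched by a quadratic with Hessian \<open>2\<kappa> Id - 2\<mu> \<nu> \<nu>\<^sup>T\<close>, at which
  \<open>F\<close> is negative for small \<open>\<kappa>\<close>, and whose slope on the lower boundary is at most \<open>\<beta>\<close>. On the lower
  boundary it suffices to control either the values or the Neumann data.
\<close>

lemma linear_barrier:
  assumes F: "elliptic_bound l K F" "F 0 = 0" and \<nu>: "norm \<nu> = 1" "r > 0"
    and w: "continuous_on (closed_strip \<nu> r) w" "\<And>x. x \<in> closed_strip \<nu> r \<Longrightarrow> w x \<le> M"
    and sub: "jet_subsolution \<nu> r F h w"
    and top: "\<And>x. x \<bullet> \<nu> = r \<Longrightarrow> w x \<le> \<alpha> + \<beta> * r"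
    and bottom: "\<And>x. x \<bullet> \<nu> = 0 \<Longrightarrow> w x \<le> \<alpha> \<or> \<beta> < h x"
    and x0: "x0 \<in> closed_strip \<nu> r"
  shows "w x0 \<le> \<alpha> + \<beta> * (x0 \<bullet> \<nu>)"
proof (rule ccontr)
  assume neg: "\<not> ?thesis"
  \<comment> \<open>Of the excess \<open>2\<omega>\<close> the term \<open>\<mu> (x \<bullet> \<nu>)\<^sup>2\<close> uses up at most \<open>\<omega>\<close>, so it cannot produce an almost
    maximum at the top.\<close>
  define \<omega> where "\<omega> = (w x0 - (\<alpha> + \<beta> * (x0 \<bullet> \<nu>))) / 2"
  have \<omega>: "\<omega> > 0" using neg by (simp add: \<omega>_def)
  define \<mu> where "\<mu> = \<omega> / r\<^sup>2"
  have \<mu>: "\<mu> > 0" "\<mu> * r\<^sup>2 = \<omega>" using \<omega> \<nu>(2) by (auto simp: \<mu>_def)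
  define \<Psi> where "\<Psi> x = w x - (\<alpha> + \<beta> * (x \<bullet> \<nu>)) + \<mu> * (x \<bullet> \<nu>)\<^sup>2" for x
  have l: "l > 0" "K > 0" using F(1) by (auto simp: elliptic_bound_def)
  define \<kappa> where "\<kappa> = min (\<omega> / 2) (l * \<mu> / (2 * (K + l)))"
  have \<kappa>: "\<kappa> > 0" "\<kappa> < \<omega>" "2 * \<kappa> * (K + l) < 2 * (l * \<mu>)"
  proof -
    show "\<kappa> > 0" "\<kappa> < \<omega>" using \<omega> l \<mu> by (auto simp: \<kappa>_def)
    have "2 * \<kappa> * (K + l) \<le> 2 * (l * \<mu> / (2 * (K + l))) * (K + l)"
      using l by (intro mult_right_mono mult_left_mono) (auto simp: \<kappa>_def)
    also have "\<dots> = l * \<mu>" using l by (simp add: field_simps)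
    finally show "2 * \<kappa> * (K + l) < 2 * (l * \<mu>)" using l \<mu> mult_pos_pos[of l \<mu>] by linarith
  qed
  have bdd: "bdd_above (\<Psi> ` closed_strip \<nu> r)"
  proof (rule bdd_aboveI2)
    fix x assume x: "x \<in> closed_strip \<nu> r"
    then have t: "0 \<le> x \<bullet> \<nu>" "x \<bullet> \<nu> \<le> r" by (auto simp: closed_strip_def)
    have "\<bar>\<beta> * (x \<bullet> \<nu>)\<bar> \<le> \<bar>\<beta>\<bar> * r" using t by (auto simp: abs_mult intro!: mult_left_mono)
    moreover have "\<mu> * (x \<bullet> \<nu>)\<^sup>2 \<le> \<mu> * r\<^sup>2" using t \<mu> by (intro mult_left_mono power_mono) auto
    ultimately show "\<Psi> x \<le> M + \<bar>\<alpha>\<bar> + \<bar>\<beta>\<bar> * r + \<mu> * r\<^sup>2" using w(2)[OF x] unfolding \<Psi>_def by linarith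
  qed
  have cont: "continuous_on (closed_strip \<nu> r) \<Psi>" unfolding \<Psi>_def by (intro continuous_intros w(1))
  obtain x1 x where x1: "x1 \<in> closed_strip \<nu> r" and xs: "x \<in> closed_strip \<nu> r"
    and "norm (x - x1) < 1" and xm: "Sup (\<Psi> ` closed_strip \<nu> r) - \<kappa> < \<Psi> x"
    and x: "\<And>y. y \<in> closed_strip \<nu> r \<Longrightarrow> norm (y - x1) \<le> 1 \<Longrightarrow>
      \<Psi> y - \<kappa> * (norm (y - x1))\<^sup>2 \<le> \<Psi> x - \<kappa> * (norm (x - x1))\<^sup>2"
    by (rule near_maximum_point[OF closed_closed_strip _ cont bdd \<kappa>(1)], use x0 in blast, rule that, assumption+)
  have "2 * \<omega> \<le> \<Psi> x0" using \<mu> by (simp add: \<Psi>_def \<omega>_def)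
  also have "\<Psi> x0 \<le> Sup (\<Psi> ` closed_strip \<nu> r)" by (rule cSUP_upper[OF x0 bdd])
  finally have big: "\<Psi> x > \<omega>" using xm \<kappa>(2) by linarith
  have tr: "x \<bullet> \<nu> \<noteq> r"
  proof
    assume "x \<bullet> \<nu> = r"
    then have "\<Psi> x \<le> \<omega>" using top[of x] \<mu>(2) by (simp add: \<Psi>_def)
    with big show False by simp
  qed
  define X where "X = (2 * \<kappa>) *\<^sub>R mat 1 - (2 * \<mu>) *\<^sub>R outer \<nu>"
  define p where "p = (\<beta> - 2 * \<mu> * (x \<bullet> \<nu>)) *\<^sub>R \<nu> + (2 * \<kappa>) *\<^sub>R (x - x1)"
  have X: "symmetric_matrix X" unfolding X_def by (intro symmetric_matrix_arith)
  have quad: "v \<bullet> (X *v v) = 2 * \<kappa> * (norm v)\<^sup>2 - 2 * \<mu> * (v \<bullet> \<nu>)\<^sup>2" for v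
    by (simp add: X_def matrix_mult_arith outer_mult inner_diff_right inner_commute dot_square_norm power2_eq_square)
  have "0 \<le> F X"
  proof (rule jet_subsolutionD[OF sub X, where x = x and p = p and d = "1 - norm (x - x1)"])
    show "0 \<le> x \<bullet> \<nu>" "x \<bullet> \<nu> < r" using xs tr by (auto simp: closed_strip_def)
    show "0 < 1 - norm (x - x1)" using \<open>norm (x - x1) < 1\<close> by simp
    fix y assume y: "y \<in> closed_strip \<nu> r" "norm (y - x) < 1 - norm (x - x1)"
    have "norm (y - x1) \<le> 1" using y(2) norm_triangle_ineq[of "y - x" "x - x1"] by simp
    from x[OF y(1) this]
    have "w y \<le> w x + \<beta> * ((y - x) \<bullet> \<nu>) - \<mu> * ((y \<bullet> \<nu>)\<^sup>2 - (x \<bullet> \<nu>)\<^sup>2) + \<kappa> * ((norm (y - x1))\<^sup>2 - (norm (x - x1))\<^sup>2)"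
      by (simp add: \<Psi>_def inner_diff_left algebra_simps)
    also have "(norm (y - x1))\<^sup>2 - (norm (x - x1))\<^sup>2 = (norm (y - x))\<^sup>2 + 2 * ((x - x1) \<bullet> (y - x))"
      by (simp add: power2_norm_eq_inner inner_diff inner_commute)
    also have "(y \<bullet> \<nu>)\<^sup>2 - (x \<bullet> \<nu>)\<^sup>2 = ((y - x) \<bullet> \<nu>)\<^sup>2 + 2 * (x \<bullet> \<nu>) * ((y - x) \<bullet> \<nu>)"
      by (simp add: inner_diff_left power2_eq_square algebra_simps)
    finally show "w y \<le> w x + p \<bullet> (y - x) + (y - x) \<bullet> (X *v (y - x)) / 2"
    proof -
      have p: "p \<bullet> (y - x) = (\<beta> - 2 * \<mu> * (x \<bullet> \<nu>)) * ((y - x) \<bullet> \<nu>) + 2 * \<kappa> * ((x - x1) \<bullet> (y - x))"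
        by (simp add: p_def inner_add_left inner_commute[of \<nu>])
      assume "w y \<le> w x + \<beta> * ((y - x) \<bullet> \<nu>) - \<mu> * (((y - x) \<bullet> \<nu>)\<^sup>2 + 2 * (x \<bullet> \<nu>) * ((y - x) \<bullet> \<nu>))
         + \<kappa> * ((norm (y - x))\<^sup>2 + 2 * ((x - x1) \<bullet> (y - x)))"
      then show ?thesis
        unfolding quad p left_diff_distrib distrib_left by (simp add: mult_ac diff_divide_distrib)
    qed
  next
    assume b: "x \<bullet> \<nu> = 0"
    have "\<not> w x \<le> \<alpha>" using big \<omega> b by (simp add: \<Psi>_def)
    then have "\<beta> < h x" using bottom[OF b] by blast
    moreover have "p \<bullet> \<nu> \<le> \<beta>"
      using b \<nu> x1 \<kappa>(1) by (simp add: p_def inner_add_left inner_diff_left dot_square_norm closed_strip_def)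
    ultimately show "p \<bullet> \<nu> < h x" by simp
  qed
  moreover have "F X - F 0 \<le> (2 * \<kappa>) * K + l * (\<nu> \<bullet> ((X - 0) *v \<nu>))"
  proof (rule elliptic_boundD[OF F(1) X _ _ \<nu>(1)])
    show "x \<bullet> ((X - 0) *v x) \<le> 2 * \<kappa> * (norm x)\<^sup>2" for x
      using \<mu>(1) by (simp add: quad)
  qed (use \<kappa>(1) in \<open>simp_all add: symmetric_matrix_arith\<close>)
  moreover have "(2 * \<kappa>) * K + l * (\<nu> \<bullet> ((X - 0) *v \<nu>)) < 0"
  proof -
    have e: "\<nu> \<bullet> ((X - 0) *v \<nu>) = 2 * \<kappa> - 2 * \<mu>" using \<nu>(1) by (simp add: quad dot_square_norm)
    have "(2 * \<kappa>) * K + l * (\<nu> \<bullet> ((X - 0) *v \<nu>)) = 2 * \<kappa> * (K + l) - 2 * (l * \<mu>)"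
      unfolding e by (simp add: algebra_simps)
    with \<kappa>(3) show ?thesis by linarith
  qed
  ultimately show False using F(2) by linarith
qed

section \<open>The maximum principle in doubled variables\<close>

text \<open>
  The second-order terms provided by \<open>sums_second_order\<close> are linear maps of which only the quadratic
  forms are of interest; a symmetric matrix with the same quadratic form is needed for the operator.
\<close>

definition symmetric_part :: "(real ^ 'n \<Rightarrow> real ^ 'n) \<Rightarrow> real ^ 'n ^ 'n" where
  "symmetric_part T = (1 / 2) *\<^sub>R (matrix T + transpose (matrix T))"

lemma symmetric_part_symmetric: "symmetric_matrix (symmetric_part T)"
  by (rule symmetric_matrixI) (simp add: symmetric_part_def transpose_def)

lemma symmetric_part_quadform:
  assumes "linear T" shows "v \<bullet> (symmetric_part T *v v) = v \<bullet> T v"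
proof -
  have "v \<bullet> (transpose (matrix T) *v v) = v \<bullet> (matrix T *v v)"
    by (metis dot_lmul_matrix inner_commute vector_transpose_matrix transpose_transpose)
  then show ?thesis
    using fun_cong[OF matrix_vector_mul(2)[OF assms], of v]
    by (simp add: symmetric_part_def matrix_mult_arith inner_add_right)
qed

definition localized_domain :: "real ^ 'n \<Rightarrow> real \<Rightarrow> real ^ 'n \<Rightarrow> real \<Rightarrow> (real ^ 'n) set" where
  "localized_domain \<nu> r x \<rho> = {h. x + h \<in> closed_strip \<nu> r \<and> norm h \<le> \<rho>}"

text \<open>
  The function \<open>w\<close> near \<open>x\<close>, stripped of the terms of the test function that belong to \<open>w\<close> alone; what
  remains of the test function is the coupling. The last term makes the maximum strict.
\<close>

definition recentred :: "(real ^ 'n \<Rightarrow> real) \<Rightarrow> real ^ 'n \<Rightarrow> real ^ 'n \<Rightarrow> real ^ 'n ^ 'n \<Rightarrow> real \<Rightarrow> real ^ 'n \<Rightarrow> real" where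
  "recentred w x p E \<tau> h = w (x + h) - p \<bullet> h - h \<bullet> (E *v h) / 2 - \<tau> * (norm h)\<^sup>2"

lemma compact_localized_domain: "compact (localized_domain \<nu> r x \<rho>)"
proof -
  have "localized_domain \<nu> r x \<rho> = (\<lambda>h. x + h) -` closed_strip \<nu> r \<inter> cball 0 \<rho>"
    by (auto simp: localized_domain_def)
  moreover have "closed ((\<lambda>h. x + h) -` closed_strip \<nu> r)"
    by (intro continuous_closed_vimage closed_closed_strip continuous_intros)
  ultimately show ?thesis by (metis closed_Int_compact compact_cball)
qed

lemma continuous_on_recentred:
  assumes "continuous_on (closed_strip \<nu> r) w"
  shows "continuous_on (localized_domain \<nu> r x \<rho>) (recentred w x p E \<tau>)"
  unfolding recentred_def
  by (intro continuous_intros continuous_on_compose2[OF assms] matrix_vector_mult_linear_continuous_on[THEN continuous_on_subset])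
     (auto simp: localized_domain_def)

lemma quadform_add:
  assumes "symmetric_matrix E"
  shows "(h + k) \<bullet> (E *v (h + k)) = h \<bullet> (E *v h) + 2 * ((E *v h) \<bullet> k) + k \<bullet> (E *v k)"
  using symmetric_matrix_inner[OF assms, of h k]
  by (simp add: matrix_vector_right_distrib inner_add_left inner_add_right inner_commute)

text \<open>
  A quadratic touching the recentred function at a point near the origin gives one touching \<open>w\<close> near \<open>x\<close>.
  Its slope there is close to \<open>p\<close>, so that the strict inequality assumed at \<open>x\<close> persists and rules out the
  Neumann alternative.
\<close>

lemma jet_subsolution_contact:
  fixes \<nu> :: "real ^ 'n"
  assumes sub: "jet_subsolution \<nu> r F h w" and \<nu>: "norm \<nu> = 1"
    and x: "x \<in> closed_strip \<nu> r" "x \<bullet> \<nu> < r" and h: "continuous_on (hyperplane \<nu> 0) h"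
    and bd: "x \<bullet> \<nu> = 0 \<Longrightarrow> p \<bullet> \<nu> < h x" and E: "symmetric_matrix E" and \<tau>: "\<tau> \<ge> 0" and \<rho>: "\<rho> > 0"
  obtains \<sigma>0 where "\<sigma>0 > 0"
    "\<And>a q X \<sigma>. a \<in> localized_domain \<nu> r x \<rho> \<Longrightarrow> norm a < \<sigma>0 \<Longrightarrow> norm q < \<sigma>0 \<Longrightarrow> linear X \<Longrightarrow>
       \<exists>d>0. \<forall>b\<in>localized_domain \<nu> r x \<rho>. norm (b - a) < d \<longrightarrow>
         recentred w x p E \<tau> b \<le> recentred w x p E \<tau> a + q \<bullet> (b - a) + (b - a) \<bullet> X (b - a) / 2 + \<sigma> * (norm (b - a))\<^sup>2 \<Longrightarrow>
       0 \<le> F (symmetric_part X + E + (2 * \<tau> + 2 * \<sigma>) *\<^sub>R mat 1)"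
proof -
  define k where "k = onorm ((*v) E) + 2 * \<tau> + 1"
  have E_le: "norm (E *v a) \<le> onorm ((*v) E) * norm a" for a
    by (rule onorm) (rule matrix_vector_mul_bounded_linear)
  have k: "k \<ge> 1" using onorm_pos_le[OF matrix_vector_mul_bounded_linear, of E] \<tau> by (simp add: k_def)
  have "\<exists>\<sigma>1>0. \<forall>(a :: real ^ 'n) q. norm a < \<sigma>1 \<longrightarrow> norm q < \<sigma>1 \<longrightarrow> (x + a) \<bullet> \<nu> = 0 \<longrightarrow>
      (p + q + E *v a + (2 * \<tau>) *\<^sub>R a) \<bullet> \<nu> < h (x + a)"
  proof (cases "x \<bullet> \<nu> = 0")
    case True
    \<comment> \<open>Half of the gap between \<open>p \<bullet> \<nu>\<close> and \<open>h x\<close> is reserved for the variation of \<open>h\<close>, half for that of the slope.\<close>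
    define m where "m = (h x - p \<bullet> \<nu>) / 2"
    have m: "m > 0" using bd[OF True] by (simp add: m_def)
    have "x \<in> hyperplane \<nu> 0" using True by (simp add: hyperplane_def)
    with h m obtain d where d: "d > 0" "\<And>y. y \<in> hyperplane \<nu> 0 \<Longrightarrow> dist y x < d \<Longrightarrow> dist (h y) (h x) < m"
      unfolding continuous_on_iff by blast
    show ?thesis
    proof (intro exI[of _ "min d (m / (k + 1))"] conjI allI impI)
      show "0 < min d (m / (k + 1))" using d m k by simp
      fix a q :: "real ^ 'n" assume a: "norm a < min d (m / (k + 1))" and q: "norm q < min d (m / (k + 1))" and z: "(x + a) \<bullet> \<nu> = 0"
      have "\<bar>h (x + a) - h x\<bar> < m"
        using d(2)[of "x + a"] a z by (simp add: hyperplane_def dist_norm)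
      then have "h x - m < h (x + a)" by linarith
      moreover have "(q + E *v a + (2 * \<tau>) *\<^sub>R a) \<bullet> \<nu> < m"
      proof -
        have "(q + E *v a + (2 * \<tau>) *\<^sub>R a) \<bullet> \<nu> \<le> norm (q + E *v a + (2 * \<tau>) *\<^sub>R a)"
          using norm_cauchy_schwarz[of "q + E *v a + (2 * \<tau>) *\<^sub>R a" \<nu>] \<nu> by simp
        also have "\<dots> \<le> norm q + norm (E *v a) + norm ((2 * \<tau>) *\<^sub>R a)"
          using norm_triangle_ineq[of "q + E *v a" "(2 * \<tau>) *\<^sub>R a"] norm_triangle_ineq[of q "E *v a"] by linarith
        also have "\<dots> \<le> norm q + onorm ((*v) E) * norm a + 2 * \<tau> * norm a"
          using E_le[of a] \<tau> by simp
        also have "\<dots> \<le> norm q + k * norm a" by (simp add: k_def algebra_simps)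
        also have "\<dots> < m / (k + 1) + k * (m / (k + 1))"
          using a q k by (intro add_less_le_mono mult_left_mono) auto
        also have "\<dots> = (k + 1) * (m / (k + 1))" by (simp only: distrib_right mult_1_left add.commute)
        also have "\<dots> = m" using k by simp
        finally show ?thesis .
      qed
      moreover have "(p + q + E *v a + (2 * \<tau>) *\<^sub>R a) \<bullet> \<nu> = p \<bullet> \<nu> + (q + E *v a + (2 * \<tau>) *\<^sub>R a) \<bullet> \<nu>"
        by (simp add: inner_add_left)
      moreover have "p \<bullet> \<nu> + m = h x - m" by (simp add: m_def field_simps)
      ultimately show "(p + q + E *v a + (2 * \<tau>) *\<^sub>R a) \<bullet> \<nu> < h (x + a)" by linarith
    qed
  next
    case False
    then have t: "x \<bullet> \<nu> > 0" using x by (simp add: closed_strip_def)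
    show ?thesis
    proof (intro exI[of _ "x \<bullet> \<nu>"] conjI t allI impI)
      fix a q :: "real ^ 'n" assume a: "norm a < x \<bullet> \<nu>" "(x + a) \<bullet> \<nu> = 0"
      have "- (a \<bullet> \<nu>) \<le> norm a" using Cauchy_Schwarz_ineq2[of a \<nu>] \<nu> by simp
      with a show "(p + q + E *v a + (2 * \<tau>) *\<^sub>R a) \<bullet> \<nu> < h (x + a)" by (simp add: inner_add_left)
    qed
  qed
  then obtain \<sigma>1 where \<sigma>1: "\<sigma>1 > 0" "\<And>a q. norm a < \<sigma>1 \<Longrightarrow> norm q < \<sigma>1 \<Longrightarrow> (x + a) \<bullet> \<nu> = 0 \<Longrightarrow>
      (p + q + E *v a + (2 * \<tau>) *\<^sub>R a) \<bullet> \<nu> < h (x + a)" by blast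
  define \<sigma>0 where "\<sigma>0 = min \<sigma>1 (min (r - x \<bullet> \<nu>) (\<rho> / 2))"
  show ?thesis
  proof (rule that[of \<sigma>0])
    show "\<sigma>0 > 0" using \<sigma>1 x \<rho> by (simp add: \<sigma>0_def)
    fix a q X \<sigma>
    assume a: "a \<in> localized_domain \<nu> r x \<rho>" "norm a < \<sigma>0" and q: "norm q < \<sigma>0" and X: "linear X"
      and "\<exists>d>0. \<forall>b\<in>localized_domain \<nu> r x \<rho>. norm (b - a) < d \<longrightarrow>
         recentred w x p E \<tau> b \<le> recentred w x p E \<tau> a + q \<bullet> (b - a) + (b - a) \<bullet> X (b - a) / 2 + \<sigma> * (norm (b - a))\<^sup>2"
    then obtain d where d: "d > 0" "\<And>b. b \<in> localized_domain \<nu> r x \<rho> \<Longrightarrow> norm (b - a) < d \<Longrightarrow>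
         recentred w x p E \<tau> b \<le> recentred w x p E \<tau> a + q \<bullet> (b - a) + (b - a) \<bullet> X (b - a) / 2 + \<sigma> * (norm (b - a))\<^sup>2"
      by blast
    let ?X = "symmetric_part X + E + (2 * \<tau> + 2 * \<sigma>) *\<^sub>R mat 1"
    let ?p = "p + q + E *v a + (2 * \<tau>) *\<^sub>R a"
    show "0 \<le> F ?X"
    proof (rule jet_subsolutionD[OF sub, where x = "x + a" and p = ?p and d = "min d (\<rho> / 2)"])
      show "symmetric_matrix ?X" by (intro symmetric_matrix_arith symmetric_part_symmetric E)
      show "0 \<le> (x + a) \<bullet> \<nu>" using a(1) by (simp add: localized_domain_def closed_strip_def)
      have "a \<bullet> \<nu> \<le> norm a" using norm_cauchy_schwarz[of a \<nu>] \<nu> by simp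
      then show "(x + a) \<bullet> \<nu> < r" using a(2) by (simp add: inner_add_left \<sigma>0_def)
      show "min d (\<rho> / 2) > 0" using d \<rho> by simp
      show "?p \<bullet> \<nu> < h (x + a)" if "(x + a) \<bullet> \<nu> = 0"
        using \<sigma>1(2)[OF _ _ that] a(2) q by (simp add: \<sigma>0_def)
      fix y assume y: "y \<in> closed_strip \<nu> r" "norm (y - (x + a)) < min d (\<rho> / 2)"
      define v where "v = y - (x + a)"
      have yv: "y = x + (a + v)" by (simp add: v_def)
      have "norm (a + v) \<le> \<rho>" using norm_triangle_ineq[of a v] y(2) a(2) by (simp add: v_def[symmetric] \<sigma>0_def)
      then have "a + v \<in> localized_domain \<nu> r x \<rho>" using y(1) by (simp add: localized_domain_def yv)
      from d(2)[OF this] y(2) have "recentred w x p E \<tau> (a + v) \<le> recentred w x p E \<tau> a + q \<bullet> v + v \<bullet> X v / 2 + \<sigma> * (norm v)\<^sup>2"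
        by (simp add: v_def[symmetric])
      moreover have "recentred w x p E \<tau> (a + v) = w y - p \<bullet> a - p \<bullet> v
         - (a \<bullet> (E *v a) + 2 * ((E *v a) \<bullet> v) + v \<bullet> (E *v v)) / 2 - \<tau> * ((norm a)\<^sup>2 + 2 * (a \<bullet> v) + (norm v)\<^sup>2)"
        unfolding recentred_def quadform_add[OF E] yv
        by (simp add: inner_add_left inner_add_right power2_norm_eq_inner inner_commute)
      ultimately have "w y \<le> w (x + a) + (p \<bullet> v + q \<bullet> v + (E *v a) \<bullet> v + 2 * \<tau> * (a \<bullet> v))
         + (v \<bullet> X v + v \<bullet> (E *v v) + (2 * \<tau> + 2 * \<sigma>) * (norm v)\<^sup>2) / 2"
        by (simp add: recentred_def field_simps)
      also have "\<dots> = w (x + a) + ?p \<bullet> v + v \<bullet> (?X *v v) / 2"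
        by (simp add: inner_add_left inner_add_right matrix_mult_arith symmetric_part_quadform[OF X] power2_norm_eq_inner)
      finally show "w y \<le> w (x + a) + ?p \<bullet> (y - (x + a)) + (y - (x + a)) \<bullet> (?X *v (y - (x + a))) / 2"
        by (simp add: v_def)
    qed
  qed
qed

text \<open>
  The maximum principle for the sum of two subsolutions in independent variables, which serves both the
  comparison principle and the estimate of the oscillation. The test function consists of the slopes
  \<open>p1\<close>, \<open>p2\<close>, of quadratic forms \<open>E1\<close>, \<open>E2\<close> in each variable and of the coupling \<open>B\<close>. If its slopes violate
  the Neumann inequalities strictly, then both equations hold with Hessians subject to the matrix
  inequality; this is the theorem on sums for the recentred functions.
\<close>

theorem doubling_maximum_principle:
  fixes \<nu> :: "real ^ 'n"
  assumes \<nu>: "norm \<nu> = 1"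
    and sub1: "jet_subsolution \<nu> r F1 h1 w1" and sub2: "jet_subsolution \<nu> r F2 h2 w2"
    and w: "continuous_on (closed_strip \<nu> r) w1" "continuous_on (closed_strip \<nu> r) w2"
    and h: "continuous_on (hyperplane \<nu> 0) h1" "continuous_on (hyperplane \<nu> 0) h2"
    and x: "x \<in> closed_strip \<nu> r" "x \<bullet> \<nu> < r" and y: "y \<in> closed_strip \<nu> r" "y \<bullet> \<nu> < r"
    and sym: "symmetric_matrix E1" "symmetric_matrix E2" "symmetric_matrix B" and \<rho>: "\<rho> > 0"
    and max: "\<And>a b. x + a \<in> closed_strip \<nu> r \<Longrightarrow> y + b \<in> closed_strip \<nu> r \<Longrightarrow> norm a \<le> \<rho> \<Longrightarrow> norm b \<le> \<rho> \<Longrightarrow>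
       w1 (x + a) + w2 (y + b) \<le> w1 x + w2 y + p1 \<bullet> a + p2 \<bullet> b
         + (a \<bullet> (E1 *v a) + b \<bullet> (E2 *v b) + (a - b) \<bullet> (B *v (a - b))) / 2"
    and bd: "x \<bullet> \<nu> = 0 \<Longrightarrow> p1 \<bullet> \<nu> < h1 x" "y \<bullet> \<nu> = 0 \<Longrightarrow> p2 \<bullet> \<nu> < h2 y" and \<sigma>: "\<sigma> > 0"
  obtains X Y where "symmetric_matrix X" "symmetric_matrix Y" "0 \<le> F1 X" "0 \<le> F2 Y"
    "\<And>\<xi> \<zeta>. \<xi> \<bullet> (X *v \<xi>) + \<zeta> \<bullet> (Y *v \<zeta>) \<le> \<xi> \<bullet> (E1 *v \<xi>) + \<zeta> \<bullet> (E2 *v \<zeta>) + (\<xi> - \<zeta>) \<bullet> (B *v (\<xi> - \<zeta>))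
        + \<sigma> * ((norm \<xi>)\<^sup>2 + (norm \<zeta>)\<^sup>2)"
proof -
  define \<tau> where "\<tau> = \<sigma> / 4"
  have \<tau>: "\<tau> > 0" "\<tau> \<ge> 0" using \<sigma> by (auto simp: \<tau>_def)
  obtain \<sigma>1 where \<sigma>1: "\<sigma>1 > 0"
    "\<And>a q X \<sigma>. a \<in> localized_domain \<nu> r x \<rho> \<Longrightarrow> norm a < \<sigma>1 \<Longrightarrow> norm q < \<sigma>1 \<Longrightarrow> linear X \<Longrightarrow>
       \<exists>d>0. \<forall>b\<in>localized_domain \<nu> r x \<rho>. norm (b - a) < d \<longrightarrow>
         recentred w1 x p1 E1 \<tau> b \<le> recentred w1 x p1 E1 \<tau> a + q \<bullet> (b - a) + (b - a) \<bullet> X (b - a) / 2 + \<sigma> * (norm (b - a))\<^sup>2 \<Longrightarrow>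
       0 \<le> F1 (symmetric_part X + E1 + (2 * \<tau> + 2 * \<sigma>) *\<^sub>R mat 1)"
    by (rule jet_subsolution_contact[OF sub1 \<nu> x h(1) bd(1) sym(1) \<tau>(2) \<rho>]) blast+
  obtain \<sigma>2 where \<sigma>2: "\<sigma>2 > 0"
    "\<And>a q X \<sigma>. a \<in> localized_domain \<nu> r y \<rho> \<Longrightarrow> norm a < \<sigma>2 \<Longrightarrow> norm q < \<sigma>2 \<Longrightarrow> linear X \<Longrightarrow>
       \<exists>d>0. \<forall>b\<in>localized_domain \<nu> r y \<rho>. norm (b - a) < d \<longrightarrow>
         recentred w2 y p2 E2 \<tau> b \<le> recentred w2 y p2 E2 \<tau> a + q \<bullet> (b - a) + (b - a) \<bullet> X (b - a) / 2 + \<sigma> * (norm (b - a))\<^sup>2 \<Longrightarrow>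
       0 \<le> F2 (symmetric_part X + E2 + (2 * \<tau> + 2 * \<sigma>) *\<^sub>R mat 1)"
    by (rule jet_subsolution_contact[OF sub2 \<nu> y h(2) bd(2) sym(2) \<tau>(2) \<rho>]) blast+
  interpret S: sums_at_origin "recentred w1 x p1 E1 \<tau>" "recentred w2 y p2 E2 \<tau>"
    "localized_domain \<nu> r x \<rho>" "localized_domain \<nu> r y \<rho>" "\<lambda>v. B *v v" \<tau>
  proof (rule sums_at_origin.intro)
    show "compact (localized_domain \<nu> r x \<rho>)" "compact (localized_domain \<nu> r y \<rho>)"
      by (rule compact_localized_domain)+
    show "0 \<in> localized_domain \<nu> r x \<rho>" "0 \<in> localized_domain \<nu> r y \<rho>"
      using x y \<rho> by (auto simp: localized_domain_def)
    show "continuous_on (localized_domain \<nu> r x \<rho>) (recentred w1 x p1 E1 \<tau>)"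
      "continuous_on (localized_domain \<nu> r y \<rho>) (recentred w2 y p2 E2 \<tau>)"
      by (rule continuous_on_recentred w)+
    show "linear ((*v) B)" by (rule matrix_vector_mul_linear)
    show "(B *v a) \<bullet> b = a \<bullet> (B *v b)" for a b by (rule symmetric_matrix_inner[OF sym(3)])
    fix a b assume "a \<in> localized_domain \<nu> r x \<rho>" "b \<in> localized_domain \<nu> r y \<rho>"
    then show "recentred w1 x p1 E1 \<tau> a + recentred w2 y p2 E2 \<tau> b \<le> recentred w1 x p1 E1 \<tau> 0 + recentred w2 y p2 E2 \<tau> 0
       + (a - b) \<bullet> (B *v (a - b)) / 2 - \<tau> * ((norm a)\<^sup>2 + (norm b)\<^sup>2)"
      using max[of a b] by (simp add: localized_domain_def recentred_def add_divide_distrib distrib_left)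
  qed (rule \<tau>)
  define \<sigma>' where "\<sigma>' = min \<tau> (min \<sigma>1 \<sigma>2)"
  have \<sigma>': "\<sigma>' > 0" "\<sigma>' \<le> \<tau>" "\<sigma>' \<le> \<sigma>1" "\<sigma>' \<le> \<sigma>2" using \<tau> \<sigma>1 \<sigma>2 by (auto simp: \<sigma>'_def)
  obtain a b p q X Y where ab: "a \<in> localized_domain \<nu> r x \<rho>" "b \<in> localized_domain \<nu> r y \<rho>"
    "norm a < \<sigma>'" "norm b < \<sigma>'" "norm p < \<sigma>'" "norm q < \<sigma>'" and XY: "linear X" "linear Y"
    and t1: "\<exists>d>0. \<forall>h'\<in>localized_domain \<nu> r x \<rho>. norm (h' - a) < d \<longrightarrow>
       recentred w1 x p1 E1 \<tau> h' \<le> recentred w1 x p1 E1 \<tau> a + p \<bullet> (h' - a) + (h' - a) \<bullet> X (h' - a) / 2 + \<sigma>' * (norm (h' - a))\<^sup>2"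
    and t2: "\<exists>d>0. \<forall>k'\<in>localized_domain \<nu> r y \<rho>. norm (k' - b) < d \<longrightarrow>
       recentred w2 y p2 E2 \<tau> k' \<le> recentred w2 y p2 E2 \<tau> b + q \<bullet> (k' - b) + (k' - b) \<bullet> Y (k' - b) / 2 + \<sigma>' * (norm (k' - b))\<^sup>2"
    and le: "\<And>\<xi> \<zeta>. \<xi> \<bullet> X \<xi> + \<zeta> \<bullet> Y \<zeta> \<le> (\<xi> - \<zeta>) \<bullet> (B *v (\<xi> - \<zeta>))"
    by (rule S.sums_second_order[OF \<sigma>'(1)], rule that, assumption+)
  show ?thesis
  proof (rule that)
    show "symmetric_matrix (symmetric_part X + E1 + (2 * \<tau> + 2 * \<sigma>') *\<^sub>R mat 1)"
      "symmetric_matrix (symmetric_part Y + E2 + (2 * \<tau> + 2 * \<sigma>') *\<^sub>R mat 1)"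
      by (intro symmetric_matrix_arith symmetric_part_symmetric sym)+
    show "0 \<le> F1 (symmetric_part X + E1 + (2 * \<tau> + 2 * \<sigma>') *\<^sub>R mat 1)"
      by (rule \<sigma>1(2)[OF ab(1) _ _ XY(1) t1]) (use ab \<sigma>' in linarith)+
    show "0 \<le> F2 (symmetric_part Y + E2 + (2 * \<tau> + 2 * \<sigma>') *\<^sub>R mat 1)"
      by (rule \<sigma>2(2)[OF ab(2) _ _ XY(2) t2]) (use ab \<sigma>' in linarith)+
    fix \<xi> \<zeta> :: "real ^ 'n"
    have "(2 * \<tau> + 2 * \<sigma>') * ((norm \<xi>)\<^sup>2 + (norm \<zeta>)\<^sup>2) \<le> \<sigma> * ((norm \<xi>)\<^sup>2 + (norm \<zeta>)\<^sup>2)"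
      using \<sigma>'(2) by (intro mult_right_mono) (auto simp: \<tau>_def)
    then show "\<xi> \<bullet> ((symmetric_part X + E1 + (2 * \<tau> + 2 * \<sigma>') *\<^sub>R mat 1) *v \<xi>)
       + \<zeta> \<bullet> ((symmetric_part Y + E2 + (2 * \<tau> + 2 * \<sigma>') *\<^sub>R mat 1) *v \<zeta>)
       \<le> \<xi> \<bullet> (E1 *v \<xi>) + \<zeta> \<bullet> (E2 *v \<zeta>) + (\<xi> - \<zeta>) \<bullet> (B *v (\<xi> - \<zeta>)) + \<sigma> * ((norm \<xi>)\<^sup>2 + (norm \<zeta>)\<^sup>2)"
      using le[of \<xi> \<zeta>]
      by (simp add: matrix_mult_arith inner_add_right symmetric_part_quadform XY power2_norm_eq_inner distrib_left)
  qed
qed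

section \<open>The comparison principle\<close>

text \<open>
  For large \<open>N\<close> the penalty forces maximizers \<open>(x, y)\<close> close to the diagonal, where the strict maximum at
  \<open>x0\<close> confines them.
\<close>

lemma doubling_penalization:
  fixes C :: "'a::real_normed_vector set"
  assumes C: "compact C" "x0 \<in> C" and f: "continuous_on C f" and g: "continuous_on C g" and \<kappa>: "\<kappa> > 0"
    and max: "\<And>x. x \<in> C \<Longrightarrow> f x + g x + \<kappa> * (norm (x - x0))\<^sup>2 \<le> f x0 + g (x0 :: 'a) "
    and \<rho>: "\<rho> > 0"
  obtains N x y where "N > 0" "x \<in> C" "y \<in> C" "norm (x - x0) < \<rho>" "norm (y - x0) < \<rho>"
    "\<And>x' y'. x' \<in> C \<Longrightarrow> y' \<in> C \<Longrightarrow>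
       f x' + g y' - N / 2 * (norm (x' - y'))\<^sup>2 \<le> f x + g y - N / 2 * (norm (x - y))\<^sup>2"
proof -
  have "bounded (f ` C)" "bounded (g ` C)"
    using C f g by (auto intro: compact_imp_bounded compact_continuous_image)
  then obtain M1 M2 where M12: "\<And>x. x \<in> C \<Longrightarrow> \<bar>f x\<bar> \<le> M1" "\<And>x. x \<in> C \<Longrightarrow> \<bar>g x\<bar> \<le> M2"
    unfolding bounded_iff by (auto simp: image_iff)
  define M where "M = max M1 M2"
  have M: "\<bar>f x\<bar> \<le> M" "\<bar>g x\<bar> \<le> M" if "x \<in> C" for x
    using M12[OF that] by (auto simp: M_def)
  have M0: "M \<ge> 0" using M(1)[OF C(2)] by linarith
  have "uniformly_continuous_on C g" by (rule compact_uniformly_continuous[OF g C(1)])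
  moreover have "\<kappa> * (\<rho> / 2)\<^sup>2 > 0" using \<kappa> \<rho> by simp
  ultimately obtain d where d: "d > 0" "\<And>x y. x \<in> C \<Longrightarrow> y \<in> C \<Longrightarrow> dist x y < d \<Longrightarrow> dist (g x) (g y) < \<kappa> * (\<rho> / 2)\<^sup>2"
    unfolding uniformly_continuous_on_def by metis
  define d' where "d' = min d (\<rho> / 2)"
  have d': "d' > 0" using d \<rho> by (simp add: d'_def)
  define N where "N = (8 * M + 1) / d'\<^sup>2"
  have N: "N > 0" using M0 d' by (simp add: N_def add_nonneg_pos)
  have "continuous_on (C \<times> C) (\<lambda>z. f (fst z) + g (snd z) - N / 2 * (norm (fst z - snd z))\<^sup>2)"
    by (intro continuous_intros continuous_on_compose2[OF f] continuous_on_compose2[OF g]) auto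
  moreover have "compact (C \<times> C)" by (rule compact_Times[OF C(1) C(1)])
  moreover have "C \<times> C \<noteq> {}" using C(2) by blast
  ultimately have "\<exists>z\<in>C \<times> C. \<forall>z'\<in>C \<times> C. f (fst z') + g (snd z') - N / 2 * (norm (fst z' - snd z'))\<^sup>2
      \<le> f (fst z) + g (snd z) - N / 2 * (norm (fst z - snd z))\<^sup>2"
    by (intro continuous_attains_sup)
  then obtain z where z: "z \<in> C \<times> C" "\<forall>z'\<in>C \<times> C. f (fst z') + g (snd z') - N / 2 * (norm (fst z' - snd z'))\<^sup>2
      \<le> f (fst z) + g (snd z) - N / 2 * (norm (fst z - snd z))\<^sup>2" by blast
  define x y where "x = fst z" and "y = snd z"
  have xy: "x \<in> C" "y \<in> C" using z by (auto simp: x_def y_def)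
  have mx: "f x' + g y' - N / 2 * (norm (x' - y'))\<^sup>2 \<le> f x + g y - N / 2 * (norm (x - y))\<^sup>2"
    if "x' \<in> C" "y' \<in> C" for x' y' using z(2)[rule_format, of "(x', y')"] that by (simp add: x_def y_def)
  have m0: "f x0 + g x0 \<le> f x + g y - N / 2 * (norm (x - y))\<^sup>2" using mx[OF C(2) C(2)] by simp
  have "N / 2 * (norm (x - y))\<^sup>2 \<le> 4 * M"
    using m0 M[OF C(2)] M[OF xy(1)] M[OF xy(2)] by linarith
  also have "\<dots> < N / 2 * d'\<^sup>2" using d' by (simp add: N_def)
  finally have "(norm (x - y))\<^sup>2 < d'\<^sup>2" using N by simp
  then have xyd: "norm (x - y) < d'" using d' by (simp add: power_less_imp_less_base)
  have "\<bar>g y - g x\<bar> < \<kappa> * (\<rho> / 2)\<^sup>2"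
    using d(2)[OF xy(2) xy(1)] xyd by (simp add: d'_def dist_norm norm_minus_commute)
  moreover have "0 \<le> N / 2 * (norm (x - y))\<^sup>2" using N by simp
  ultimately have "\<kappa> * (norm (x - x0))\<^sup>2 < \<kappa> * (\<rho> / 2)\<^sup>2" using m0 max[OF xy(1)] by linarith
  then have "(norm (x - x0))\<^sup>2 < (\<rho> / 2)\<^sup>2" using \<kappa> by simp
  then have nx: "norm (x - x0) < \<rho> / 2" using \<rho> power_less_imp_less_base[of "norm (x - x0)" 2 "\<rho> / 2"] by simp
  have "norm (y - x0) \<le> norm (x - y) + norm (x - x0)"
    using norm_triangle_ineq4[of "x - x0" "x - y"] by simp
  then have "norm (y - x0) < \<rho>" using nx xyd by (simp add: d'_def)
  then show ?thesis using that[of N x y] N xy nx \<rho> mx by simp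
qed

text \<open>
  If the claim fails, then \<open>w1 + w2 + \<alpha> (x \<bullet> \<nu>) + \<mu> (x \<bullet> \<nu>)\<^sup>2\<close> has an almost maximum \<open>x2\<close> below the top. As
  \<open>\<alpha>\<close> exceeds the gap \<open>\<delta>\<close> between the Neumann data, a number \<open>m\<close> can be found such that the slopes \<open>m - \<alpha>\<close>
  for \<open>w1\<close> and \<open>- m\<close> for \<open>w2\<close> violate both Neumann inequalities near \<open>x2\<close>. The doubling adds the slopes
  \<open>N (x - y)\<close> and \<open>N (y - x)\<close>; at a point on the lower boundary this lowers the normal slope
  further, since the other point lies in the strip. The doubled maximum principle then yields Hessians
  with \<open>X + Y \<le> 6\<kappa> Id - 2\<mu> \<nu> \<nu>\<^sup>T\<close>, which contradicts ellipticity for small \<open>\<kappa>\<close>.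
\<close>

theorem strip_comparison:
  fixes \<nu> :: "real ^ 'n"
  assumes F: "elliptic_bound l K F" and \<nu>: "norm \<nu> = 1" and r: "r > 0"
    and sub1: "jet_subsolution \<nu> r F h1 w1" and sub2: "jet_subsolution \<nu> r (dual_operator F) h2 w2"
    and w: "continuous_on (closed_strip \<nu> r) w1" "continuous_on (closed_strip \<nu> r) w2"
    and wM: "\<And>x. x \<in> closed_strip \<nu> r \<Longrightarrow> w1 x + w2 x \<le> M"
    and h: "continuous_on (hyperplane \<nu> 0) h1" "continuous_on (hyperplane \<nu> 0) h2"
    and \<delta>: "\<delta> \<ge> 0" "\<And>x. x \<bullet> \<nu> = 0 \<Longrightarrow> - h1 x - h2 x \<le> \<delta>"
    and top: "\<And>x. x \<bullet> \<nu> = r \<Longrightarrow> w1 x + w2 x \<le> c"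
    and x0: "x0 \<in> closed_strip \<nu> r"
  shows "w1 x0 + w2 x0 \<le> c + \<delta> * r"
proof (rule ccontr)
  assume neg: "\<not> ?thesis"
  have l: "l > 0" "K > 0" using F by (auto simp: elliptic_bound_def)
  have \<nu>1: "\<nu> \<bullet> \<nu> = 1" using \<nu> by (simp add: dot_square_norm)
  \<comment> \<open>Of the excess \<open>3\<omega>\<close> the term with \<open>\<alpha>\<close> uses up \<open>\<omega>\<close> apart from \<open>\<delta> r\<close>, the term with \<open>\<mu>\<close> another \<open>\<omega>\<close>, and
    passing to an almost maximum less than \<open>\<omega>\<close>.\<close>
  define \<omega> where "\<omega> = (w1 x0 + w2 x0 - (c + \<delta> * r)) / 3"
  have \<omega>: "\<omega> > 0" using neg by (simp add: \<omega>_def)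
  define \<delta>1 where "\<delta>1 = \<omega> / (3 * r)"
  have \<delta>1: "\<delta>1 > 0" "3 * \<delta>1 * r = \<omega>" using \<omega> r by (auto simp: \<delta>1_def)
  define \<mu> where "\<mu> = \<omega> / r\<^sup>2"
  have \<mu>: "\<mu> > 0" "\<mu> * r\<^sup>2 = \<omega>" using \<omega> r by (auto simp: \<mu>_def)
  define \<alpha> where "\<alpha> = \<delta> + 3 * \<delta>1"
  have \<alpha>: "\<alpha> > 0" "\<alpha> * r = \<delta> * r + \<omega>" using \<delta> \<delta>1 by (auto simp: \<alpha>_def distrib_right)
  define \<Psi> where "\<Psi> x = w1 x + w2 x + \<alpha> * (x \<bullet> \<nu>) + \<mu> * (x \<bullet> \<nu>)\<^sup>2" for x
  define \<kappa> where "\<kappa> = min (\<omega> / 2) (l * \<mu> / (8 * (K + l)))"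
  have \<kappa>: "\<kappa> > 0" "\<kappa> < \<omega>" "6 * \<kappa> * (K + l) < 2 * (l * \<mu>)"
  proof -
    show "\<kappa> > 0" "\<kappa> < \<omega>" using \<omega> l \<mu> by (auto simp: \<kappa>_def)
    have "6 * \<kappa> * (K + l) \<le> 6 * (l * \<mu> / (8 * (K + l))) * (K + l)"
      using l by (intro mult_right_mono mult_left_mono) (auto simp: \<kappa>_def)
    also have "\<dots> = 6 / 8 * (l * \<mu>)" using l by (simp add: field_simps)
    finally show "6 * \<kappa> * (K + l) < 2 * (l * \<mu>)" using mult_pos_pos[OF l(1) \<mu>(1)] by linarith
  qed
  let ?S = "closed_strip \<nu> r"
  have t: "0 \<le> x \<bullet> \<nu>" "x \<bullet> \<nu> \<le> r" if "x \<in> ?S" for x using that by (auto simp: closed_strip_def)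
  have tr: "\<alpha> * (x \<bullet> \<nu>) + \<mu> * (x \<bullet> \<nu>)\<^sup>2 \<le> \<alpha> * r + \<mu> * r\<^sup>2" if "x \<in> ?S" for x
    using t[OF that] \<alpha> \<mu> by (intro add_mono mult_left_mono power_mono) auto
  have bdd: "bdd_above (\<Psi> ` ?S)"
    by (rule bdd_aboveI2[of _ _ "M + \<alpha> * r + \<mu> * r\<^sup>2"]) (use wM tr in \<open>fastforce simp: \<Psi>_def\<close>)
  have cont: "continuous_on ?S \<Psi>" unfolding \<Psi>_def by (intro continuous_intros w)
  obtain x1 x2 where x12: "x1 \<in> ?S" "x2 \<in> ?S" "norm (x2 - x1) < 1" "Sup (\<Psi> ` ?S) - \<kappa> < \<Psi> x2"
    and mx: "\<And>x. x \<in> ?S \<Longrightarrow> norm (x - x1) \<le> 1 \<Longrightarrow> \<Psi> x - \<kappa> * (norm (x - x1))\<^sup>2 \<le> \<Psi> x2 - \<kappa> * (norm (x2 - x1))\<^sup>2"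
    by (rule near_maximum_point[OF closed_closed_strip _ cont bdd \<kappa>(1)], use x0 in blast, rule that, assumption+)
  have "c + \<delta> * r + 3 * \<omega> \<le> \<Psi> x0"
  proof -
    have "3 * \<omega> = w1 x0 + w2 x0 - (c + \<delta> * r)" by (simp add: \<omega>_def)
    moreover have "0 \<le> \<alpha> * (x0 \<bullet> \<nu>)" "0 \<le> \<mu> * (x0 \<bullet> \<nu>)\<^sup>2" using t[OF x0] \<alpha>(1) \<mu>(1) by auto
    ultimately show ?thesis unfolding \<Psi>_def by linarith
  qed
  also have "\<Psi> x0 \<le> Sup (\<Psi> ` ?S)" by (rule cSUP_upper[OF x0 bdd])
  finally have big: "c + \<delta> * r + 2 * \<omega> < \<Psi> x2" using x12(4) \<kappa>(2) by linarith
  have x2r: "x2 \<bullet> \<nu> < r"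
  proof -
    have "x2 \<bullet> \<nu> \<noteq> r"
    proof
      assume eq: "x2 \<bullet> \<nu> = r"
      have "\<Psi> x2 = w1 x2 + w2 x2 + \<alpha> * r + \<mu> * r\<^sup>2" by (simp add: \<Psi>_def eq)
      with big top[OF eq] \<alpha>(2) \<mu>(2) show False by linarith
    qed
    then show ?thesis using t[OF x12(2)] by simp
  qed
  \<comment> \<open>If \<open>x2\<close> lies on the lower boundary, \<open>m\<close> has to be chosen between \<open>- h2\<close> and \<open>h1 + \<alpha>\<close>, which at \<open>x2\<close> are
    at least \<open>3 \<delta>1\<close> apart; the distance \<open>\<delta>1\<close> to either end allows for the variation of \<open>h1\<close> and \<open>h2\<close>.
    Otherwise the neighbourhood can be taken away from the lower boundary.\<close>
  define m where "m = (if x2 \<bullet> \<nu> = 0 then \<delta>1 - h2 x2 else 0)"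
  have "\<exists>d>0. \<forall>x\<in>?S. norm (x - x2) < d \<longrightarrow> x \<bullet> \<nu> = 0 \<longrightarrow> m - \<alpha> < h1 x \<and> - m < h2 x"
  proof (cases "x2 \<bullet> \<nu> = 0")
    case True
    then have x2H: "x2 \<in> hyperplane \<nu> 0" by (simp add: hyperplane_def)
    obtain d1 where d1: "d1 > 0" "\<And>y. y \<in> hyperplane \<nu> 0 \<Longrightarrow> dist y x2 < d1 \<Longrightarrow> dist (h1 y) (h1 x2) < \<delta>1"
      using h(1) x2H \<delta>1(1) unfolding continuous_on_iff by blast
    obtain d2 where d2: "d2 > 0" "\<And>y. y \<in> hyperplane \<nu> 0 \<Longrightarrow> dist y x2 < d2 \<Longrightarrow> dist (h2 y) (h2 x2) < \<delta>1"
      using h(2) x2H \<delta>1(1) unfolding continuous_on_iff by blast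
    show ?thesis
    proof (intro exI[of _ "min d1 d2"] conjI ballI impI)
      fix x assume "norm (x - x2) < min d1 d2" "x \<bullet> \<nu> = 0"
      then have "\<bar>h1 x - h1 x2\<bar> < \<delta>1" "\<bar>h2 x - h2 x2\<bar> < \<delta>1"
        using d1(2)[of x] d2(2)[of x] by (auto simp: hyperplane_def dist_norm)
      then show "m - \<alpha> < h1 x" "- m < h2 x"
        using \<delta>(2)[OF True] True by (auto simp: m_def \<alpha>_def)
    qed (use d1 d2 in auto)
  next
    case False
    then have "x2 \<bullet> \<nu> > 0" using t[OF x12(2)] by simp
    moreover have "x \<bullet> \<nu> \<noteq> 0" if "norm (x - x2) < x2 \<bullet> \<nu>" for x
      using Cauchy_Schwarz_ineq2[of "x - x2" \<nu>] \<nu> that by (auto simp: inner_diff_left)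
    ultimately show ?thesis by (intro exI[of _ "x2 \<bullet> \<nu>"]) auto
  qed
  then obtain d where d: "d > 0" "\<And>x. x \<in> ?S \<Longrightarrow> norm (x - x2) < d \<Longrightarrow> x \<bullet> \<nu> = 0 \<Longrightarrow> m - \<alpha> < h1 x \<and> - m < h2 x"
    by blast
  define C where "C = ?S \<inter> cball x1 1"
  have C: "compact C" unfolding C_def by (rule closed_Int_compact[OF closed_closed_strip compact_cball])
  have x2C: "x2 \<in> C" using x12 by (simp add: C_def dist_norm norm_minus_commute)
  define \<rho>0 where "\<rho>0 = min d (min (r - x2 \<bullet> \<nu>) ((1 - norm (x2 - x1)) / 2))"
  have \<rho>0: "\<rho>0 > 0" using d x2r x12 by (simp add: \<rho>0_def)
  \<comment> \<open>The second quadratic term turns \<open>x2\<close> into the strict maximum required by \<open>doubling_penalization\<close>.\<close>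
  define f where "f x = w1 x - m * (x \<bullet> \<nu>) + \<alpha> * (x \<bullet> \<nu>) + \<mu> * (x \<bullet> \<nu>)\<^sup>2 - \<kappa> * (norm (x - x1))\<^sup>2 - \<kappa> * (norm (x - x2))\<^sup>2" for x
  define g where "g y = w2 y + m * (y \<bullet> \<nu>)" for y
  have fg: "f x + g x + \<kappa> * (norm (x - x2))\<^sup>2 \<le> f x2 + g x2" if "x \<in> C" for x
    using mx[of x] that by (simp add: f_def g_def \<Psi>_def C_def dist_norm norm_minus_commute)
  have cfg: "continuous_on C f" "continuous_on C g"
    unfolding f_def g_def C_def by (intro continuous_intros continuous_on_subset[OF w(1)] continuous_on_subset[OF w(2)]; auto)+
  obtain N x y where N: "N > 0" and xy: "x \<in> C" "y \<in> C" "norm (x - x2) < \<rho>0" "norm (y - x2) < \<rho>0"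
    and mxy: "\<And>x' y'. x' \<in> C \<Longrightarrow> y' \<in> C \<Longrightarrow>
       f x' + g y' - N / 2 * (norm (x' - y'))\<^sup>2 \<le> f x + g y - N / 2 * (norm (x - y))\<^sup>2"
    by (rule doubling_penalization[OF C x2C cfg \<kappa>(1) fg \<rho>0], assumption+, rule that, assumption+)
  have S: "x \<in> ?S" "y \<in> ?S" using xy by (auto simp: C_def)
  have lt: "z \<bullet> \<nu> < r" if "norm (z - x2) < \<rho>0" for z
    using norm_cauchy_schwarz[of "z - x2" \<nu>] \<nu> that by (simp add: inner_diff_left \<rho>0_def)
  define \<rho>1 where "\<rho>1 = (1 - norm (x2 - x1)) / 2"
  have \<rho>1: "\<rho>1 > 0" using x12 by (simp add: \<rho>1_def)
  have inC: "z + a \<in> C" if "norm (z - x2) < \<rho>0" "norm a \<le> \<rho>1" "z + a \<in> ?S" for z a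
  proof -
    have "norm (z + a - x1) \<le> norm (z - x2) + norm (x2 - x1) + norm a"
      using norm_triangle_ineq[of "z - x2 + (x2 - x1)" a] norm_triangle_ineq[of "z - x2" "x2 - x1"]
      by (simp add: algebra_simps)
    also have "\<dots> \<le> 1" using that by (simp add: \<rho>0_def \<rho>1_def)
    finally show ?thesis using that by (simp add: C_def dist_norm norm_minus_commute)
  qed
  define E1 where "E1 = (4 * \<kappa>) *\<^sub>R mat 1 - (2 * \<mu>) *\<^sub>R outer \<nu>"
  define p1 where "p1 = (m - \<alpha> - 2 * \<mu> * (x \<bullet> \<nu>)) *\<^sub>R \<nu> + (2 * \<kappa>) *\<^sub>R (x - x1) + (2 * \<kappa>) *\<^sub>R (x - x2) + N *\<^sub>R (x - y)"
  define p2 where "p2 = (- m) *\<^sub>R \<nu> - N *\<^sub>R (x - y)"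
  have E1q: "v \<bullet> (E1 *v v) = 4 * \<kappa> * (norm v)\<^sup>2 - 2 * \<mu> * (v \<bullet> \<nu>)\<^sup>2" for v
    by (simp add: E1_def matrix_mult_arith outer_mult inner_diff_right inner_commute dot_square_norm power2_eq_square)
  have Nq: "v \<bullet> ((N *\<^sub>R mat 1) *v v) = N * (norm v)\<^sup>2" for v :: "real ^ 'n"
    by (simp add: matrix_mult_arith dot_square_norm)
  have sq: "(norm (u + v))\<^sup>2 = (norm u)\<^sup>2 + 2 * (u \<bullet> v) + (norm v)\<^sup>2" for u v :: "real ^ 'n"
    by (simp add: power2_norm_eq_inner inner_add_left inner_add_right inner_commute)
  obtain X Y where XY: "symmetric_matrix X" "symmetric_matrix Y" "0 \<le> F X" "0 \<le> dual_operator F Y"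
    and le: "\<And>\<xi> \<zeta>. \<xi> \<bullet> (X *v \<xi>) + \<zeta> \<bullet> (Y *v \<zeta>) \<le> \<xi> \<bullet> (E1 *v \<xi>) + \<zeta> \<bullet> (0 *v \<zeta>) + (\<xi> - \<zeta>) \<bullet> ((N *\<^sub>R mat 1) *v (\<xi> - \<zeta>))
        + \<kappa> * ((norm \<xi>)\<^sup>2 + (norm \<zeta>)\<^sup>2)"
  proof (rule doubling_maximum_principle[where ?E1.0 = E1 and ?E2.0 = 0 and B = "N *\<^sub>R mat 1" and ?p1.0 = p1 and ?p2.0 = p2,
        OF \<nu> sub1 sub2 w h S(1) lt[OF xy(3)] S(2) lt[OF xy(4)] _ _ _ \<rho>1 _ _ _ \<kappa>(1)])
    show "symmetric_matrix E1" "symmetric_matrix 0" "symmetric_matrix (N *\<^sub>R mat 1)"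
      unfolding E1_def by (intro symmetric_matrix_arith)+
    show "w1 (x + a) + w2 (y + b) \<le> w1 x + w2 y + p1 \<bullet> a + p2 \<bullet> b
         + (a \<bullet> (E1 *v a) + b \<bullet> (0 *v b) + (a - b) \<bullet> ((N *\<^sub>R mat 1) *v (a - b))) / 2"
      if ab: "x + a \<in> ?S" "y + b \<in> ?S" "norm a \<le> \<rho>1" "norm b \<le> \<rho>1" for a b
    proof -
      have e1: "(norm (x + a - x1))\<^sup>2 = (norm (x - x1))\<^sup>2 + 2 * ((x - x1) \<bullet> a) + (norm a)\<^sup>2"
        using sq[of "x - x1" a] by (simp add: algebra_simps)
      have e2: "(norm (x + a - x2))\<^sup>2 = (norm (x - x2))\<^sup>2 + 2 * ((x - x2) \<bullet> a) + (norm a)\<^sup>2"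
        using sq[of "x - x2" a] by (simp add: algebra_simps)
      have e3: "(norm (x + a - (y + b)))\<^sup>2 = (norm (x - y))\<^sup>2 + 2 * ((x - y) \<bullet> (a - b)) + (norm (a - b))\<^sup>2"
        using sq[of "x - y" "a - b"] by (simp add: algebra_simps)
      have e4: "(x \<bullet> \<nu> + a \<bullet> \<nu>)\<^sup>2 = (x \<bullet> \<nu>)\<^sup>2 + 2 * (x \<bullet> \<nu>) * (a \<bullet> \<nu>) + (a \<bullet> \<nu>)\<^sup>2"
        by (simp add: power2_sum)
      have P1: "p1 \<bullet> a = (m - \<alpha> - 2 * \<mu> * (x \<bullet> \<nu>)) * (a \<bullet> \<nu>) + 2 * \<kappa> * ((x - x1) \<bullet> a) + 2 * \<kappa> * ((x - x2) \<bullet> a) + N * ((x - y) \<bullet> a)"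
        by (simp only: p1_def inner_add_left inner_scaleR_left inner_commute[of \<nu>])
      have P2: "p2 \<bullet> b = - m * (b \<bullet> \<nu>) - N * ((x - y) \<bullet> b)"
        by (simp only: p2_def inner_diff_left[of "(- m) *\<^sub>R \<nu>"] inner_scaleR_left inner_commute[of \<nu>])
      have "f (x + a) + g (y + b) - N / 2 * (norm (x + a - (y + b)))\<^sup>2 \<le> f x + g y - N / 2 * (norm (x - y))\<^sup>2"
        using ab xy by (intro mxy inC)
      then show ?thesis
        unfolding f_def g_def e1 e2 e3 P1 P2 E1q Nq inner_diff_right[of "x - y"] inner_add_left e4
        by (simp add: field_simps)
    qed
    show "p1 \<bullet> \<nu> < h1 x" if z: "x \<bullet> \<nu> = 0"
    proof -
      have "p1 \<bullet> \<nu> = m - \<alpha> - 2 * \<kappa> * (x1 \<bullet> \<nu>) - 2 * \<kappa> * (x2 \<bullet> \<nu>) - N * (y \<bullet> \<nu>)"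
        by (simp add: p1_def inner_add_left inner_diff_left z \<nu>1)
      moreover have "0 \<le> 2 * \<kappa> * (x1 \<bullet> \<nu>)" "0 \<le> 2 * \<kappa> * (x2 \<bullet> \<nu>)" "0 \<le> N * (y \<bullet> \<nu>)"
        using t[OF x12(1)] t[OF x12(2)] t[OF S(2)] \<kappa> N by auto
      moreover have "m - \<alpha> < h1 x" using d(2)[OF S(1) _ z] xy(3) by (simp add: \<rho>0_def)
      ultimately show ?thesis by linarith
    qed
    show "p2 \<bullet> \<nu> < h2 y" if z: "y \<bullet> \<nu> = 0"
    proof -
      have "p2 \<bullet> \<nu> = - m - N * (x \<bullet> \<nu>)" by (simp add: p2_def inner_diff_left z \<nu>1)
      moreover have "0 \<le> N * (x \<bullet> \<nu>)" using t[OF S(1)] N by simp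
      moreover have "- m < h2 y" using d(2)[OF S(2) _ z] xy(4) by (simp add: \<rho>0_def)
      ultimately show ?thesis by linarith
    qed
  qed (rule that, assumption+)
  \<comment> \<open>The coupling disappears on the diagonal \<open>\<xi> = \<zeta>\<close>.\<close>
  have q: "\<xi> \<bullet> ((X - - Y) *v \<xi>) \<le> 6 * \<kappa> * (norm \<xi>)\<^sup>2 - 2 * \<mu> * (\<xi> \<bullet> \<nu>)\<^sup>2" for \<xi>
    using le[of \<xi> \<xi>] by (simp add: E1q matrix_mult_arith inner_add_right)
  have "F X - F (- Y) \<le> (6 * \<kappa>) * K + l * (\<nu> \<bullet> ((X - - Y) *v \<nu>))"
  proof (rule elliptic_boundD[OF F XY(1) symmetric_matrix_arith(3)[OF XY(2)] _ \<nu>])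
    show "\<xi> \<bullet> ((X - - Y) *v \<xi>) \<le> 6 * \<kappa> * (norm \<xi>)\<^sup>2" for \<xi>
    proof -
      have "0 \<le> 2 * \<mu> * (\<xi> \<bullet> \<nu>)\<^sup>2" using \<mu>(1) by simp
      with q[of \<xi>] show ?thesis by linarith
    qed
  qed (use \<kappa> in simp)
  also have "\<dots> \<le> (6 * \<kappa>) * K + l * (6 * \<kappa> - 2 * \<mu>)"
    using q[of \<nu>] l \<nu> \<nu>1 by (intro add_left_mono mult_left_mono) auto
  also have "\<dots> < 0" using \<kappa>(3) by (simp add: algebra_simps)
  finally show False using XY(3,4) by (simp add: dual_operator_def)
qed

section \<open>Equicontinuity along the boundary\<close>

text \<open>
  Taylor's formula for the norm, valid up to half of the distance to the singularity at the cost of a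
  second-order term twice as large as the Hessian requires.
\<close>

lemma norm_add_le_second_order:
  fixes z s :: "'a::real_inner"
  assumes z: "z \<noteq> 0" and s: "norm s \<le> norm z / 2" and e: "e = z /\<^sub>R norm z"
  shows "norm (z + s) \<le> norm z + e \<bullet> s + ((norm s)\<^sup>2 - (e \<bullet> s)\<^sup>2) / norm z"
proof -
  define N c P where "N = norm z" and "c = e \<bullet> s" and "P = (norm s)\<^sup>2 - (e \<bullet> s)\<^sup>2"
  have N: "N > 0" using z by (simp add: N_def)
  have "norm e = 1" using z by (simp add: e)
  then have cs: "\<bar>c\<bar> \<le> norm s" using Cauchy_Schwarz_ineq2[of e s] by (simp add: c_def)
  then have "c\<^sup>2 \<le> (norm s)\<^sup>2" by (metis abs_ge_zero power2_abs power_mono)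
  then have P: "P \<ge> 0" by (simp add: P_def c_def)
  have Nc: "N + c \<ge> N / 2" using cs s by (simp add: N_def)
  have zs: "z \<bullet> s = N * c" using N by (simp add: c_def e N_def)
  have "(norm (z + s))\<^sup>2 = (N + c)\<^sup>2 + P"
    using zs by (simp add: power2_norm_eq_inner inner_add_left inner_add_right inner_commute power2_sum P_def N_def c_def)
  also have "\<dots> \<le> (N + c)\<^sup>2 + 2 * (N + c) * (P / N)"
  proof -
    have "P = 2 * (N / 2) * (P / N)" using N by simp
    also have "\<dots> \<le> 2 * (N + c) * (P / N)" using Nc P N by (intro mult_right_mono) auto
    finally show ?thesis by simp
  qed
  also have "\<dots> \<le> (N + c + P / N)\<^sup>2" by (simp add: power2_sum)
  finally have "(norm (z + s))\<^sup>2 \<le> (N + c + P / N)\<^sup>2" .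
  moreover have "0 \<le> P / N" using N P by simp
  then have "0 \<le> N + c + P / N" using Nc N by linarith
  ultimately have "norm (z + s) \<le> N + c + P / N" by (rule power2_le_imp_le)
  then show ?thesis by (simp add: N_def c_def P_def)
qed

text \<open>
  This is the method of Ishii and Lions. If the estimate fails for a pair of points, the function
  \<open>w x - w y - L (|x - y| - |x - y|\<^sup>2) + \<psi> (x \<bullet> \<nu>) + \<psi> (y \<bullet> \<nu>)\<close> has an almost maximum with \<open>x \<noteq> y\<close>. The
  modulus \<open>n - n\<^sup>2\<close> is strictly concave, so along \<open>e = (x - y) / |x - y|\<close> the coupling has the second
  derivative \<open>- 2 L\<close>. In the matrix inequality the choice \<open>\<xi> = - \<zeta> = e\<close> shows that \<open>X + Y\<close> is bounded by
  a constant minus \<open>8 L\<close> in the direction \<open>e\<close>, while \<open>\<xi> = \<zeta>\<close> bounds \<open>X + Y\<close> from above independently of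
  \<open>L\<close>; for large \<open>L\<close> this contradicts ellipticity. The function \<open>\<psi>\<close> has the slope \<open>A\<close> at the lower
  boundary, which exceeds the Neumann data and thereby rules out the Neumann alternative, but its values
  are too small to affect the estimate. All constants depend on the data through the bound \<open>A\<close> only.
\<close>

theorem tangential_equicontinuity:
  fixes \<nu> :: "real ^ 'n"
  assumes F: "elliptic_bound l K F" and \<nu>: "norm \<nu> = 1" and A: "A > 0" and \<theta>: "\<theta> > 0"
  obtains r0 where "r0 > 0"
    "\<And>h w x y. continuous_on (hyperplane \<nu> 0) h \<Longrightarrow> (\<And>x. x \<bullet> \<nu> = 0 \<Longrightarrow> \<bar>h x\<bar> < A) \<Longrightarrow>
       continuous_on (closed_strip \<nu> 1) w \<Longrightarrow> (\<And>x. x \<in> closed_strip \<nu> 1 \<Longrightarrow> \<bar>w x\<bar> \<le> A * (1 - x \<bullet> \<nu>)) \<Longrightarrow>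
       jet_subsolution \<nu> 1 F h w \<Longrightarrow> jet_subsolution \<nu> 1 (dual_operator F) (\<lambda>x. - h x) (\<lambda>x. - w x) \<Longrightarrow>
       x \<bullet> \<nu> = 0 \<Longrightarrow> y \<bullet> \<nu> = 0 \<Longrightarrow> norm (x - y) \<le> r0 \<Longrightarrow> w x - w y \<le> \<theta>"
proof -
  have l: "l > 0" "K > 0" using F by (auto simp: elliptic_bound_def)
  have \<nu>1: "\<nu> \<bullet> \<nu> = 1" using \<nu> by (simp add: dot_square_norm)
  define \<theta>' where "\<theta>' = \<theta> / 4"
  have \<theta>': "\<theta>' > 0" using \<theta> by (simp add: \<theta>'_def)
  \<comment> \<open>The maximal value of \<open>\<psi>\<close> is \<open>A\<^sup>2 / (4 q) = \<theta>'\<close>.\<close>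
  define q where "q = A\<^sup>2 / (4 * \<theta>')"
  have q: "q > 0" using A \<theta>' by (simp add: q_def)
  \<comment> \<open>The bound by \<open>8 A\<close> keeps the maximum away from \<open>|x - y| = 1 / 2\<close> and from the top; the last one gives
    the contradiction with ellipticity.\<close>
  define L where "L = 8 * A + (4 * q + 4) * (K + l) / (8 * l) + 1"
  have L: "L > 0" "L \<ge> 8 * A" "(4 * q + 4) * (K + l) < 8 * l * L"
  proof -
    have "0 < (4 * q + 4) * (K + l) / (8 * l)" using q l by simp
    then show "L > 0" "L \<ge> 8 * A" using A by (auto simp: L_def)
    have "8 * l * L = 8 * l * (8 * A + 1) + (4 * q + 4) * (K + l)" using l by (simp add: L_def field_simps)
    then show "(4 * q + 4) * (K + l) < 8 * l * L" using l A by simp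
  qed
  define \<psi> where "\<psi> t = A * t - q * t\<^sup>2" for t :: real
  have \<psi>: "\<psi> t \<le> \<theta>'" for t
  proof -
    have "\<theta>' - \<psi> t = q * (t - A / (2 * q))\<^sup>2"
    proof -
      have "q * (t - A / (2 * q))\<^sup>2 = q * t\<^sup>2 - A * t + A\<^sup>2 / (4 * q)"
        using q by (simp add: power2_diff field_simps power2_eq_square)
      moreover have "A\<^sup>2 / (4 * q) = \<theta>'" using A \<theta>' by (simp add: q_def)
      ultimately show ?thesis by (simp add: \<psi>_def)
    qed
    moreover have "0 \<le> q * (t - A / (2 * q))\<^sup>2" using q by simp
    ultimately show ?thesis by linarith
  qed
  define r0 where "r0 = min (1 / 2) (\<theta>' / L)"
  show ?thesis
  proof (rule that[of r0])
    show "r0 > 0" using \<theta>' L by (simp add: r0_def)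
    fix h w and x0 y0 :: "real ^ 'n"
    assume h: "continuous_on (hyperplane \<nu> 0) h" "\<And>x. x \<bullet> \<nu> = 0 \<Longrightarrow> \<bar>h x\<bar> < A"
      and w: "continuous_on (closed_strip \<nu> 1) w" "\<And>x. x \<in> closed_strip \<nu> 1 \<Longrightarrow> \<bar>w x\<bar> \<le> A * (1 - x \<bullet> \<nu>)"
      and sub1: "jet_subsolution \<nu> 1 F h w"
      and sub2: "jet_subsolution \<nu> 1 (dual_operator F) (\<lambda>x. - h x) (\<lambda>x. - w x)"
      and xy0: "x0 \<bullet> \<nu> = 0" "y0 \<bullet> \<nu> = 0" "norm (x0 - y0) \<le> r0"
    show "w x0 - w y0 \<le> \<theta>"
    proof (rule ccontr)
      assume neg: "\<not> w x0 - w y0 \<le> \<theta>"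
      let ?S = "closed_strip \<nu> 1"
      define S2 where "S2 = {z. fst z \<in> ?S \<and> snd z \<in> ?S \<and> norm (fst z - snd z) \<le> 1 / 2}"
      define \<Phi> where "\<Phi> z = w (fst z) - w (snd z) - L * (norm (fst z - snd z) - (norm (fst z - snd z))\<^sup>2)
          + \<psi> (fst z \<bullet> \<nu>) + \<psi> (snd z \<bullet> \<nu>)" for z
      have t: "0 \<le> x \<bullet> \<nu>" "x \<bullet> \<nu> \<le> 1" if "x \<in> ?S" for x using that by (auto simp: closed_strip_def)
      have wA: "\<bar>w x\<bar> \<le> A" if "x \<in> ?S" for x
      proof -
        have "A * (1 - x \<bullet> \<nu>) \<le> A * 1" using t[OF that] A by (intro mult_left_mono) auto
        with w(2)[OF that] show ?thesis by linarith
      qed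
      have quad: "n / 2 \<le> n - n\<^sup>2" if "0 \<le> n" "n \<le> 1 / 2" for n :: real
      proof -
        have "n * n \<le> n * (1 / 2)" using that by (intro mult_left_mono) auto
        then show ?thesis by (simp add: power2_eq_square)
      qed
      have closed: "closed S2"
      proof -
        have eq: "S2 = ?S \<times> ?S \<inter> {z. norm (fst z - snd z) \<le> 1 / 2}" by (auto simp: S2_def)
        have "closed {z :: (real ^ 'n) \<times> (real ^ 'n). norm (fst z - snd z) \<le> 1 / 2}"
          by (intro closed_Collect_le continuous_intros)
        then show ?thesis unfolding eq by (intro closed_Int closed_Times closed_closed_strip)
      qed
      have cont: "continuous_on S2 \<Phi>"
        unfolding \<Phi>_def \<psi>_def
        by (intro continuous_intros continuous_on_compose2[OF w(1)]) (auto simp: S2_def)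
      have ub: "\<Phi> z \<le> 2 * A - L / 2 * norm (fst z - snd z) + 2 * \<theta>'" if "z \<in> S2" for z
      proof -
        have "L * (norm (fst z - snd z) / 2) \<le> L * (norm (fst z - snd z) - (norm (fst z - snd z))\<^sup>2)"
          using L(1) quad[of "norm (fst z - snd z)"] that by (intro mult_left_mono) (auto simp: S2_def)
        then show ?thesis
          using wA[of "fst z"] wA[of "snd z"] \<psi>[of "fst z \<bullet> \<nu>"] \<psi>[of "snd z \<bullet> \<nu>"] that
          by (auto simp: S2_def \<Phi>_def)
      qed
      have bdd: "bdd_above (\<Phi> ` S2)"
      proof (rule bdd_aboveI2)
        fix z assume "z \<in> S2"
        then have "\<Phi> z \<le> 2 * A - L / 2 * norm (fst z - snd z) + 2 * \<theta>'" by (rule ub)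
        moreover have "0 \<le> L / 2 * norm (fst z - snd z)" using L(1) by simp
        ultimately show "\<Phi> z \<le> 2 * A + 2 * \<theta>'" by linarith
      qed
      have z0: "(x0, y0) \<in> S2" using xy0 by (simp add: S2_def closed_strip_def r0_def)
      have big0: "3 * \<theta>' < \<Phi> (x0, y0)"
      proof -
        have "L * (norm (x0 - y0) - (norm (x0 - y0))\<^sup>2) \<le> L * (\<theta>' / L)"
          using xy0(3) L(1) by (intro mult_left_mono) (auto simp: r0_def intro: order_trans[of _ "norm (x0 - y0)"])
        then show ?thesis using neg L(1) xy0 by (simp add: \<Phi>_def \<psi>_def \<theta>'_def)
      qed
      define \<kappa> where "\<kappa> = min \<theta>' (1 / 2)"
      have \<kappa>: "\<kappa> > 0" "\<kappa> \<le> \<theta>'" "\<kappa> \<le> 1 / 2" using \<theta>' by (auto simp: \<kappa>_def)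
      obtain z1 z2 where z12: "z1 \<in> S2" "z2 \<in> S2" "norm (z2 - z1) < 1" "Sup (\<Phi> ` S2) - \<kappa> < \<Phi> z2"
        and mx: "\<And>z. z \<in> S2 \<Longrightarrow> norm (z - z1) \<le> 1 \<Longrightarrow> \<Phi> z - \<kappa> * (norm (z - z1))\<^sup>2 \<le> \<Phi> z2 - \<kappa> * (norm (z2 - z1))\<^sup>2"
        by (rule near_maximum_point[OF closed _ cont bdd \<kappa>(1)], use z0 in blast, rule that, assumption+)
      have "\<Phi> (x0, y0) \<le> Sup (\<Phi> ` S2)" by (rule cSUP_upper[OF z0 bdd])
      then have big: "2 * \<theta>' < \<Phi> z2" using big0 z12(4) \<kappa>(2) by linarith
      define x y x1 y1 where "x = fst z2" and "y = snd z2" and "x1 = fst z1" and "y1 = snd z1"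
      have zz: "z2 = (x, y)" "z1 = (x1, y1)" by (simp_all add: x_def y_def x1_def y1_def)
      have xyS: "x \<in> ?S" "y \<in> ?S" "norm (x - y) \<le> 1 / 2" and xy1S: "x1 \<in> ?S" "y1 \<in> ?S"
        using z12 by (auto simp: S2_def zz)
      define z N e where "z = x - y" and "N = norm z" and "e = z /\<^sub>R N"
      have "x \<noteq> y"
      proof
        assume "x = y"
        then have "\<Phi> z2 = 2 * \<psi> (x \<bullet> \<nu>)" by (simp add: \<Phi>_def zz)
        with big \<psi>[of "x \<bullet> \<nu>"] show False by linarith
      qed
      then have z: "z \<noteq> 0" and N: "N > 0" by (auto simp: z_def N_def)
      have e1: "norm e = 1" using N by (simp add: e_def N_def)
      have ez: "z = N *\<^sub>R e" using N by (simp add: e_def)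
      have N2: "N < 1 / 2"
      proof (rule ccontr)
        assume "\<not> N < 1 / 2"
        then have "L / 2 * N \<ge> L / 2 * (1 / 2)" using L(1) by (intro mult_left_mono) auto
        then show False using ub[OF z12(2)] big L(2) by (simp add: zz z_def N_def)
      qed
      \<comment> \<open>At the top, where one of the two values of \<open>w\<close> vanishes, the other is at most \<open>A |x - y|\<close>, which the
        modulus dominates.\<close>
      have AL: "A * N \<le> L * (N - N\<^sup>2)"
      proof -
        have "A * N \<le> L * (N / 2)" using L(2) A N by simp
        also have "\<dots> \<le> L * (N - N\<^sup>2)" using quad[of N] N N2 L(1) by (intro mult_left_mono) auto
        finally show ?thesis .
      qed
      have \<Phi>2: "\<Phi> z2 \<le> w x - w y - L * (N - N\<^sup>2) + 2 * \<theta>'"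
        using \<psi>[of "x \<bullet> \<nu>"] \<psi>[of "y \<bullet> \<nu>"] by (simp add: \<Phi>_def zz z_def N_def)
      have zn: "\<bar>x \<bullet> \<nu> - y \<bullet> \<nu>\<bar> \<le> N"
        using Cauchy_Schwarz_ineq2[of z \<nu>] \<nu> by (simp add: z_def N_def inner_diff_left)
      have xr: "x \<bullet> \<nu> < 1"
      proof (rule ccontr)
        assume "\<not> x \<bullet> \<nu> < 1"
        then have x1': "x \<bullet> \<nu> = 1" using t[OF xyS(1)] by simp
        have "w x \<le> 0" using w(2)[OF xyS(1)] x1' by simp
        moreover have "- w y \<le> A * N"
        proof -
          have "A * (1 - y \<bullet> \<nu>) \<le> A * N" using zn x1' A by (intro mult_left_mono) auto
          with w(2)[OF xyS(2)] show ?thesis by linarith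
        qed
        ultimately show False using \<Phi>2 big AL by linarith
      qed
      have yr: "y \<bullet> \<nu> < 1"
      proof (rule ccontr)
        assume "\<not> y \<bullet> \<nu> < 1"
        then have y1': "y \<bullet> \<nu> = 1" using t[OF xyS(2)] by simp
        have "- w y \<le> 0" using w(2)[OF xyS(2)] y1' by simp
        moreover have "w x \<le> A * N"
        proof -
          have "A * (1 - x \<bullet> \<nu>) \<le> A * N" using zn y1' A by (intro mult_left_mono) auto
          with w(2)[OF xyS(1)] show ?thesis by linarith
        qed
        ultimately show False using \<Phi>2 big AL by linarith
      qed
      define E where "E = (2 * q) *\<^sub>R outer \<nu> + (2 * \<kappa>) *\<^sub>R mat 1"
      define B where "B = (2 * L / N - 2 * L) *\<^sub>R mat 1 - (2 * L / N) *\<^sub>R outer e"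
      define p1 where "p1 = L *\<^sub>R (e - 2 *\<^sub>R z) - (A - 2 * q * (x \<bullet> \<nu>)) *\<^sub>R \<nu> + (2 * \<kappa>) *\<^sub>R (x - x1)"
      define p2 where "p2 = - (L *\<^sub>R (e - 2 *\<^sub>R z)) - (A - 2 * q * (y \<bullet> \<nu>)) *\<^sub>R \<nu> + (2 * \<kappa>) *\<^sub>R (y - y1)"
      have Eq: "v \<bullet> (E *v v) = 2 * q * (v \<bullet> \<nu>)\<^sup>2 + 2 * \<kappa> * (norm v)\<^sup>2" for v
        by (simp add: E_def matrix_mult_arith outer_mult inner_add_right inner_commute dot_square_norm power2_eq_square)
      have Bq: "v \<bullet> (B *v v) = (2 * L / N - 2 * L) * (norm v)\<^sup>2 - (2 * L / N) * (e \<bullet> v)\<^sup>2" for v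
        by (simp add: B_def matrix_mult_arith outer_mult inner_diff_right inner_commute dot_square_norm power2_eq_square)
      have sq: "(norm (u + v))\<^sup>2 = (norm u)\<^sup>2 + 2 * (u \<bullet> v) + (norm v)\<^sup>2" for u v :: "real ^ 'n"
        by (simp add: power2_norm_eq_inner inner_add_left inner_add_right inner_commute)
      define \<rho> where "\<rho> = min (N / 4) (min ((1 / 2 - N) / 2) ((1 - norm (z2 - z1)) / 2))"
      have \<rho>: "\<rho> > 0" using N N2 z12(3) by (simp add: \<rho>_def)
      have \<rho>b: "\<rho> \<le> N / 4" "2 * \<rho> \<le> 1 / 2 - N" "2 * \<rho> \<le> 1 - norm (z2 - z1)"
        by (auto simp: \<rho>_def min_def)
      have ch: "continuous_on (hyperplane \<nu> 0) (\<lambda>x. - h x)" "continuous_on ?S (\<lambda>x. - w x)"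
        by (intro continuous_intros h w)+
      obtain X Y where XY: "symmetric_matrix X" "symmetric_matrix Y" "0 \<le> F X" "0 \<le> dual_operator F Y"
        and le: "\<And>\<xi> \<zeta>. \<xi> \<bullet> (X *v \<xi>) + \<zeta> \<bullet> (Y *v \<zeta>) \<le> \<xi> \<bullet> (E *v \<xi>) + \<zeta> \<bullet> (E *v \<zeta>) + (\<xi> - \<zeta>) \<bullet> (B *v (\<xi> - \<zeta>))
            + 1 * ((norm \<xi>)\<^sup>2 + (norm \<zeta>)\<^sup>2)"
      proof (rule doubling_maximum_principle[where ?E1.0 = E and ?E2.0 = E and B = B and ?p1.0 = p1 and ?p2.0 = p2 and \<sigma> = 1,
            OF \<nu> sub1 sub2 w(1) ch(2) h(1) ch(1) xyS(1) xr xyS(2) yr _ _ _ \<rho>])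
        show "symmetric_matrix E" "symmetric_matrix E" "symmetric_matrix B"
          unfolding E_def B_def by (intro symmetric_matrix_arith)+
        show "w (x + a) + - w (y + b) \<le> w x + - w y + p1 \<bullet> a + p2 \<bullet> b
           + (a \<bullet> (E *v a) + b \<bullet> (E *v b) + (a - b) \<bullet> (B *v (a - b))) / 2"
          if ab: "x + a \<in> ?S" "y + b \<in> ?S" "norm a \<le> \<rho>" "norm b \<le> \<rho>" for a b
        proof -
          define s where "s = a - b"
          have s: "norm s \<le> 2 * \<rho>" using norm_triangle_ineq4[of a b] ab by (simp add: s_def)
          have xs: "x + a - (y + b) = z + s" by (simp add: z_def s_def)
          have nzs: "norm (z + s) \<le> 1 / 2"
            using norm_triangle_ineq[of z s] s \<rho>b(2) unfolding N_def by linarith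
          have "norm ((x + a, y + b) - z1) \<le> norm (z2 - z1) + norm (a, b)"
            using norm_triangle_ineq[of "z2 - z1" "(a, b)"] by (simp add: zz algebra_simps)
          also have "norm (a, b) \<le> norm a + norm b" by (simp add: norm_Pair sqrt_sum_squares_le_sum)
          also have "norm (z2 - z1) + (norm a + norm b) \<le> 1" using ab \<rho>b(3) by linarith
          finally have n1: "norm ((x + a, y + b) - z1) \<le> 1" by simp
          have "(x + a, y + b) \<in> S2" using ab nzs by (simp add: S2_def xs)
          from mx[OF this n1] have
            "w (x + a) - w (y + b) - L * (norm (z + s) - (norm (z + s))\<^sup>2) + \<psi> ((x + a) \<bullet> \<nu>) + \<psi> ((y + b) \<bullet> \<nu>)
               - \<kappa> * (norm ((x + a, y + b) - z1))\<^sup>2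
             \<le> w x - w y - L * (N - N\<^sup>2) + \<psi> (x \<bullet> \<nu>) + \<psi> (y \<bullet> \<nu>) - \<kappa> * (norm (z2 - z1))\<^sup>2"
            by (simp add: \<Phi>_def zz z_def[symmetric] N_def[symmetric] xs)
          moreover have "\<kappa> * (norm ((x + a, y + b) - z1))\<^sup>2 = \<kappa> * (norm (z2 - z1))\<^sup>2 + 2 * \<kappa> * ((x - x1) \<bullet> a) + \<kappa> * (norm a)\<^sup>2
             + 2 * \<kappa> * ((y - y1) \<bullet> b) + \<kappa> * (norm b)\<^sup>2"
          proof -
            have np: "(norm (u, v))\<^sup>2 = (norm u)\<^sup>2 + (norm v)\<^sup>2" for u v :: "real ^ 'n"
              by (simp add: norm_Pair)
            have d1: "(x + a, y + b) - z1 = ((x - x1) + a, (y - y1) + b)" and d2: "z2 - z1 = (x - x1, y - y1)"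
              by (simp_all add: zz)
            show ?thesis unfolding d1 d2 np sq distrib_left by linarith
          qed
          moreover have "\<psi> ((x + a) \<bullet> \<nu>) = \<psi> (x \<bullet> \<nu>) + (A - 2 * q * (x \<bullet> \<nu>)) * (a \<bullet> \<nu>) - q * (a \<bullet> \<nu>)\<^sup>2"
            "\<psi> ((y + b) \<bullet> \<nu>) = \<psi> (y \<bullet> \<nu>) + (A - 2 * q * (y \<bullet> \<nu>)) * (b \<bullet> \<nu>) - q * (b \<bullet> \<nu>)\<^sup>2"
            by (simp_all add: \<psi>_def inner_add_left power2_sum algebra_simps)
          moreover have "L * (norm (z + s) - (norm (z + s))\<^sup>2)
             \<le> L * (N - N\<^sup>2) + L * (e \<bullet> s - 2 * (z \<bullet> s)) + (s \<bullet> (B *v s)) / 2"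
          proof -
            have "norm (z + s) \<le> N + e \<bullet> s + ((norm s)\<^sup>2 - (e \<bullet> s)\<^sup>2) / N"
              unfolding N_def
              by (rule norm_add_le_second_order[OF z]) (use s \<rho>b(1) in \<open>simp_all add: N_def e_def\<close>)
            then have "norm (z + s) - (norm (z + s))\<^sup>2
              \<le> (N + e \<bullet> s + ((norm s)\<^sup>2 - (e \<bullet> s)\<^sup>2) / N) - (N\<^sup>2 + 2 * (z \<bullet> s) + (norm s)\<^sup>2)"
              unfolding sq[of z s] N_def by simp
            then have "L * (norm (z + s) - (norm (z + s))\<^sup>2)
              \<le> L * ((N + e \<bullet> s + ((norm s)\<^sup>2 - (e \<bullet> s)\<^sup>2) / N) - (N\<^sup>2 + 2 * (z \<bullet> s) + (norm s)\<^sup>2))"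
              using L(1) by (intro mult_left_mono) auto
            also have "\<dots> = L * (N - N\<^sup>2) + L * (e \<bullet> s - 2 * (z \<bullet> s)) + (s \<bullet> (B *v s)) / 2"
              unfolding Bq using N by (simp add: field_simps)
            finally show ?thesis .
          qed
          moreover have "p1 \<bullet> a + p2 \<bullet> b = L * (e \<bullet> s - 2 * (z \<bullet> s)) - (A - 2 * q * (x \<bullet> \<nu>)) * (a \<bullet> \<nu>)
             - (A - 2 * q * (y \<bullet> \<nu>)) * (b \<bullet> \<nu>) + 2 * \<kappa> * ((x - x1) \<bullet> a) + 2 * \<kappa> * ((y - y1) \<bullet> b)"
          proof -
            have "p1 \<bullet> a = L * ((e - 2 *\<^sub>R z) \<bullet> a) - (A - 2 * q * (x \<bullet> \<nu>)) * (a \<bullet> \<nu>) + 2 * \<kappa> * ((x - x1) \<bullet> a)"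
              unfolding p1_def inner_add_left inner_diff_left[of "L *\<^sub>R (e - 2 *\<^sub>R z)"] inner_scaleR_left inner_commute[of \<nu>] ..
            moreover have "p2 \<bullet> b = - (L * ((e - 2 *\<^sub>R z) \<bullet> b)) - (A - 2 * q * (y \<bullet> \<nu>)) * (b \<bullet> \<nu>) + 2 * \<kappa> * ((y - y1) \<bullet> b)"
              unfolding p2_def inner_add_left inner_diff_left[of "- (L *\<^sub>R (e - 2 *\<^sub>R z))"] inner_minus_left inner_scaleR_left inner_commute[of \<nu>] ..
            moreover have "L * ((e - 2 *\<^sub>R z) \<bullet> a) - L * ((e - 2 *\<^sub>R z) \<bullet> b) = L * (e \<bullet> s - 2 * (z \<bullet> s))"
              by (simp add: s_def inner_diff_left inner_diff_right algebra_simps)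
            ultimately show ?thesis by linarith
          qed
          moreover have "(a \<bullet> (E *v a) + b \<bullet> (E *v b) + s \<bullet> (B *v s)) / 2
            = q * (a \<bullet> \<nu>)\<^sup>2 + \<kappa> * (norm a)\<^sup>2 + q * (b \<bullet> \<nu>)\<^sup>2 + \<kappa> * (norm b)\<^sup>2 + (s \<bullet> (B *v s)) / 2"
            unfolding Eq by (simp add: add_divide_distrib)
          ultimately show ?thesis
            unfolding s_def[symmetric] by linarith
        qed
        \<comment> \<open>The modulus is increasing for \<open>|x - y| < 1 / 2\<close>; at a point on the lower boundary its normal slope
          therefore has the favourable sign.\<close>
        have ezn: "(e - 2 *\<^sub>R z) \<bullet> \<nu> = (1 / N - 2) * (x \<bullet> \<nu> - y \<bullet> \<nu>)"
        proof -
          have "z \<bullet> \<nu> = x \<bullet> \<nu> - y \<bullet> \<nu>" by (simp add: z_def inner_diff_left)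
          moreover have "(e - 2 *\<^sub>R z) \<bullet> \<nu> = (1 / N - 2) * (z \<bullet> \<nu>)"
            by (simp add: e_def inner_diff_left left_diff_distrib inverse_eq_divide)
          ultimately show ?thesis by simp
        qed
        have N12: "1 / N - 2 \<ge> 0" using N N2 by (simp add: field_simps)
        show "p1 \<bullet> \<nu> < h x" if b: "x \<bullet> \<nu> = 0"
        proof -
          have "p1 \<bullet> \<nu> = - (L * ((1 / N - 2) * (y \<bullet> \<nu>))) - A - 2 * \<kappa> * (x1 \<bullet> \<nu>)"
            unfolding p1_def inner_add_left inner_diff_left[of "L *\<^sub>R (e - 2 *\<^sub>R z)"] inner_scaleR_left ezn
            by (simp add: b \<nu>1 inner_diff_left)
          moreover have "0 \<le> L * ((1 / N - 2) * (y \<bullet> \<nu>))" using L(1) N12 t[OF xyS(2)] by auto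
          moreover have "0 \<le> 2 * \<kappa> * (x1 \<bullet> \<nu>)" using \<kappa>(1) t[OF xy1S(1)] by auto
          ultimately show ?thesis using h(2)[OF b] by linarith
        qed
        show "p2 \<bullet> \<nu> < - h y" if b: "y \<bullet> \<nu> = 0"
        proof -
          have "p2 \<bullet> \<nu> = - (L * ((1 / N - 2) * (x \<bullet> \<nu>))) - A - 2 * \<kappa> * (y1 \<bullet> \<nu>)"
            unfolding p2_def inner_add_left inner_diff_left[of "- (L *\<^sub>R (e - 2 *\<^sub>R z))"] inner_minus_left inner_scaleR_left ezn
            by (simp add: b \<nu>1 inner_diff_left)
          moreover have "0 \<le> L * ((1 / N - 2) * (x \<bullet> \<nu>))" using L(1) N12 t[OF xyS(1)] by auto
          moreover have "0 \<le> 2 * \<kappa> * (y1 \<bullet> \<nu>)" using \<kappa>(1) t[OF xy1S(2)] by auto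
          ultimately show ?thesis using h(2)[OF b] by linarith
        qed
      qed (simp, rule that, assumption+)
      have bound: "\<xi> \<bullet> (E *v \<xi>) + \<xi> \<bullet> (E *v \<xi>) + 2 * (norm \<xi>)\<^sup>2 \<le> (4 * q + 4) * (norm \<xi>)\<^sup>2" for \<xi>
      proof -
        have "(\<xi> \<bullet> \<nu>)\<^sup>2 \<le> (norm \<xi>)\<^sup>2"
          using Cauchy_Schwarz_ineq[of \<xi> \<nu>] by (simp add: \<nu> dot_square_norm)
        then have "4 * q * (\<xi> \<bullet> \<nu>)\<^sup>2 \<le> 4 * q * (norm \<xi>)\<^sup>2" using q by (intro mult_left_mono) auto
        moreover have "4 * \<kappa> * (norm \<xi>)\<^sup>2 \<le> 2 * (norm \<xi>)\<^sup>2" using \<kappa>(3) by (intro mult_right_mono) auto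
        ultimately show ?thesis by (simp add: Eq algebra_simps)
      qed
      have q1: "\<xi> \<bullet> ((X - - Y) *v \<xi>) \<le> (4 * q + 4) * (norm \<xi>)\<^sup>2" for \<xi>
        using le[of \<xi> \<xi>] bound[of \<xi>] by (simp add: matrix_mult_arith inner_add_right)
      \<comment> \<open>Here \<open>\<xi> = e\<close> and \<open>\<zeta> = - e\<close>, for which the coupling contributes \<open>4 (e \<bullet> B e) = - 8 L\<close>.\<close>
      have q2: "e \<bullet> ((X - - Y) *v e) \<le> (4 * q + 4) - 8 * L"
      proof -
        have "e - - e = 2 *\<^sub>R e" by (simp add: scaleR_2)
        then have "(e - - e) \<bullet> (B *v (e - - e)) = 4 * (e \<bullet> (B *v e))"
          by (simp add: matrix_vector_mult_scaleR)
        also have "e \<bullet> (B *v e) = - 2 * L" by (simp add: Bq e1 dot_square_norm)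
        finally have B4: "(e - - e) \<bullet> (B *v (e - - e)) = - 8 * L" by simp
        have neg: "M *v (- e) = - (M *v e)" for M :: "real ^ 'n ^ 'n"
          using matrix_vector_mult_scaleR[of M "-1" e] by simp
        show ?thesis
          using le[of e "- e"] bound[of e] unfolding B4 neg
          by (simp add: matrix_mult_arith inner_add_right e1)
      qed
      have "F X - F (- Y) \<le> (4 * q + 4) * K + l * (e \<bullet> ((X - - Y) *v e))"
        by (rule elliptic_boundD[OF F XY(1) symmetric_matrix_arith(3)[OF XY(2)] _ e1 q1]) (use q in simp)
      also have "\<dots> \<le> (4 * q + 4) * K + l * ((4 * q + 4) - 8 * L)"
        using q2 l by (intro add_left_mono mult_left_mono) auto
      also have "\<dots> < 0" using L(3) by (simp add: algebra_simps)
      finally show False using XY(3,4) by (simp add: dual_operator_def)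
    qed
  qed
qed

section \<open>Almost periods\<close>

text \<open>
  The integer parts of \<open>n cos (\<xi> \<bullet> z)\<close> and \<open>n sin (\<xi> \<bullet> z)\<close> for \<open>\<xi> \<in> K\<close> sort the points \<open>z\<close> into finitely many
  classes; \<open>Z\<close> contains one point of each.
\<close>

lemma finite_net_of_characters:
  fixes K :: "(real ^ 'n) set" and n :: nat
  assumes K: "finite K" and n: "n > 0"
  obtains Z where "finite Z" "Z \<subseteq> S"
    "\<And>z. z \<in> S \<Longrightarrow> \<exists>z'\<in>Z. \<forall>\<xi>\<in>K. norm (exp (\<i> * complex_of_real (\<xi> \<bullet> z)) - exp (\<i> * complex_of_real (\<xi> \<bullet> z'))) \<le> 2 / n"
proof -
  define b where "b z = restrict (\<lambda>\<xi>. (\<lfloor>real n * cos (\<xi> \<bullet> z)\<rfloor>, \<lfloor>real n * sin (\<xi> \<bullet> z)\<rfloor>)) K" for z :: "real ^ 'n"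
  have rng: "\<lfloor>real n * c\<rfloor> \<in> {- int n..int n}" if "- 1 \<le> c" "c \<le> 1" for c :: real
  proof -
    have "real n * - 1 \<le> real n * c" "real n * c \<le> real n * 1" using that by (intro mult_left_mono; simp)+
    then show ?thesis by (auto simp: le_floor_iff floor_le_iff)
  qed
  have "b ` S \<subseteq> (\<Pi>\<^sub>E \<xi>\<in>K. {- int n..int n} \<times> {- int n..int n})"
    by (auto simp: b_def intro!: rng[unfolded atLeastAtMost_iff, THEN conjunct1] rng[unfolded atLeastAtMost_iff, THEN conjunct2] sin_le_one sin_ge_minus_one cos_le_one cos_ge_minus_one)
  then have fin: "finite (b ` S)" by (rule finite_subset) (intro finite_PiE K, simp)
  define Z where "Z = inv_into S b ` (b ` S)"
  show ?thesis
  proof (rule that[of Z])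
    show "finite Z" unfolding Z_def using fin by simp
    show "Z \<subseteq> S" unfolding Z_def by (auto intro: inv_into_into)
    fix z assume z: "z \<in> S"
    define z' where "z' = inv_into S b (b z)"
    have bz: "b z' = b z" unfolding z'_def by (rule f_inv_into_f) (use z in simp)
    have near: "\<bar>x - y\<bar> \<le> 1 / n" if "\<lfloor>real n * x\<rfloor> = \<lfloor>real n * y\<rfloor>" for x y :: real
    proof -
      have "\<bar>real n * x - real n * y\<bar> \<le> 1" using that by linarith
      then have "real n * \<bar>x - y\<bar> \<le> 1" by (simp add: abs_mult flip: right_diff_distrib)
      then show ?thesis using n by (simp add: field_simps)
    qed
    have "norm (exp (\<i> * complex_of_real (\<xi> \<bullet> z)) - exp (\<i> * complex_of_real (\<xi> \<bullet> z'))) \<le> 2 / n" if "\<xi> \<in> K" for \<xi>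
    proof -
      have "(\<lfloor>real n * cos (\<xi> \<bullet> z)\<rfloor>, \<lfloor>real n * sin (\<xi> \<bullet> z)\<rfloor>) = (\<lfloor>real n * cos (\<xi> \<bullet> z')\<rfloor>, \<lfloor>real n * sin (\<xi> \<bullet> z')\<rfloor>)"
        using fun_cong[OF bz, of \<xi>] that by (simp add: b_def)
      then have "\<bar>cos (\<xi> \<bullet> z) - cos (\<xi> \<bullet> z')\<bar> \<le> 1 / n" "\<bar>sin (\<xi> \<bullet> z) - sin (\<xi> \<bullet> z')\<bar> \<le> 1 / n"
        by (auto intro!: near)
      then show ?thesis
        using cmod_le[of "exp (\<i> * complex_of_real (\<xi> \<bullet> z)) - exp (\<i> * complex_of_real (\<xi> \<bullet> z'))"]
        by (simp add: Re_exp Im_exp)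
    qed
    moreover have "z' \<in> Z" unfolding Z_def z'_def using z by blast
    ultimately show "\<exists>z'\<in>Z. \<forall>\<xi>\<in>K. norm (exp (\<i> * complex_of_real (\<xi> \<bullet> z)) - exp (\<i> * complex_of_real (\<xi> \<bullet> z'))) \<le> 2 / n"
      by blast
  qed
qed

text \<open>
  If all frequencies of an approximating trigonometric polynomial take almost the same values at \<open>z\<close> and
  \<open>z'\<close>, then \<open>z - z'\<close> is an almost period. Since \<open>z'\<close> can be taken from a finite set, this almost period
  stays within a bounded distance of \<open>z\<close>.
\<close>

theorem almost_periods_relatively_dense:
  fixes S :: "(real ^ 'n) set"
  assumes S: "subspace S" and f: "almost_periodic_on S f" and \<delta>: "\<delta> > 0"
  obtains R where "R \<ge> 0"
    "\<And>z. z \<in> S \<Longrightarrow> \<exists>\<tau>\<in>S. norm (\<tau> - z) \<le> R \<and> (\<forall>x\<in>S. \<bar>f (x + \<tau>) - f x\<bar> \<le> \<delta>)"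
proof -
  have "\<delta> / 4 > 0" using \<delta> by simp
  then obtain p where "trigonometric_polynomial S p" and fp: "\<And>x. x \<in> S \<Longrightarrow> norm (complex_of_real (f x) - p x) \<le> \<delta> / 4"
    using f unfolding almost_periodic_on_def by blast
  then obtain K c where K: "finite K" and p: "p = (\<lambda>x. \<Sum>\<xi>\<in>K. c \<xi> * exp (\<i> * complex_of_real (\<xi> \<bullet> x)))"
    unfolding trigonometric_polynomial_def by blast
  define s where "s = (\<Sum>\<xi>\<in>K. norm (c \<xi>))"
  have s: "s \<ge> 0" unfolding s_def by (intro sum_nonneg) auto
  obtain n :: nat where n: "4 * (s + 1) / \<delta> < n" using reals_Archimedean2 by blast
  moreover have "0 < 4 * (s + 1) / \<delta>" using s \<delta> by simp
  ultimately have n0: "n > 0" by (metis of_nat_0_less_iff order_less_trans)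
  have sn: "s * (2 / n) \<le> \<delta> / 2"
  proof -
    have "4 * (s + 1) < \<delta> * n" using n \<delta> by (simp add: divide_less_eq mult.commute)
    then show ?thesis using n0 s by (simp add: field_simps)
  qed
  obtain Z where Z: "finite Z" "Z \<subseteq> S" "\<And>z. z \<in> S \<Longrightarrow> \<exists>z'\<in>Z. \<forall>\<xi>\<in>K. norm (exp (\<i> * complex_of_real (\<xi> \<bullet> z)) - exp (\<i> * complex_of_real (\<xi> \<bullet> z'))) \<le> 2 / n"
    by (rule finite_net_of_characters[OF K n0, of S], rule that, assumption+)
  define R where "R = (\<Sum>z\<in>Z. norm z)"
  show ?thesis
  proof (rule that[of R])
    show "R \<ge> 0" unfolding R_def by (intro sum_nonneg) auto
    fix z assume z: "z \<in> S"
    obtain z' where z': "z' \<in> Z" "\<And>\<xi>. \<xi> \<in> K \<Longrightarrow> norm (exp (\<i> * complex_of_real (\<xi> \<bullet> z)) - exp (\<i> * complex_of_real (\<xi> \<bullet> z'))) \<le> 2 / n"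
      using Z(3)[OF z] by blast
    have \<tau>: "z - z' \<in> S" using S z z'(1) Z(2) by (auto intro: subspace_diff)
    have "norm (z - z' - z) \<le> R"
      unfolding R_def using member_le_sum[OF z'(1), of norm] Z(1) by simp
    moreover have "\<bar>f (x + (z - z')) - f x\<bar> \<le> \<delta>" if x: "x \<in> S" for x
    proof -
      have "p (x + (z - z')) - p x = (\<Sum>\<xi>\<in>K. c \<xi> * (exp (\<i> * complex_of_real (\<xi> \<bullet> (x + (z - z')))) - exp (\<i> * complex_of_real (\<xi> \<bullet> x))))"
        by (simp add: p sum_subtractf right_diff_distrib)
      also have "norm \<dots> \<le> (\<Sum>\<xi>\<in>K. norm (c \<xi>) * (2 / n))"
      proof (rule sum_norm_le)
        fix \<xi> assume \<xi>: "\<xi> \<in> K"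
        have "exp (\<i> * complex_of_real (\<xi> \<bullet> (x + (z - z')))) - exp (\<i> * complex_of_real (\<xi> \<bullet> x))
          = exp (\<i> * complex_of_real (\<xi> \<bullet> (x - z'))) * (exp (\<i> * complex_of_real (\<xi> \<bullet> z)) - exp (\<i> * complex_of_real (\<xi> \<bullet> z')))"
          by (simp add: right_diff_distrib inner_add_right inner_diff_right algebra_simps flip: exp_add)
        then have "norm (exp (\<i> * complex_of_real (\<xi> \<bullet> (x + (z - z')))) - exp (\<i> * complex_of_real (\<xi> \<bullet> x))) \<le> 2 / n"
          using z'(2)[OF \<xi>] by (simp add: norm_mult norm_exp_i_times)
        then show "norm (c \<xi> * (exp (\<i> * complex_of_real (\<xi> \<bullet> (x + (z - z')))) - exp (\<i> * complex_of_real (\<xi> \<bullet> x))))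
          \<le> norm (c \<xi>) * (2 / n)" unfolding norm_mult by (intro mult_left_mono) auto
      qed
      also have "\<dots> = s * (2 / n)" by (simp only: s_def sum_distrib_right)
      finally have pp: "norm (p (x + (z - z')) - p x) \<le> \<delta> / 2" using sn by linarith
      have xs: "x + (z - z') \<in> S" using S x \<tau> by (rule subspace_add)
      have "\<bar>f (x + (z - z')) - f x\<bar> = norm (complex_of_real (f (x + (z - z'))) - complex_of_real (f x))"
        by (metis norm_of_real of_real_diff)
      also have "complex_of_real (f (x + (z - z'))) - complex_of_real (f x)
         = (complex_of_real (f (x + (z - z'))) - p (x + (z - z'))) + (p (x + (z - z')) - p x) - (complex_of_real (f x) - p x)" by simp
      also have "norm \<dots> \<le> \<delta> / 4 + \<delta> / 2 + \<delta> / 4"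
        by (intro order_trans[OF norm_triangle_ineq4] order_trans[OF norm_triangle_ineq] add_mono fp xs x pp)
      finally show ?thesis by simp
    qed
    ultimately show "\<exists>\<tau>\<in>S. norm (\<tau> - z) \<le> R \<and> (\<forall>x\<in>S. \<bar>f (x + \<tau>) - f x\<bar> \<le> \<delta>)"
      using \<tau> by blast
  qed
qed

section \<open>Solutions with constant Neumann data\<close>

text \<open>
  Schwarz's theorem under differentiability of the gradient at one point: the second difference of \<open>\<phi>\<close>
  over a small parallelogram is evaluated by the mean value theorem along either pair of sides.
\<close>

lemma second_derivative_symmetric:
  fixes \<phi> :: "'a::real_inner \<Rightarrow> real"
  assumes "open U" "x \<in> U"
    and \<phi>: "\<And>y. y \<in> U \<Longrightarrow> (\<phi> has_derivative (\<lambda>v. G y \<bullet> v)) (at y)"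
    and G: "(G has_derivative H) (at x)"
  shows "H v \<bullet> w = H w \<bullet> v"
proof -
  have linH: "H (s *\<^sub>R y) = s *\<^sub>R H y" "H (y + z) = H y + H z" for s y z
    using has_derivative_linear[OF G] by (simp_all add: linear_cmul linear_add)
  have main: "H v \<bullet> w - H w \<bullet> v \<le> e * (4 * (norm v + norm w + 1)\<^sup>2)" if "e > 0" for e v w
  proof -
    define N where "N = norm v + norm w + 1"
    have N: "N > 0" "norm v \<le> N" "norm w \<le> N" by (auto simp: N_def add_nonneg_pos)
    obtain d where d: "d > 0" "\<And>y. norm (y - x) < d \<Longrightarrow> norm (G y - G x - H (y - x)) \<le> e * norm (y - x)"
      using G \<open>e > 0\<close> unfolding has_derivative_at_alt by blast
    obtain d' where d': "d' > 0" "ball x d' \<subseteq> U" using assms(1,2) open_contains_ball by blast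
    define t where "t = min d d' / (2 * N)"
    have t: "t > 0" using d(1) d'(1) N by (simp add: t_def)
    have tN: "t * N < d" "t * N < d'" using d(1) d'(1) N by (auto simp: t_def min_def)
    have d3: "norm (G (x + z) - G x - H z) \<le> e * (t * N)" if "norm z \<le> t * N" for z
    proof -
      have "norm (G (x + z) - G x - H z) \<le> e * norm z" using d(2)[of "x + z"] that tN(1) by simp
      also have "\<dots> \<le> e * (t * N)" using that \<open>e > 0\<close> by (intro mult_left_mono) auto
      finally show ?thesis .
    qed
    have dx: "dist x (x + z) = norm z" for z by (simp add: dist_norm)
    have step: "\<exists>s\<in>{0<..<1}. \<phi> (x + t *\<^sub>R a + t *\<^sub>R b) - \<phi> (x + t *\<^sub>R a) - (\<phi> (x + t *\<^sub>R b) - \<phi> x)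
        = t * ((G (x + (s * t) *\<^sub>R a + t *\<^sub>R b) - G (x + (s * t) *\<^sub>R a)) \<bullet> a)"
      if ab: "norm a + norm b < N" for a b
    proof -
      define f where "f = (\<lambda>s. \<phi> (x + (s * t) *\<^sub>R a + t *\<^sub>R b) - \<phi> (x + (s * t) *\<^sub>R a))"
      have inU: "x + (s * t) *\<^sub>R a + c *\<^sub>R b \<in> U" if s: "s \<in> {0..1}" and c: "c = t \<or> c = 0" for s c
      proof -
        have "norm ((s * t) *\<^sub>R a + c *\<^sub>R b) \<le> s * t * norm a + c * norm b"
          using norm_triangle_ineq[of "(s * t) *\<^sub>R a" "c *\<^sub>R b"] s c t by (auto simp: abs_mult)
        also have "\<dots> \<le> t * norm a + t * norm b"
          using s c t by (intro add_mono mult_right_mono) (auto simp: mult_left_le_one_le)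
        also have "\<dots> \<le> t * N" using ab t by (simp flip: distrib_left)
        also have "\<dots> < d'" by (rule tN)
        finally have "x + (s * t) *\<^sub>R a + c *\<^sub>R b \<in> ball x d'"
          unfolding mem_ball add.assoc dx .
        then show ?thesis using d'(2) by blast
      qed
      have lin: "((\<lambda>s. x + (s * t) *\<^sub>R a + c) has_derivative (\<lambda>h. (h * t) *\<^sub>R a)) (at s within {0..1})" for s c
        by (auto intro!: derivative_eq_intros)
      have der: "(f has_derivative (\<lambda>h. h * (t * ((G (x + (s * t) *\<^sub>R a + t *\<^sub>R b) - G (x + (s * t) *\<^sub>R a)) \<bullet> a)))) (at s within {0..1})"
        if "s \<in> {0..1}" for s
      proof -
        have "(f has_derivative (\<lambda>h. G (x + (s * t) *\<^sub>R a + t *\<^sub>R b) \<bullet> ((h * t) *\<^sub>R a) - G (x + (s * t) *\<^sub>R a) \<bullet> ((h * t) *\<^sub>R a))) (at s within {0..1})"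
          unfolding f_def
          using has_derivative_diff[OF has_derivative_compose[OF lin[of "t *\<^sub>R b" s] \<phi>[OF inU[OF that, of t]]]
              has_derivative_compose[OF lin[of 0 s] \<phi>]] inU[OF that, of 0] by simp
        then show ?thesis by (simp add: algebra_simps)
      qed
      obtain s where s: "s \<in> {0<..<1}"
        "f 1 - f 0 = t * ((G (x + (s * t) *\<^sub>R a + t *\<^sub>R b) - G (x + (s * t) *\<^sub>R a)) \<bullet> a)"
        using mvt_simple[of 0 1 f "\<lambda>s h. h * (t * ((G (x + (s * t) *\<^sub>R a + t *\<^sub>R b) - G (x + (s * t) *\<^sub>R a)) \<bullet> a))"] der
        by auto
      have "f 1 - f 0 = \<phi> (x + t *\<^sub>R a + t *\<^sub>R b) - \<phi> (x + t *\<^sub>R a) - (\<phi> (x + t *\<^sub>R b) - \<phi> x)"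
        by (simp add: f_def)
      with s show ?thesis by (intro bexI[of _ s]) simp_all
    qed
    have est: "\<bar>(G (x + (s * t) *\<^sub>R a + t *\<^sub>R b) - G (x + (s * t) *\<^sub>R a)) \<bullet> a - t * (H b \<bullet> a)\<bar> \<le> 2 * e * (t * N) * N"
      if s: "s \<in> {0<..<1}" and ab: "norm a + norm b < N" for s a b
    proof -
      have na: "norm a \<le> N" using ab norm_ge_zero[of b] by linarith
      have n1: "norm ((s * t) *\<^sub>R a + t *\<^sub>R b) \<le> t * N"
      proof -
        have "norm ((s * t) *\<^sub>R a + t *\<^sub>R b) \<le> s * t * norm a + t * norm b"
          using norm_triangle_ineq[of "(s * t) *\<^sub>R a" "t *\<^sub>R b"] s t by (auto simp: abs_mult)
        also have "\<dots> \<le> t * norm a + t * norm b"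
          using s t by (intro add_mono mult_right_mono) (auto simp: mult_left_le_one_le)
        also have "\<dots> \<le> t * N" using ab t by (simp flip: distrib_left)
        finally show ?thesis .
      qed
      have n2: "norm ((s * t) *\<^sub>R a) \<le> t * N"
      proof -
        have "s * norm a \<le> 1 * N" using s na by (intro mult_mono) auto
        then have "t * (s * norm a) \<le> t * N" using t by (intro mult_left_mono) auto
        then show ?thesis using s t by (simp add: abs_mult mult_ac)
      qed
      have e1: "norm (G (x + ((s * t) *\<^sub>R a + t *\<^sub>R b)) - G x - H ((s * t) *\<^sub>R a + t *\<^sub>R b)) \<le> e * (t * N)"
        by (rule d3[OF n1])
      have e2: "norm (G (x + (s * t) *\<^sub>R a) - G x - H ((s * t) *\<^sub>R a)) \<le> e * (t * N)"
        by (rule d3[OF n2])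
      have "(G (x + (s * t) *\<^sub>R a + t *\<^sub>R b) - G (x + (s * t) *\<^sub>R a)) \<bullet> a - t * (H b \<bullet> a)
        = ((G (x + ((s * t) *\<^sub>R a + t *\<^sub>R b)) - G x - H ((s * t) *\<^sub>R a + t *\<^sub>R b))
          - (G (x + (s * t) *\<^sub>R a) - G x - H ((s * t) *\<^sub>R a))) \<bullet> a"
        by (simp add: linH inner_diff_left inner_add_left add.assoc)
      also have "\<bar>\<dots>\<bar> \<le> norm ((G (x + ((s * t) *\<^sub>R a + t *\<^sub>R b)) - G x - H ((s * t) *\<^sub>R a + t *\<^sub>R b))
          - (G (x + (s * t) *\<^sub>R a) - G x - H ((s * t) *\<^sub>R a))) * norm a" by (rule Cauchy_Schwarz_ineq2)
      also have "\<dots> \<le> (e * (t * N) + e * (t * N)) * N"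
        using na N(1) \<open>e > 0\<close> t by (intro mult_mono order_trans[OF norm_triangle_ineq4] add_mono e1 e2) auto
      finally show ?thesis by (simp add: mult_ac)
    qed
    have vw: "norm v + norm w < N" "norm w + norm v < N" by (auto simp: N_def)
    obtain s1 where s1: "s1 \<in> {0<..<1}" "\<phi> (x + t *\<^sub>R w + t *\<^sub>R v) - \<phi> (x + t *\<^sub>R w) - (\<phi> (x + t *\<^sub>R v) - \<phi> x)
        = t * ((G (x + (s1 * t) *\<^sub>R w + t *\<^sub>R v) - G (x + (s1 * t) *\<^sub>R w)) \<bullet> w)" using step[OF vw(2)] by blast
    obtain s2 where s2: "s2 \<in> {0<..<1}" "\<phi> (x + t *\<^sub>R v + t *\<^sub>R w) - \<phi> (x + t *\<^sub>R v) - (\<phi> (x + t *\<^sub>R w) - \<phi> x)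
        = t * ((G (x + (s2 * t) *\<^sub>R v + t *\<^sub>R w) - G (x + (s2 * t) *\<^sub>R v)) \<bullet> v)" using step[OF vw(1)] by blast
    have eq: "x + t *\<^sub>R v + t *\<^sub>R w = x + t *\<^sub>R w + t *\<^sub>R v" by simp
    have "t * ((G (x + (s1 * t) *\<^sub>R w + t *\<^sub>R v) - G (x + (s1 * t) *\<^sub>R w)) \<bullet> w)
       = t * ((G (x + (s2 * t) *\<^sub>R v + t *\<^sub>R w) - G (x + (s2 * t) *\<^sub>R v)) \<bullet> v)"
      using s1(2) s2(2)[unfolded eq] by linarith
    then have "(G (x + (s1 * t) *\<^sub>R w + t *\<^sub>R v) - G (x + (s1 * t) *\<^sub>R w)) \<bullet> w
       = (G (x + (s2 * t) *\<^sub>R v + t *\<^sub>R w) - G (x + (s2 * t) *\<^sub>R v)) \<bullet> v" using t by simp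
    with est[OF s1(1) vw(2)] est[OF s2(1) vw(1)]
    have "t * (H v \<bullet> w) - t * (H w \<bullet> v) \<le> 4 * e * (t * N) * N" by linarith
    then have "t * (H v \<bullet> w - H w \<bullet> v) \<le> t * (e * (4 * N\<^sup>2))"
      by (simp add: right_diff_distrib power2_eq_square mult_ac)
    then show ?thesis using t by (simp add: N_def)
  qed
  have le: "H v \<bullet> w \<le> H w \<bullet> v" for v w
    using nonpos_if_le_small_multiples[of "H v \<bullet> w - H w \<bullet> v", OF main] by simp
  from le[of v w] le[of w v] show ?thesis by simp
qed

lemma C2_on_hessian_symmetric:
  assumes "C2_on U \<phi> G H" "open U" "x \<in> U"
  shows "symmetric_matrix (H x)"
proof (rule symmetric_matrixI)
  fix i j
  have "(H x *v axis i 1) \<bullet> axis j 1 = (H x *v axis j 1) \<bullet> axis i 1"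
    by (rule second_derivative_symmetric[of U x \<phi> G "(*v) (H x)"]) (use assms in \<open>auto simp: C2_on_def\<close>)
  then show "H x $ i $ j = H x $ j $ i"
    by (metis inner_commute quadform_axis)
qed

lemma C2_on_uminus:
  assumes "C2_on U \<phi> G H"
  shows "C2_on U (\<lambda>x. - \<phi> x) (\<lambda>x. - G x) (\<lambda>x. - H x)"
  unfolding C2_on_def
proof (intro conjI ballI)
  fix x assume "x \<in> U"
  then have d: "(\<phi> has_derivative (\<lambda>v. G x \<bullet> v)) (at x)" "(G has_derivative (\<lambda>v. H x *v v)) (at x)"
    using assms by (auto simp: C2_on_def)
  show "((\<lambda>x. - \<phi> x) has_derivative (\<lambda>v. - G x \<bullet> v)) (at x)"
    using has_derivative_minus[OF d(1)] by simp
  show "((\<lambda>x. - G x) has_derivative (\<lambda>v. - H x *v v)) (at x)"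
    using has_derivative_minus[OF d(2)] by (simp add: matrix_mult_arith)
qed (use assms in \<open>auto simp: C2_on_def intro!: continuous_intros\<close>)

lemma viscosity_supersolution_dual:
  assumes "viscosity_subsolution \<nu> r (dual_operator F) (\<lambda>x. - h x) (\<lambda>x. - u x)"
  shows "viscosity_supersolution \<nu> r F h u"
  unfolding viscosity_supersolution_def
proof (intro conjI allI impI ballI)
  fix x U \<phi> G H assume C: "C2_on U \<phi> G H" and t: "touches_from_below (closure (strip \<nu> r)) u \<phi> U x"
  have "touches_from_above (closure (strip \<nu> r)) (\<lambda>x. - u x) (\<lambda>x. - \<phi> x) U x"
    using t unfolding touches_from_above_def touches_from_below_def by (auto simp: algebra_simps)
  from assms[unfolded viscosity_subsolution_def, THEN conjunct1, rule_format, OF C2_on_uminus[OF C] this]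
  show "x \<in> strip \<nu> r \<Longrightarrow> F (H x) \<le> 0" "x \<in> hyperplane \<nu> 0 \<Longrightarrow> F (H x) \<le> 0 \<or> G x \<bullet> \<nu> \<le> h x"
    by (auto simp: dual_operator_def)
next
  fix x assume "x \<in> hyperplane \<nu> r"
  then show "0 \<le> u x" using assms unfolding viscosity_subsolution_def by force
qed

text \<open>
  At an interior point where \<open>\<phi>\<close> touches a linear function from above, the Hessian of \<open>\<phi>\<close> is positive
  semidefinite; at the lower boundary, moving in the direction \<open>\<nu>\<close> shows that its normal slope is at least \<open>c\<close>.
\<close>

lemma linear_viscosity_subsolution:
  assumes F: "elliptic_bound l K F" "F 0 = 0" and \<nu>: "norm \<nu> = 1"
  shows "viscosity_subsolution \<nu> 1 F (\<lambda>_. c) (\<lambda>x. c * (x \<bullet> \<nu> - 1))"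
  unfolding viscosity_subsolution_def
proof (intro conjI allI impI ballI)
  have \<nu>1: "\<nu> \<bullet> \<nu> = 1" using \<nu> by (simp add: dot_square_norm)
  fix x U \<phi> G H assume C: "C2_on U \<phi> G H" and t: "touches_from_above (closure (strip \<nu> 1)) (\<lambda>x. c * (x \<bullet> \<nu> - 1)) \<phi> U x"
  have U: "open U" "x \<in> U" and le: "\<And>y. y \<in> U \<Longrightarrow> y \<in> closed_strip \<nu> 1 \<Longrightarrow> c * (y \<bullet> \<nu>) - \<phi> y \<le> c * (x \<bullet> \<nu>) - \<phi> x"
    using t closure_strip[OF \<nu>, of 1] by (auto simp: touches_from_above_def right_diff_distrib)
  have d: "(\<phi> has_derivative (\<lambda>v. G y \<bullet> v)) (at y)" if "y \<in> U" for y using C that by (auto simp: C2_on_def)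
  have dG: "(G has_derivative (\<lambda>v. H x *v v)) (at x)" using C U by (auto simp: C2_on_def)
  show "0 \<le> F (H x)" if x: "x \<in> strip \<nu> 1"
  proof -
    have "open (strip \<nu> 1)"
    proof -
      have "strip \<nu> 1 = {X. 0 < X \<bullet> \<nu>} \<inter> {X. X \<bullet> \<nu> < 1}" by (auto simp: strip_def)
      moreover have "open ({X. 0 < X \<bullet> \<nu>} \<inter> {X. X \<bullet> \<nu> < 1})"
        by (intro open_Int open_Collect_less continuous_intros)
      ultimately show ?thesis by metis
    qed
    with U x have "open (U \<inter> strip \<nu> 1)" "x \<in> U \<inter> strip \<nu> 1" by auto
    then obtain r where r: "r > 0" "ball x r \<subseteq> U \<inter> strip \<nu> 1" using open_contains_ball by blast
    have inb: "c * (y \<bullet> \<nu>) - \<phi> y \<le> c * (x \<bullet> \<nu>) - \<phi> x" if "y \<in> ball x r" for y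
      using r(2) that by (intro le) (auto simp: strip_def closed_strip_def subset_iff)
    have Gx: "G x \<bullet> v = c * (v \<bullet> \<nu>)" for v
    proof -
      have "((\<lambda>y. c * (y \<bullet> \<nu>) - \<phi> y) has_derivative (\<lambda>v. c * (v \<bullet> \<nu>) - G x \<bullet> v)) (at x)"
        by (auto intro!: derivative_eq_intros d U)
      from differential_zero_maxmin[of x "ball x r", OF _ _ this] inb r(1)
      have "(\<lambda>v. c * (v \<bullet> \<nu>) - G x \<bullet> v) = (\<lambda>v. 0)" by auto
      from fun_cong[OF this, of v] show ?thesis by simp
    qed
    \<comment> \<open>Otherwise \<open>\<phi>\<close> minus the linear function would decrease strictly from \<open>x\<close> in the direction \<open>v\<close>.\<close>
    have psd: "0 \<le> v \<bullet> (H x *v v)" for v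
    proof (rule ccontr)
      assume neg: "\<not> 0 \<le> v \<bullet> (H x *v v)"
      define b where "b = - (v \<bullet> (H x *v v))"
      have b: "b > 0" using neg by (simp add: b_def)
      have v: "v \<noteq> 0" using neg by auto
      define e where "e = b / (2 * (norm v)\<^sup>2)"
      have e: "e > 0" "e * (norm v)\<^sup>2 = b / 2" using b v by (auto simp: e_def)
      obtain d' where d': "d' > 0" "\<And>y. norm (y - x) < d' \<Longrightarrow> norm (G y - G x - H x *v (y - x)) \<le> e * norm (y - x)"
        using dG e(1) unfolding has_derivative_at_alt by blast
      define s where "s = min d' r / (2 * norm v)"
      have s: "s > 0" using d' r v by (simp add: s_def)
      have sn: "s * norm v < d'" "s * norm v < r" using d' r v by (auto simp: s_def min_def)
      have tn: "norm (t *\<^sub>R v) < d'" "norm (t *\<^sub>R v) < r" if "0 \<le> t" "t \<le> s" for t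
        using mult_right_mono[OF that(2) norm_ge_zero[of v]] sn that by auto
      define f where "f t = \<phi> (x + t *\<^sub>R v) - c * ((x + t *\<^sub>R v) \<bullet> \<nu>)" for t
      have "(f has_derivative (\<lambda>h. h * ((G (x + t *\<^sub>R v) - G x) \<bullet> v))) (at t within {0..s})" if t: "t \<in> {0..s}" for t
      proof -
        have "x + t *\<^sub>R v \<in> U" using tn(2)[of t] t r(2) by (auto simp: dist_norm subset_iff)
        have "((\<lambda>t. x + t *\<^sub>R v) has_derivative (\<lambda>h. h *\<^sub>R v)) (at t within {0..s})"
          by (auto intro!: derivative_eq_intros)
        from has_derivative_compose[OF this d[OF \<open>x + t *\<^sub>R v \<in> U\<close>]]
        have "((\<lambda>t. \<phi> (x + t *\<^sub>R v)) has_derivative (\<lambda>h. G (x + t *\<^sub>R v) \<bullet> (h *\<^sub>R v))) (at t within {0..s})" .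
        then have "(f has_derivative (\<lambda>h. G (x + t *\<^sub>R v) \<bullet> (h *\<^sub>R v) - c * ((h *\<^sub>R v) \<bullet> \<nu>))) (at t within {0..s})"
          unfolding f_def by (auto intro!: derivative_eq_intros)
        moreover have "G (x + t *\<^sub>R v) \<bullet> (h *\<^sub>R v) - c * ((h *\<^sub>R v) \<bullet> \<nu>) = h * ((G (x + t *\<^sub>R v) - G x) \<bullet> v)" for h
          by (simp add: inner_diff_left Gx algebra_simps)
        ultimately show ?thesis by simp
      qed
      then obtain t where t: "t \<in> {0<..<s}" "f s - f 0 = (s - 0) * ((G (x + t *\<^sub>R v) - G x) \<bullet> v)"
        using mvt_simple[of 0 s f "\<lambda>t h. h * ((G (x + t *\<^sub>R v) - G x) \<bullet> v)"] s by auto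
      have "norm (G (x + t *\<^sub>R v) - G x - H x *v (t *\<^sub>R v)) \<le> e * norm (t *\<^sub>R v)"
        using d'(2)[of "x + t *\<^sub>R v"] tn(1)[of t] t by simp
      then have "(G (x + t *\<^sub>R v) - G x - H x *v (t *\<^sub>R v)) \<bullet> v \<le> e * norm (t *\<^sub>R v) * norm v"
        using norm_cauchy_schwarz[of "G (x + t *\<^sub>R v) - G x - H x *v (t *\<^sub>R v)" v]
        by (meson mult_right_mono norm_ge_zero order_trans)
      also have "\<dots> = t * (b / 2)" using t by (simp add: e(2)[symmetric] power2_eq_square)
      finally have "(G (x + t *\<^sub>R v) - G x) \<bullet> v \<le> t * (b / 2) - t * b"
      proof -
        have "(H x *v (t *\<^sub>R v)) \<bullet> v = - (t * b)"
          by (simp add: matrix_vector_mult_scaleR b_def inner_commute)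
        moreover assume "(G (x + t *\<^sub>R v) - G x - H x *v (t *\<^sub>R v)) \<bullet> v \<le> t * (b / 2)"
        ultimately show ?thesis
          unfolding inner_diff_left[of "G (x + t *\<^sub>R v) - G x" "H x *v (t *\<^sub>R v)"] by linarith
      qed
      also have "\<dots> < 0" using t b by (simp add: field_simps)
      finally have "(s - 0) * ((G (x + t *\<^sub>R v) - G x) \<bullet> v) < 0" using s by (simp add: mult_pos_neg)
      then have "f s < f 0" using t(2) by linarith
      moreover have "f 0 \<le> f s" using inb[of "x + s *\<^sub>R v"] tn(2)[of s] s by (simp add: f_def dist_norm)
      ultimately show False by simp
    qed
    have H: "symmetric_matrix (H x)" by (rule C2_on_hessian_symmetric[OF C U])
    have "F 0 - F (H x) \<le> 0 * K + l * (\<nu> \<bullet> ((0 - H x) *v \<nu>))"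
      by (rule elliptic_boundD[OF F(1) symmetric_matrix_arith(7) H _ \<nu>]) (use psd in \<open>simp_all add: matrix_mult_arith\<close>)
    moreover have "l * (\<nu> \<bullet> ((0 - H x) *v \<nu>)) \<le> 0"
      using psd[of \<nu>] F(1) by (simp add: matrix_mult_arith elliptic_bound_def)
    ultimately show ?thesis using F(2) by simp
  qed
  show "0 \<le> F (H x) \<or> c \<le> G x \<bullet> \<nu>" if x: "x \<in> hyperplane \<nu> 0"
  proof -
    have "c \<le> G x \<bullet> \<nu> + e" if e: "e > 0" for e
    proof -
      obtain d' where d': "d' > 0" "\<And>y. norm (y - x) < d' \<Longrightarrow> norm (\<phi> y - \<phi> x - G x \<bullet> (y - x)) \<le> e * norm (y - x)"
        using d[OF U(2)] e unfolding has_derivative_at_alt by blast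
      obtain r where r: "r > 0" "ball x r \<subseteq> U" using U open_contains_ball by blast
      define s where "s = min (min d' r) 1 / 2"
      have s: "0 < s" "s < d'" "s < r" "s \<le> 1" using d' r by (auto simp: s_def)
      have "x + s *\<^sub>R \<nu> \<in> U" using r(2) s \<nu> by (auto simp: subset_iff dist_norm)
      moreover have "x + s *\<^sub>R \<nu> \<in> closed_strip \<nu> 1"
        using x s by (simp add: closed_strip_def hyperplane_def inner_add_left \<nu>1)
      ultimately have "c * s \<le> \<phi> (x + s *\<^sub>R \<nu>) - \<phi> x"
        using le[of "x + s *\<^sub>R \<nu>"] by (simp add: inner_add_left \<nu>1 distrib_left)
      also have "\<dots> \<le> s * (G x \<bullet> \<nu>) + e * s"
        using d'(2)[of "x + s *\<^sub>R \<nu>"] s \<nu> by (simp add: abs_le_iff)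
      finally have "s * c \<le> s * (G x \<bullet> \<nu> + e)" by (simp add: algebra_simps)
      then show ?thesis using s by simp
    qed
    then show ?thesis using field_le_epsilon by blast
  qed
qed (simp add: hyperplane_def)

lemma linear_bounded_viscosity_solution:
  assumes F: "elliptic_bound l K F" "F 0 = 0" and \<nu>: "norm \<nu> = 1"
  shows "bounded_viscosity_solution \<nu> 1 F (\<lambda>_. c) (\<lambda>x. c * (x \<bullet> \<nu> - 1))"
  unfolding bounded_viscosity_solution_def
proof (intro conjI)
  show "continuous_on (closure (strip \<nu> 1)) (\<lambda>x. c * (x \<bullet> \<nu> - 1))" by (intro continuous_intros)
  have "\<bar>c * (x \<bullet> \<nu> - 1)\<bar> \<le> \<bar>c\<bar> * 1" if "x \<in> closed_strip \<nu> 1" for x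
    unfolding abs_mult using that by (intro mult_left_mono) (auto simp: closed_strip_def)
  then show "bounded ((\<lambda>x. c * (x \<bullet> \<nu> - 1)) ` closure (strip \<nu> 1))"
    unfolding closure_strip[OF \<nu> zero_less_one] bounded_iff by (intro exI[of _ "\<bar>c\<bar> * 1"]) auto
  show "viscosity_subsolution \<nu> 1 F (\<lambda>_. c) (\<lambda>x. c * (x \<bullet> \<nu> - 1))"
    by (rule linear_viscosity_subsolution[OF F \<nu>])
  show "viscosity_supersolution \<nu> 1 F (\<lambda>_. c) (\<lambda>x. c * (x \<bullet> \<nu> - 1))"
  proof (rule viscosity_supersolution_dual)
    have "dual_operator F 0 = 0" using F(2) by (simp add: dual_operator_def)
    from linear_viscosity_subsolution[OF elliptic_bound_dual[OF F(1)] this \<nu>, of "- c"]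
    show "viscosity_subsolution \<nu> 1 (dual_operator F) (\<lambda>x. - c) (\<lambda>x. - (c * (x \<bullet> \<nu> - 1)))" by simp
  qed
qed

lemma bounded_viscosity_solution_jets:
  assumes \<nu>: "norm \<nu> = 1" and u: "bounded_viscosity_solution \<nu> 1 F h u"
  shows "continuous_on (closed_strip \<nu> 1) u" "\<exists>M. \<forall>x\<in>closed_strip \<nu> 1. \<bar>u x\<bar> \<le> M"
    "jet_subsolution \<nu> 1 F h u" "jet_subsolution \<nu> 1 (dual_operator F) (\<lambda>x. - h x) (\<lambda>x. - u x)"
    "\<And>x. x \<bullet> \<nu> = 1 \<Longrightarrow> u x = 0"
proof -
  note cs = closure_strip[OF \<nu> zero_less_one]
  show "continuous_on (closed_strip \<nu> 1) u" "\<exists>M. \<forall>x\<in>closed_strip \<nu> 1. \<bar>u x\<bar> \<le> M"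
    using u unfolding bounded_viscosity_solution_def cs bounded_iff by auto
  show "jet_subsolution \<nu> 1 F h u" "jet_subsolution \<nu> 1 (dual_operator F) (\<lambda>x. - h x) (\<lambda>x. - u x)"
    using u viscosity_subsolution_imp_jet[OF \<nu> zero_less_one] viscosity_supersolution_imp_jet[OF \<nu> zero_less_one]
    unfolding bounded_viscosity_solution_def by blast+
  show "u x = 0" if "x \<bullet> \<nu> = 1" for x
    using u that unfolding bounded_viscosity_solution_def viscosity_subsolution_def viscosity_supersolution_def hyperplane_def
    by (intro antisym) auto
qed

text \<open>
  Linear barriers with slopes \<open>c - e\<close> and \<open>c + e\<close>, which are strictly on the right side of the Neumann
  data, enclose every solution.
\<close>

lemma constant_data_solution_unique:
  assumes F: "elliptic_bound l K F" "F 0 = 0" and \<nu>: "norm \<nu> = 1"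
    and v: "bounded_viscosity_solution \<nu> 1 F (\<lambda>_. c) v" and x: "x \<in> closed_strip \<nu> 1"
  shows "v x = c * (x \<bullet> \<nu> - 1)"
proof -
  have upper: "w x \<le> b * (x \<bullet> \<nu> - 1)"
    if F': "elliptic_bound l K F'" "F' 0 = 0" and w: "continuous_on (closed_strip \<nu> 1) w" "\<And>x. x \<in> closed_strip \<nu> 1 \<Longrightarrow> w x \<le> M"
      "jet_subsolution \<nu> 1 F' (\<lambda>_. b) w" "\<And>x. x \<bullet> \<nu> = 1 \<Longrightarrow> w x \<le> 0" for F' b w M
  proof (rule field_le_epsilon)
    fix e :: real assume e: "e > 0"
    have "w x \<le> (e - b) + (b - e) * (x \<bullet> \<nu>)"
      by (rule linear_barrier[OF F' \<nu> zero_less_one w(1,2) w(3)]) (use w(4) e x in auto)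
    also have "\<dots> = b * (x \<bullet> \<nu> - 1) + e * (1 - x \<bullet> \<nu>)" by (simp add: algebra_simps)
    also have "e * (1 - x \<bullet> \<nu>) \<le> e * 1" using e x by (intro mult_left_mono) (auto simp: closed_strip_def)
    finally show "w x \<le> b * (x \<bullet> \<nu> - 1) + e" by simp
  qed
  note j = bounded_viscosity_solution_jets[OF \<nu> v]
  obtain M where M: "\<And>x. x \<in> closed_strip \<nu> 1 \<Longrightarrow> \<bar>v x\<bar> \<le> M" using j(2) by blast
  have "v x \<le> c * (x \<bullet> \<nu> - 1)"
    by (rule upper[OF F j(1) _ j(3)]) (use M j(5) in \<open>auto simp: abs_le_iff\<close>)
  moreover have "- v x \<le> - c * (x \<bullet> \<nu> - 1)"
    by (rule upper[OF elliptic_bound_dual[OF F(1)] _ _ _ j(4)])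
      (use M j(5) F(2) in \<open>auto simp: abs_le_iff dual_operator_def intro!: continuous_intros j(1)\<close>)
  ultimately show ?thesis by simp
qed

lemma positively_homogeneous_zero: "positively_homogeneous F \<Longrightarrow> F 0 = 0"
  unfolding positively_homogeneous_def using symmetric_matrix_arith(7) by (metis mult_zero_left order_refl scaleR_zero_left)

lemma positively_homogeneous_dual: "positively_homogeneous F \<Longrightarrow> positively_homogeneous (dual_operator F)"
  unfolding positively_homogeneous_def dual_operator_def
  using symmetric_matrix_arith(3) by (metis mult_minus_right scaleR_minus_right)

section \<open>Homogenization\<close>

text \<open>
  A linear barrier that controls \<open>w\<close> on the lower boundary by its values there, not by its slope.
\<close>

lemma profile_upper_bound:
  assumes F: "elliptic_bound l K F" "F 0 = 0" and \<nu>: "norm \<nu> = 1"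
    and w: "continuous_on (closed_strip \<nu> 1) w" "\<And>x. x \<in> closed_strip \<nu> 1 \<Longrightarrow> w x \<le> M"
      "jet_subsolution \<nu> 1 F h w" "\<And>x. x \<bullet> \<nu> = 1 \<Longrightarrow> w x \<le> 0"
    and a: "\<And>x. x \<bullet> \<nu> = 0 \<Longrightarrow> w x \<le> a" and x: "x \<in> closed_strip \<nu> 1"
  shows "w x \<le> a * (1 - x \<bullet> \<nu>)"
proof -
  have "w x \<le> a + (- a) * (x \<bullet> \<nu>)"
    by (rule linear_barrier[OF F \<nu> zero_less_one w(1,2) w(3) _ _ x]) (use w(4) a in auto)
  then show ?thesis by (simp add: algebra_simps)
qed

text \<open>
  Let \<open>T\<close> be the supremum of \<open>w\<close> on the lower boundary. By homogeneity \<open>w (s x) / s\<close> solves the problem with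
  the Neumann data of \<open>v\<close>, and at the top it is at most \<open>T (1 - s) / s\<close> by the profile bound. Comparison
  with \<open>v\<close> on the lower boundary gives \<open>T \<le> (1 - s) T + s b\<close>, that is \<open>T \<le> b\<close>.
\<close>

lemma sup_boundary_value_monotone:
  fixes \<nu> :: "real ^ 'n"
  assumes F: "elliptic_bound l K F" and hom: "positively_homogeneous F" and \<nu>: "norm \<nu> = 1" and s: "0 < s" "s \<le> 1"
    and w: "continuous_on (closed_strip \<nu> 1) w" "\<And>x. x \<in> closed_strip \<nu> 1 \<Longrightarrow> \<bar>w x\<bar> \<le> M"
      "jet_subsolution \<nu> 1 F h' w" "\<And>x. x \<bullet> \<nu> = 1 \<Longrightarrow> w x = 0"
    and v: "continuous_on (closed_strip \<nu> 1) v" "\<And>x. x \<in> closed_strip \<nu> 1 \<Longrightarrow> \<bar>v x\<bar> \<le> M"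
      "jet_subsolution \<nu> 1 (dual_operator F) (\<lambda>x. - h x) (\<lambda>x. - v x)" "\<And>x. x \<bullet> \<nu> = 1 \<Longrightarrow> v x = 0"
    and h: "continuous_on (hyperplane \<nu> 0) h" "\<And>x. x \<bullet> \<nu> = 0 \<Longrightarrow> h' (s *\<^sub>R x) = h x"
    and b: "\<And>x. x \<bullet> \<nu> = 0 \<Longrightarrow> v x \<le> b" and y: "y \<bullet> \<nu> = 0"
  shows "w y \<le> b"
proof -
  define T where "T = (SUP x\<in>hyperplane \<nu> 0. w x)"
  have H_strip: "x \<in> closed_strip \<nu> 1" if "x \<in> hyperplane \<nu> 0" for x
    using that by (simp add: closed_strip_def hyperplane_def)
  have bdd: "bdd_above (w ` hyperplane \<nu> 0)"
    by (rule bdd_aboveI2[of _ _ M]) (use w(2) H_strip in \<open>auto simp: abs_le_iff\<close>)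
  have T: "w x \<le> T" if "x \<bullet> \<nu> = 0" for x
    unfolding T_def by (rule cSUP_upper[OF _ bdd]) (simp add: hyperplane_def that)
  have prof: "w x \<le> T * (1 - x \<bullet> \<nu>)" if "x \<in> closed_strip \<nu> 1" for x
    by (rule profile_upper_bound[OF F positively_homogeneous_zero[OF hom] \<nu> w(1) _ w(3) _ T that])
      (use w(2,4) in \<open>auto simp: abs_le_iff\<close>)
  have sc: "s *\<^sub>R x \<in> closed_strip \<nu> 1" if "x \<in> closed_strip \<nu> 1" for x
    using that s mult_le_one[of s "x \<bullet> \<nu>"] by (auto simp: closed_strip_def)
  have "w x \<le> (1 - s) * T + s * b" if x: "x \<in> hyperplane \<nu> 0" for x
  proof -
    define z where "z = x /\<^sub>R s"
    have xz: "x = s *\<^sub>R z" and z0: "z \<bullet> \<nu> = 0" using s x by (auto simp: z_def hyperplane_def)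
    have zS: "z \<in> closed_strip \<nu> 1" using z0 by (simp add: closed_strip_def)
    have "w (s *\<^sub>R z) / s + - v z \<le> (T * (1 - s)) / s + 0 * 1"
    proof (rule strip_comparison[OF F \<nu> zero_less_one _ v(3) _ _ _ _ _ _ _ _ zS, where M = "M / s + M"])
      show "jet_subsolution \<nu> 1 F (\<lambda>x. h' (s *\<^sub>R x)) (\<lambda>x. w (s *\<^sub>R x) / s)"
        by (rule jet_subsolution_mono_strip[OF jet_subsolution_scale[OF w(3) hom s(1)]]) (use s in simp)
      show "continuous_on (closed_strip \<nu> 1) (\<lambda>x. w (s *\<^sub>R x) / s)"
        using s sc by (intro continuous_intros continuous_on_compose2[OF w(1)]) auto
      show "continuous_on (closed_strip \<nu> 1) (\<lambda>x. - v x)" by (intro continuous_intros v(1))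
      show "w (s *\<^sub>R x) / s + - v x \<le> M / s + M" if "x \<in> closed_strip \<nu> 1" for x
      proof -
        have "w (s *\<^sub>R x) / s \<le> M / s" using w(2)[OF sc[OF that]] s by (intro divide_right_mono) auto
        moreover have "- v x \<le> M" using v(2)[OF that] by linarith
        ultimately show ?thesis by linarith
      qed
      show "continuous_on (hyperplane \<nu> 0) (\<lambda>x. - h x)" by (intro continuous_intros h(1))
      show "continuous_on (hyperplane \<nu> 0) (\<lambda>x. h' (s *\<^sub>R x))"
        by (rule continuous_on_eq[OF h(1)]) (simp add: h(2) hyperplane_def)
      show "- h' (s *\<^sub>R x) - - h x \<le> 0" if "x \<bullet> \<nu> = 0" for x using h(2)[OF that] by simp
      show "w (s *\<^sub>R x) / s + - v x \<le> (T * (1 - s)) / s" if "x \<bullet> \<nu> = 1" for x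
      proof -
        have "w (s *\<^sub>R x) \<le> T * (1 - s)" using prof[OF sc[of x]] that by (simp add: closed_strip_def)
        then show ?thesis using v(4)[OF that] s by (simp add: divide_right_mono)
      qed
    qed simp
    then have "w x / s \<le> T * (1 - s) / s + b" using b[OF z0] by (simp add: xz)
    then have "s * (w x / s) \<le> s * (T * (1 - s) / s + b)" using s by (intro mult_left_mono) auto
    then show ?thesis using s by (simp add: distrib_left mult.commute)
  qed
  then have "T \<le> (1 - s) * T + s * b"
    unfolding T_def by (intro cSUP_least) (use y in \<open>auto simp: hyperplane_def\<close>)
  then have "s * T \<le> s * b" by (simp add: algebra_simps)
  then have "T \<le> b" using s by simp
  with T[OF y] show ?thesis by linarith
qed
lemma hoelder_space_continuous_on:
  assumes g: "g \<in> hoelder_space \<gamma> S" and \<gamma>: "0 < \<gamma>"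
  shows "continuous_on S g"
proof -
  obtain C where C: "\<And>x y. x \<in> S \<Longrightarrow> y \<in> S \<Longrightarrow> \<bar>g x - g y\<bar> \<le> C * dist x y powr \<gamma>"
    using g unfolding hoelder_space_def by blast
  show ?thesis
    unfolding continuous_on_def
  proof
    fix x assume x: "x \<in> S"
    have "((\<lambda>y. dist y x) \<longlongrightarrow> dist x x) (at x within S)" by (intro tendsto_intros)
    then have "((\<lambda>y. C * dist y x powr \<gamma>) \<longlongrightarrow> C * dist x x powr \<gamma>) (at x within S)"
      using \<gamma> by (intro tendsto_mult_left tendsto_powr') auto
    then have lim: "((\<lambda>y. C * dist y x powr \<gamma>) \<longlongrightarrow> 0) (at x within S)" using \<gamma> by simp
    have "((\<lambda>y. g y - g x) \<longlongrightarrow> 0) (at x within S)"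
      by (rule Lim_null_comparison[OF _ lim])
        (use C x in \<open>auto simp: eventually_at_topological\<close>)
    then show "(g \<longlongrightarrow> g x) (at x within S)" by (rule LIM_zero_cancel)
  qed
qed

text \<open>
  The barriers have the slopes \<open>\<plusminus> A\<close>, which the Neumann data do not reach.
\<close>

lemma bounded_viscosity_solution_bound:
  assumes F: "elliptic_bound l K F" "F 0 = 0" and \<nu>: "norm \<nu> = 1"
    and u: "bounded_viscosity_solution \<nu> 1 F h u" and h: "\<And>x. x \<bullet> \<nu> = 0 \<Longrightarrow> \<bar>h x\<bar> < A"
    and x: "x \<in> closed_strip \<nu> 1"
  shows "\<bar>u x\<bar> \<le> A * (1 - x \<bullet> \<nu>)"
proof -
  note j = bounded_viscosity_solution_jets[OF \<nu> u]
  obtain M where M: "\<And>x. x \<in> closed_strip \<nu> 1 \<Longrightarrow> \<bar>u x\<bar> \<le> M" using j(2) by blast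
  have "u x \<le> A + (- A) * (x \<bullet> \<nu>)"
    by (rule linear_barrier[OF F \<nu> zero_less_one j(1) _ j(3) _ _ x, of M])
      (use M j(5) h in \<open>fastforce simp: abs_le_iff abs_less_iff\<close>)+
  moreover have "- u x \<le> A + (- A) * (x \<bullet> \<nu>)"
    by (rule linear_barrier[OF elliptic_bound_dual[OF F(1)] _ \<nu> zero_less_one continuous_on_minus[OF j(1)] _ j(4) _ _ x, of M])
      (use M j(5) h F(2) in \<open>fastforce simp: abs_le_iff abs_less_iff dual_operator_def\<close>)+
  ultimately show ?thesis by (auto simp: abs_le_iff algebra_simps)
qed

text \<open>
  Let \<open>\<tau>\<close> be an almost period of \<open>g\<close> within distance \<open>R\<close> of \<open>(y - x) / \<epsilon>\<close>. The solution and its translate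
  by \<open>\<epsilon> \<tau>\<close> have almost the same Neumann data, so comparison bounds the change from \<open>x\<close> to \<open>x + \<epsilon> \<tau>\<close>. The
  latter point is within \<open>\<epsilon> R\<close> of \<open>y\<close>, and the modulus of continuity along the boundary, which does not
  depend on \<open>\<epsilon>\<close>, bounds the rest.
\<close>

lemma boundary_oscillation_vanishes:
  fixes \<nu> :: "real ^ 'n"
  assumes F: "elliptic_bound l K F" "F 0 = 0" and \<nu>: "norm \<nu> = 1"
    and g: "continuous_on (hyperplane \<nu> 0) g" "\<And>x. x \<bullet> \<nu> = 0 \<Longrightarrow> \<bar>g x\<bar> < A" "almost_periodic_on (hyperplane \<nu> 0) g"
    and u: "\<And>\<epsilon>. \<epsilon> > 0 \<Longrightarrow> bounded_viscosity_solution \<nu> 1 F (\<lambda>x. g (x /\<^sub>R \<epsilon>)) (u \<epsilon>)"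
    and \<theta>: "\<theta> > 0"
  obtains \<epsilon>0 where "\<epsilon>0 > 0"
    "\<And>\<epsilon> x y. 0 < \<epsilon> \<Longrightarrow> \<epsilon> \<le> \<epsilon>0 \<Longrightarrow> x \<bullet> \<nu> = 0 \<Longrightarrow> y \<bullet> \<nu> = 0 \<Longrightarrow> u \<epsilon> x - u \<epsilon> y \<le> \<theta>"
proof -
  have A: "A > 0" using g(2)[of 0] by simp
  obtain r0 where r0: "r0 > 0"
    "\<And>h w x y. continuous_on (hyperplane \<nu> 0) h \<Longrightarrow> (\<And>x. x \<bullet> \<nu> = 0 \<Longrightarrow> \<bar>h x\<bar> < A) \<Longrightarrow>
       continuous_on (closed_strip \<nu> 1) w \<Longrightarrow> (\<And>x. x \<in> closed_strip \<nu> 1 \<Longrightarrow> \<bar>w x\<bar> \<le> A * (1 - x \<bullet> \<nu>)) \<Longrightarrow>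
       jet_subsolution \<nu> 1 F h w \<Longrightarrow> jet_subsolution \<nu> 1 (dual_operator F) (\<lambda>x. - h x) (\<lambda>x. - w x) \<Longrightarrow>
       x \<bullet> \<nu> = 0 \<Longrightarrow> y \<bullet> \<nu> = 0 \<Longrightarrow> norm (x - y) \<le> r0 \<Longrightarrow> w x - w y \<le> \<theta> / 2"
    using tangential_equicontinuity[OF F(1) \<nu> A, of "\<theta> / 2"] \<theta> by (metis half_gt_zero)
  have "subspace (hyperplane \<nu> 0)" by (auto simp: subspace_def hyperplane_def inner_add_left)
  from almost_periods_relatively_dense[OF this g(3), of "\<theta> / 2"] \<theta>
  obtain R where R: "R \<ge> 0" "\<And>z. z \<in> hyperplane \<nu> 0 \<Longrightarrow>
      \<exists>\<tau>\<in>hyperplane \<nu> 0. norm (\<tau> - z) \<le> R \<and> (\<forall>x\<in>hyperplane \<nu> 0. \<bar>g (x + \<tau>) - g x\<bar> \<le> \<theta> / 2)"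
    by (metis half_gt_zero)
  show thesis
  proof (rule that)
    show "r0 / (R + 1) > 0" using r0(1) R(1) by simp
    fix \<epsilon> x y assume \<epsilon>: "0 < \<epsilon>" "\<epsilon> \<le> r0 / (R + 1)" and x: "x \<bullet> \<nu> = 0" and y: "y \<bullet> \<nu> = 0"
    define h where "h = (\<lambda>x. g (x /\<^sub>R \<epsilon>))"
    have uh: "bounded_viscosity_solution \<nu> 1 F h (u \<epsilon>)" unfolding h_def by (rule u[OF \<epsilon>(1)])
    note j = bounded_viscosity_solution_jets[OF \<nu> uh]
    have hA: "\<bar>h z\<bar> < A" if "z \<bullet> \<nu> = 0" for z unfolding h_def using that by (intro g(2)) simp
    have h_cont: "continuous_on (hyperplane \<nu> 0) h"
      unfolding h_def by (rule continuous_on_compose2[OF g(1)]) (auto intro!: continuous_intros simp: hyperplane_def)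
    note bound = bounded_viscosity_solution_bound[OF F \<nu> uh hA]
    have boundA: "\<bar>u \<epsilon> z\<bar> \<le> A" if "z \<in> closed_strip \<nu> 1" for z
    proof -
      have "A * (1 - z \<bullet> \<nu>) \<le> A * 1" using that A by (intro mult_left_mono) (auto simp: closed_strip_def)
      with bound[OF _ that] show ?thesis by simp
    qed
    have "(y - x) /\<^sub>R \<epsilon> \<in> hyperplane \<nu> 0" using x y by (simp add: hyperplane_def inner_diff_left)
    then obtain \<tau> where \<tau>: "\<tau> \<bullet> \<nu> = 0" "norm (\<tau> - (y - x) /\<^sub>R \<epsilon>) \<le> R"
      "\<And>z. z \<bullet> \<nu> = 0 \<Longrightarrow> \<bar>g (z + \<tau>) - g z\<bar> \<le> \<theta> / 2"
      using R(2) unfolding hyperplane_def by blast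
    have shift: "z + \<epsilon> *\<^sub>R \<tau> \<in> closed_strip \<nu> 1" if "z \<in> closed_strip \<nu> 1" for z
      using that \<tau>(1) by (simp add: closed_strip_def inner_add_left)
    have h_shift: "h (z + \<epsilon> *\<^sub>R \<tau>) = g (z /\<^sub>R \<epsilon> + \<tau>)" for z
      using \<epsilon>(1) by (simp add: h_def scaleR_add_right)
    have "u \<epsilon> x + - u \<epsilon> (x + \<epsilon> *\<^sub>R \<tau>) \<le> 0 + \<theta> / 2 * 1"
    proof (rule strip_comparison[OF F(1) \<nu> zero_less_one j(3), where M = "A + A"])
      show "jet_subsolution \<nu> 1 (dual_operator F) (\<lambda>z. - h (z + \<epsilon> *\<^sub>R \<tau>)) (\<lambda>z. - u \<epsilon> (z + \<epsilon> *\<^sub>R \<tau>))"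
        by (rule jet_subsolution_translate[OF j(4)]) (simp add: \<tau>(1))
      show "continuous_on (closed_strip \<nu> 1) (\<lambda>z. - u \<epsilon> (z + \<epsilon> *\<^sub>R \<tau>))"
        using shift by (intro continuous_intros continuous_on_compose2[OF j(1)]) auto
      show "u \<epsilon> z + - u \<epsilon> (z + \<epsilon> *\<^sub>R \<tau>) \<le> A + A" if "z \<in> closed_strip \<nu> 1" for z
        using boundA[OF that] boundA[OF shift[OF that]] by linarith
      show "continuous_on (hyperplane \<nu> 0) (\<lambda>z. - h (z + \<epsilon> *\<^sub>R \<tau>))"
        using \<tau>(1) by (intro continuous_intros continuous_on_compose2[OF h_cont]) (auto simp: hyperplane_def inner_add_left)
      show "- h z - - h (z + \<epsilon> *\<^sub>R \<tau>) \<le> \<theta> / 2" if "z \<bullet> \<nu> = 0" for z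
        using abs_le_D1[OF \<tau>(3)[of "z /\<^sub>R \<epsilon>"]] that unfolding h_shift by (simp add: h_def)
      show "u \<epsilon> z + - u \<epsilon> (z + \<epsilon> *\<^sub>R \<tau>) \<le> 0" if "z \<bullet> \<nu> = 1" for z
        using j(5)[of z] j(5)[of "z + \<epsilon> *\<^sub>R \<tau>"] that \<tau>(1) by (simp add: inner_add_left)
    qed (use j(1) h_cont \<theta> x in \<open>auto simp: closed_strip_def\<close>)
    moreover have "u \<epsilon> (x + \<epsilon> *\<^sub>R \<tau>) - u \<epsilon> y \<le> \<theta> / 2"
    proof (rule r0(2)[OF h_cont hA j(1) bound j(3,4)])
      have "x + \<epsilon> *\<^sub>R \<tau> - y = \<epsilon> *\<^sub>R (\<tau> - (y - x) /\<^sub>R \<epsilon>)" using \<epsilon>(1) by (simp add: algebra_simps)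
      then have "norm (x + \<epsilon> *\<^sub>R \<tau> - y) \<le> \<epsilon> * R" using \<tau>(2) \<epsilon>(1) by (simp add: mult_left_mono)
      also have "\<dots> \<le> \<epsilon> * (R + 1)" using \<epsilon>(1) by simp
      also have "\<dots> \<le> r0" using \<epsilon>(2) R(1) by (simp add: le_divide_eq)
      finally show "norm (x + \<epsilon> *\<^sub>R \<tau> - y) \<le> r0" .
    qed (use x y \<tau>(1) in \<open>auto simp: inner_add_left\<close>)
    ultimately show "u \<epsilon> x - u \<epsilon> y \<le> \<theta>" by linarith
  qed
qed

theorem theorem1p1:
  fixes \<nu> :: "real ^ 'n"
    and F :: "real ^ 'n ^ 'n \<Rightarrow> real"
    and g :: "real ^ 'n \<Rightarrow> real"
    and \<gamma> :: real
    and u :: "real \<Rightarrow> real ^ 'n \<Rightarrow> real"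
  assumes "CARD('n) \<ge> 2"
    and "norm \<nu> = 1"
    and "uniformly_elliptic F"
    and "positively_homogeneous F"
    and "0 < \<gamma>" and "\<gamma> < 1"
    and "g \<in> hoelder_space \<gamma> (hyperplane \<nu> 0)"
    and "almost_periodic_on (hyperplane \<nu> 0) g"
    and "\<And>\<epsilon>. \<epsilon> > 0 \<Longrightarrow> bounded_viscosity_solution \<nu> 1 F (\<lambda>x. g (x /\<^sub>R \<epsilon>)) (u \<epsilon>)"
  shows "\<exists>!gbar :: real. \<exists>ubar :: real ^ 'n \<Rightarrow> real.
           bounded_viscosity_solution \<nu> 1 F (\<lambda>_. gbar) ubar \<and>
           (\<forall>v. bounded_viscosity_solution \<nu> 1 F (\<lambda>_. gbar) v \<longrightarrow>
                (\<forall>x\<in>closure (strip \<nu> 1). v x = ubar x)) \<and>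
           uniform_limit (closure (strip \<nu> 1)) u ubar (at_right 0)"
proof -
  let ?H = "hyperplane \<nu> 0"
  note \<nu> = assms(2) and hom = assms(4) and u = assms(9)
  obtain l K where F: "elliptic_bound l K F" by (rule uniformly_elliptic_imp_elliptic_bound[OF assms(3)])
  note F0 = positively_homogeneous_zero[OF hom]
  note F' = elliptic_bound_dual[OF F] and hom' = positively_homogeneous_dual[OF hom]
  have F0': "dual_operator F 0 = 0" by (rule positively_homogeneous_zero[OF hom'])
  have g_cont: "continuous_on ?H g" by (rule hoelder_space_continuous_on[OF assms(7,5)])
  obtain C where "\<And>x. x \<in> ?H \<Longrightarrow> \<bar>g x\<bar> \<le> C"
    using assms(7) unfolding hoelder_space_def bounded_iff by auto
  then have C: "\<bar>g x\<bar> \<le> C" if "x \<bullet> \<nu> = 0" for x using that by (simp add: hyperplane_def)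
  define A where "A = C + 1"
  have g_bound: "\<bar>g x\<bar> < A" if "x \<bullet> \<nu> = 0" for x using C[OF that] by (simp add: A_def)
  have A: "A > 0" using g_bound[of 0] by simp
  note jets = bounded_viscosity_solution_jets[OF \<nu> u]
  have bound: "\<bar>u \<epsilon> x\<bar> \<le> A" if "\<epsilon> > 0" "x \<in> closed_strip \<nu> 1" for \<epsilon> x
  proof -
    have "\<bar>u \<epsilon> x\<bar> \<le> A * (1 - x \<bullet> \<nu>)"
      by (rule bounded_viscosity_solution_bound[OF F F0 \<nu> u[OF that(1)] g_bound that(2)]) simp
    also have "\<dots> \<le> A * 1" using that A by (intro mult_left_mono) (auto simp: closed_strip_def)
    finally show ?thesis by simp
  qed
  have H_strip: "x \<in> closed_strip \<nu> 1" if "x \<in> ?H" for x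
    using that by (simp add: closed_strip_def hyperplane_def)
  have H0: "0 \<in> ?H" by (simp add: hyperplane_def)
  define S where "S = (\<lambda>\<epsilon>. SUP x\<in>?H. u \<epsilon> x)"
  define I where "I = (\<lambda>\<epsilon>. INF x\<in>?H. u \<epsilon> x)"
  have S: "u \<epsilon> x \<le> S \<epsilon>" and I: "I \<epsilon> \<le> u \<epsilon> x" if "\<epsilon> > 0" "x \<bullet> \<nu> = 0" for \<epsilon> x
  proof -
    have "bdd_above (u \<epsilon> ` ?H)" "bdd_below (u \<epsilon> ` ?H)"
      using bound[OF that(1) H_strip] by (auto intro!: bdd_aboveI2[of _ _ A] bdd_belowI2[of _ "- A"] simp: abs_le_iff minus_le_iff)
    then show "u \<epsilon> x \<le> S \<epsilon>" "I \<epsilon> \<le> u \<epsilon> x"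
      unfolding S_def I_def using that by (auto intro!: cSUP_upper cINF_lower simp: hyperplane_def)
  qed
  have upper: "u \<epsilon> x \<le> S \<epsilon> * (1 - x \<bullet> \<nu>)" and lower: "I \<epsilon> * (1 - x \<bullet> \<nu>) \<le> u \<epsilon> x"
    if "\<epsilon> > 0" "x \<in> closed_strip \<nu> 1" for \<epsilon> x
  proof -
    note j = jets[OF that(1)]
    show "u \<epsilon> x \<le> S \<epsilon> * (1 - x \<bullet> \<nu>)"
      by (rule profile_upper_bound[OF F F0 \<nu> j(1) _ j(3) _ S[OF that(1)] that(2), of A])
        (use bound[OF that(1)] j(5) in \<open>auto simp: abs_le_iff\<close>)
    have "- u \<epsilon> x \<le> - I \<epsilon> * (1 - x \<bullet> \<nu>)"
      by (rule profile_upper_bound[OF F' F0' \<nu> continuous_on_minus[OF j(1)] _ j(4) _ _ that(2), of A])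
        (use bound[OF that(1)] j(5) I[OF that(1)] in \<open>auto simp: abs_le_iff\<close>)
    then show "I \<epsilon> * (1 - x \<bullet> \<nu>) \<le> u \<epsilon> x" by simp
  qed
  \<comment> \<open>Going from \<open>\<epsilon>\<close> to a smaller \<open>\<epsilon>'\<close> shrinks the range of the boundary values: \<open>x / \<epsilon>\<close> and
    \<open>(\<epsilon>' / \<epsilon>) x / \<epsilon>'\<close> are the same point, so both solutions see the same data after scaling by \<open>\<epsilon>' / \<epsilon>\<close>.\<close>
  have between: "I \<epsilon> \<le> u \<epsilon>' y \<and> u \<epsilon>' y \<le> S \<epsilon>" if \<epsilon>: "0 < \<epsilon>'" "\<epsilon>' \<le> \<epsilon>" and y: "y \<bullet> \<nu> = 0" for \<epsilon> \<epsilon>' y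
  proof -
    have pos: "\<epsilon> > 0" using \<epsilon> by simp
    have s: "0 < \<epsilon>' / \<epsilon>" "\<epsilon>' / \<epsilon> \<le> 1" using \<epsilon> pos by auto
    note j = jets[OF pos] and j' = jets[OF \<epsilon>(1)]
    have h: "continuous_on ?H (\<lambda>x. g (x /\<^sub>R \<epsilon>))"
      by (rule continuous_on_compose2[OF g_cont]) (auto intro!: continuous_intros simp: hyperplane_def)
    have same: "((\<epsilon>' / \<epsilon>) *\<^sub>R x) /\<^sub>R \<epsilon>' = x /\<^sub>R \<epsilon>" for x :: "real ^ 'n"
      using \<epsilon> by (simp add: divide_inverse)
    have "u \<epsilon>' y \<le> S \<epsilon>"
    proof (rule sup_boundary_value_monotone[OF F hom \<nu> s j'(1) _ j'(3) j'(5) j(1) _ j(4) j(5) h _ S[OF pos] y, where M = A])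
      show "g (((\<epsilon>' / \<epsilon>) *\<^sub>R x) /\<^sub>R \<epsilon>') = g (x /\<^sub>R \<epsilon>)" for x unfolding same ..
    qed (simp_all add: bound[OF \<epsilon>(1)] bound[OF pos])
    moreover have "- u \<epsilon>' y \<le> - I \<epsilon>"
    proof (rule sup_boundary_value_monotone[OF F' hom' \<nu> s continuous_on_minus[OF j'(1)] _ j'(4) _
          continuous_on_minus[OF j(1)] _ _ _ continuous_on_minus[OF h] _ _ y, where M = A])
      show "- g (((\<epsilon>' / \<epsilon>) *\<^sub>R x) /\<^sub>R \<epsilon>') = - g (x /\<^sub>R \<epsilon>)" for x unfolding same ..
      show "jet_subsolution \<nu> 1 (dual_operator (dual_operator F)) (\<lambda>x. - (- g (x /\<^sub>R \<epsilon>))) (\<lambda>x. - (- u \<epsilon> x))"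
        using j(3) by simp
      show "\<bar>- u \<epsilon>' x\<bar> \<le> A" "\<bar>- u \<epsilon> x\<bar> \<le> A" if "x \<in> closed_strip \<nu> 1" for x
        using bound[OF \<epsilon>(1) that] bound[OF pos that] by simp_all
      show "- u \<epsilon>' x = 0" "- u \<epsilon> x = 0" if "x \<bullet> \<nu> = 1" for x using j(5)[OF that] j'(5)[OF that] by simp_all
      show "- u \<epsilon> x \<le> - I \<epsilon>" if "x \<bullet> \<nu> = 0" for x using I[OF pos that] by simp
    qed
    ultimately show ?thesis by simp
  qed
  have I_le_S: "I \<epsilon> \<le> S \<epsilon>'" if "\<epsilon> > 0" "\<epsilon>' > 0" for \<epsilon> \<epsilon>'
    using between[of \<epsilon>' \<epsilon> 0] between[of \<epsilon> \<epsilon>' 0] S[OF that(2), of 0] I[OF that(1), of 0] that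
    by (cases "\<epsilon>' \<le> \<epsilon>") auto
  \<comment> \<open>The common limit of \<open>S\<close> and \<open>I\<close>; it lies between \<open>I \<epsilon>\<close> and \<open>S \<epsilon>\<close> for every \<open>\<epsilon>\<close>.\<close>
  define m where "m = (INF \<epsilon>\<in>{0<..}. S \<epsilon>)"
  have m: "I \<epsilon> \<le> m" "m \<le> S \<epsilon>" if "\<epsilon> > 0" for \<epsilon>
  proof -
    show "I \<epsilon> \<le> m" unfolding m_def using I_le_S[OF that] by (intro cINF_greatest) auto
    show "m \<le> S \<epsilon>" unfolding m_def using I_le_S[of 1] that by (intro cINF_lower bdd_belowI2[of _ "I 1"]) auto
  qed
  define ubar where "ubar = (\<lambda>x. (- m) * (x \<bullet> \<nu> - 1))"
  note cs = closure_strip[OF \<nu> zero_less_one]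
  have conv: "uniform_limit (closed_strip \<nu> 1) u ubar (at_right 0)"
    unfolding uniform_limit_iff
  proof (intro allI impI)
    fix e :: real assume e: "e > 0"
    obtain \<epsilon>0 where \<epsilon>0: "\<epsilon>0 > 0"
      "\<And>\<epsilon> x y. 0 < \<epsilon> \<Longrightarrow> \<epsilon> \<le> \<epsilon>0 \<Longrightarrow> x \<bullet> \<nu> = 0 \<Longrightarrow> y \<bullet> \<nu> = 0 \<Longrightarrow> u \<epsilon> x - u \<epsilon> y \<le> e / 2"
      using boundary_oscillation_vanishes[OF F F0 \<nu> g_cont g_bound assms(8) u, of "e / 2"] e by (metis half_gt_zero)
    have "\<bar>u \<epsilon> x - ubar x\<bar> < e" if \<epsilon>: "0 < \<epsilon>" "\<epsilon> < \<epsilon>0" and x: "x \<in> closed_strip \<nu> 1" for \<epsilon> x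
    proof -
      have "u \<epsilon> z - e / 2 \<le> I \<epsilon>" if "z \<in> ?H" for z
        unfolding I_def
      proof (rule cINF_greatest)
        show "u \<epsilon> z - e / 2 \<le> u \<epsilon> y" if y: "y \<in> ?H" for y
          using \<epsilon>0(2)[of \<epsilon> z y] \<epsilon> y \<open>z \<in> ?H\<close> by (simp add: hyperplane_def)
      qed (use H0 in blast)
      then have "S \<epsilon> \<le> I \<epsilon> + e / 2"
        unfolding S_def using H0 by (intro cSUP_least) (auto simp: diff_le_eq)
      moreover have "(S \<epsilon> - m) * (1 - x \<bullet> \<nu>) \<le> (S \<epsilon> - m) * 1" "(m - I \<epsilon>) * (1 - x \<bullet> \<nu>) \<le> (m - I \<epsilon>) * 1"
        using m[OF \<epsilon>(1)] x by (auto intro!: mult_left_mono simp: closed_strip_def simp del: mult_1_right)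
      ultimately show ?thesis
        using upper[OF \<epsilon>(1) x] lower[OF \<epsilon>(1) x] m[OF \<epsilon>(1)] e unfolding ubar_def abs_less_iff
        by (auto simp: algebra_simps)
    qed
    then show "\<forall>\<^sub>F \<epsilon> in at_right 0. \<forall>x\<in>closed_strip \<nu> 1. dist (u \<epsilon> x) (ubar x) < e"
      unfolding eventually_at_right_field dist_real_def using \<epsilon>0(1) by (intro exI[of _ \<epsilon>0]) auto
  qed
  have sol: "bounded_viscosity_solution \<nu> 1 F (\<lambda>_. - m) ubar"
    unfolding ubar_def by (rule linear_bounded_viscosity_solution[OF F F0 \<nu>])
  show ?thesis
    unfolding cs
  proof (rule ex1I[of _ "- m"])
    show "\<exists>ubar. bounded_viscosity_solution \<nu> 1 F (\<lambda>_. - m) ubar \<and>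
        (\<forall>v. bounded_viscosity_solution \<nu> 1 F (\<lambda>_. - m) v \<longrightarrow> (\<forall>x\<in>closed_strip \<nu> 1. v x = ubar x)) \<and>
        uniform_limit (closed_strip \<nu> 1) u ubar (at_right 0)"
    proof (intro exI[of _ ubar] conjI allI impI ballI)
      show "v x = ubar x" if "bounded_viscosity_solution \<nu> 1 F (\<lambda>_. - m) v" "x \<in> closed_strip \<nu> 1" for v x
        unfolding ubar_def by (rule constant_data_solution_unique[OF F F0 \<nu> that])
    qed (fact sol conv)+
  next
    fix c assume "\<exists>w. bounded_viscosity_solution \<nu> 1 F (\<lambda>_. c) w \<and>
        (\<forall>v. bounded_viscosity_solution \<nu> 1 F (\<lambda>_. c) v \<longrightarrow> (\<forall>x\<in>closed_strip \<nu> 1. v x = w x)) \<and>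
        uniform_limit (closed_strip \<nu> 1) u w (at_right 0)"
    then obtain w where w: "bounded_viscosity_solution \<nu> 1 F (\<lambda>_. c) w" "uniform_limit (closed_strip \<nu> 1) u w (at_right 0)"
      by blast
    have zero: "(0 :: real ^ 'n) \<in> closed_strip \<nu> 1" by (simp add: closed_strip_def)
    \<comment> \<open>The limit at the origin determines the slope.\<close>
    have "w 0 = ubar 0"
      by (rule tendsto_unique[OF trivial_limit_at_right_real tendsto_uniform_limitI[OF w(2) zero] tendsto_uniform_limitI[OF conv zero]])
    moreover have "w 0 = - c" using constant_data_solution_unique[OF F F0 \<nu> w(1) zero] by simp
    ultimately show "c = - m" by (simp add: ubar_def)
  qed
qed
end
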